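(* Let $G:=\mathrm{Aut}(p(\mathcal M))$, let $G'$ be its derived (commutator) subgroup, and let $K:=\ker(\psi^*_p)$. For each $h\in K$ and $a\models p$ there is $h'\in G'$ such that $h(a)=h'(a)$. Thus $K$ (which contains $G'$) is the normal subgroup of $G$ consisting of all automorphisms fixing (setwise) all orbits of elements of $p(\mathcal M)$ under the action of $G'$, and $H^*_1(p)=G/K$ (i.e. $\psi^*_p$ induces an isomorphism $G/K\cong H_1^*(p)$).
   Context: **Setting.** $T$ is a complete theory and $\mathcal M=\mathcal M^{\mathrm{eq}}$ a large saturated (monster) model; sets and tuples are small, tuples possibly infinite; $a\equiv b$ means equality of types over $\emptyset$. Fix an $\mathrm{Aut}(\mathcal M)$-invariant ternary relation $A\perp^*_C D$ between small sets satisfying, for all sets: (finite character) $A\perp^*_CD$ iff $a\perp^*_Cd$ for all finite tuples $a\in A$, $d\in D$; (normality) $A\perp^*_CD$ implies $A\perp^*_C\mathrm{acl}(DC)$; (symmetry) $A\perp^*_CD$ iff $D\perp^*_CA$; (transitivity) for $E\subseteq C\subseteq D$, $A\perp^*_ED$ iff $A\perp^*_EC$ and $A\perp^*_CD$; (extension) for $E\subseteq C$ there is $A'\equiv_E A$ with $A'\perp^*_EC$. A family is $*$-independent over $C$ if each member is $*$-independent over $C$ from the union of the others; no mention of $C$ means over $\emptyset$. Fix a strong type $p$ over $B=\mathrm{acl}(B)$; the elements of $B$ are named by constants, so that $B=\mathrm{acl}(\emptyset)=\mathrm{dcl}(\emptyset)$ and "over $\emptyset$" means "over $B$". It is assumed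 that $p=\mathrm{tp}(a)$ where either $a$ enumerates $\mathrm{acl}(a)$, or $\mathrm{acl}(a)=\mathrm{dcl}(a)$. **Simplices and homology.** For a finite $s\subset\omega$, the power set $\mathcal P(s)$ is a category with one morphism $u\to v$ when $u\subseteq v$ and none otherwise. $\mathcal C$ is the category of small subsets of $\mathcal M$ containing $B$, with elementary maps over $B$ as morphisms. For a functor $f$ write $f^u_v:f(u)\to f(v)$ for the image of $u\to v$, and $f^u_v(u)$ for the set $f^u_v[f(u)]$. An $n$-simplex of $p$ is a functor $f:\mathcal P(s)\to\mathcal C$ with $|s|=n+1$ such that $f(\emptyset)=B$, each $f(\{i\})$ is of the form $\mathrm{acl}(b)$ with $b\models p$, and for nonempty $u\subseteq s$, $f(u)=\mathrm{acl}(\bigcup_{i\in u}f^{\{i\}}_u(\{i\}))$ and $\{f^{\{i\}}_u(\{i\}): i\in u\}$ is $*$-independent over $B$. Put $\mathrm{supp}(f)=s$. $C_n$ is the free abelian group on $n$-simplices ($n$-chains). For $s=\{s_0<\dots<s_n\}$ put $\partial^i f=f\restriction\mathcal P(s\setminus\{s_i\})$, $\partial f=\sum_{i}(-1)^i\partial^i f$ (extended linearly), and $H^*_n(p)=\ker\partial_n/\mathrm{Im}\,\partial_{n+1}$; $[c]$ is the class of a cycle $c$. **Shells and the bracket $[a,b]$.** A $1$-shell is a $1$-chain $s=f_0-f_1+f_2$ of $1$-simplices with $\partial^if_j=\partial^{j-1}f_i$ for $0\le i<j\le 2$; its support (the union of the supports of the $f_i$) is $\{n_0<n_1<n_2\}$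 and we write $s=f_{12}-f_{02}+f_{01}$ with $\mathrm{supp}(f_{ij})=\{n_i,n_j\}$. A representation of $s$ is a quadruple $(a_0,a_1,a_2,a_3)$ of realizations of $p$ such that, for some realizations $e_i\models p$ with $\mathrm{acl}(e_i)$ equal to the common vertex set $f_{jk}(\{n_i\})$ ($i=0,1,2$), writing $e_i^{jk}$ for the image of $e_i$ under the map $f_{jk}(\{n_i\})\to f_{jk}(\{n_j,n_k\})$, one has $a_0a_1\equiv e_0^{01}e_1^{01}$, $a_1a_2\equiv e_1^{12}e_2^{12}$, $a_3a_2\equiv e_0^{02}e_2^{02}$. Then $(a_0,a_3)$ is called an endpoint pair of $s$. Every pair $(a,b)$ of realizations of $p$ is an endpoint pair of some $1$-shell with support $\{0,1,2\}$, and the class of such a shell in $H_1^*(p)$ depends only on $(a,b)$; it is denoted $[a,b]$. **The map $\psi^*_p$.** $\mathrm{Aut}(p(\mathcal M))=\{\sigma\restriction p(\mathcal M):\sigma\in\mathrm{Aut}(\mathcal M)\}$, and $\psi^*_p:\mathrm{Aut}(p(\mathcal M))\to H^*_1(p)$ is the surjective homomorphism $\sigma\mapsto[a,\sigma(a)]$, for some/any $a\models p$ (it does not depend on $a$). *)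

theory Defs
  imports
    "HOL-Library.FuncSet"
    "HOL-Library.Equipollence"
    "HOL-Algebra.Free_Abelian_Groups"
    "HOL-Algebra.Generated_Groups"
    "HOL-Algebra.Group_Action"
    "HOL-Algebra.Bij"
begin

section \<open>Many-sorted first-order logic\<close>

text \<open>
  The type \<open>'s\<close> is the set of sorts. A variable carries its sort, so that substituting or
  valuating is well-sorted when \<open>v x\<close> has sort \<open>fst x\<close>. The universe of a structure is the whole
  type \<open>'m\<close>, partitioned into sorts by \<open>sort_of\<close>; the function and relation symbols in use are the
  members of \<open>funs\<close> and \<open>rels\<close> (which may be empty), and interpretations matter only on well-sorted
  arguments.
\<close>

type_synonym 's var = "'s \<times> nat"

datatype ('s, 'f) trm = V "'s var" | F 'f "('s, 'f) trm list"

datatype ('s, 'f, 'r) fml =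
    FEq "('s, 'f) trm" "('s, 'f) trm"
  | FRel 'r "('s, 'f) trm list"
  | FNot "('s, 'f, 'r) fml"
  | FAnd "('s, 'f, 'r) fml" "('s, 'f, 'r) fml"
  | FEx "'s var" "('s, 'f, 'r) fml"

record ('s, 'f, 'r) lang =
  funs :: "'f set"
  rels :: "'r set"
  fdom :: "'f \<Rightarrow> 's list"
  fcod :: "'f \<Rightarrow> 's"
  rdom :: "'r \<Rightarrow> 's list"

record ('s, 'f, 'r, 'm) struct = "('s, 'f, 'r) lang" +
  sort_of :: "'m \<Rightarrow> 's"
  fint :: "'f \<Rightarrow> 'm list \<Rightarrow> 'm"
  rint :: "'r \<Rightarrow> 'm list \<Rightarrow> bool"

fun tsort :: "('s, 'f, 'r, 'z) lang_scheme \<Rightarrow> ('s, 'f) trm \<Rightarrow> 's" where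
  "tsort L (V x) = fst x"
| "tsort L (F f ts) = fcod L f"

fun wf_trm :: "('s, 'f, 'r, 'z) lang_scheme \<Rightarrow> ('s, 'f) trm \<Rightarrow> bool" where
  "wf_trm L (V x) \<longleftrightarrow> True"
| "wf_trm L (F f ts) \<longleftrightarrow> f \<in> funs L \<and> map (tsort L) ts = fdom L f \<and> (\<forall>t\<in>set ts. wf_trm L t)"

primrec wf_fml :: "('s, 'f, 'r, 'z) lang_scheme \<Rightarrow> ('s, 'f, 'r) fml \<Rightarrow> bool" where
  "wf_fml L (FEq t t') \<longleftrightarrow> wf_trm L t \<and> wf_trm L t' \<and> tsort L t = tsort L t'"
| "wf_fml L (FRel r ts) \<longleftrightarrow> r \<in> rels L \<and> map (tsort L) ts = rdom L r \<and> (\<forall>t\<in>set ts. wf_trm L t)"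
| "wf_fml L (FNot \<phi>) \<longleftrightarrow> wf_fml L \<phi>"
| "wf_fml L (FAnd \<phi> \<chi>) \<longleftrightarrow> wf_fml L \<phi> \<and> wf_fml L \<chi>"
| "wf_fml L (FEx x \<phi>) \<longleftrightarrow> wf_fml L \<phi>"

fun tvars :: "('s, 'f) trm \<Rightarrow> 's var set" where
  "tvars (V x) = {x}"
| "tvars (F f ts) = (\<Union>t\<in>set ts. tvars t)"

primrec fvars :: "('s, 'f, 'r) fml \<Rightarrow> 's var set" where
  "fvars (FEq t t') = tvars t \<union> tvars t'"
| "fvars (FRel r ts) = (\<Union>t\<in>set ts. tvars t)"
| "fvars (FNot \<phi>) = fvars \<phi>"
| "fvars (FAnd \<phi> \<chi>) = fvars \<phi> \<union> fvars \<chi>"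
| "fvars (FEx x \<phi>) = fvars \<phi> - {x}"

fun teval :: "('s, 'f, 'r, 'm) struct \<Rightarrow> ('s var \<Rightarrow> 'm) \<Rightarrow> ('s, 'f) trm \<Rightarrow> 'm" where
  "teval M v (V x) = v x"
| "teval M v (F f ts) = fint M f (map (teval M v) ts)"

primrec sat :: "('s, 'f, 'r, 'm) struct \<Rightarrow> ('s var \<Rightarrow> 'm) \<Rightarrow> ('s, 'f, 'r) fml \<Rightarrow> bool" where
  "sat M v (FEq t t') \<longleftrightarrow> teval M v t = teval M v t'"
| "sat M v (FRel r ts) \<longleftrightarrow> rint M r (map (teval M v) ts)"
| "sat M v (FNot \<phi>) \<longleftrightarrow> \<not> sat M v \<phi>"
| "sat M v (FAnd \<phi> \<chi>) \<longleftrightarrow> sat M v \<phi> \<and> sat M v \<chi>"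
| "sat M v (FEx x \<phi>) \<longleftrightarrow> (\<exists>c. sort_of M c = fst x \<and> sat M (v(x := c)) \<phi>)"

text \<open>Every sort is nonempty, as usual.\<close>

definition wf_struct :: "('s, 'f, 'r, 'm) struct \<Rightarrow> bool" where
  "wf_struct M \<longleftrightarrow> surj (sort_of M) \<and>
     (\<forall>f\<in>funs M. \<forall>xs. map (sort_of M) xs = fdom M f \<longrightarrow> sort_of M (fint M f xs) = fcod M f)"

definition sentences :: "('s, 'f, 'r, 'z) lang_scheme \<Rightarrow> ('s, 'f, 'r) fml set" where
  "sentences L = {\<phi>. wf_fml L \<phi> \<and> fvars \<phi> = {}}"

text \<open>Theories are taken to be deductively closed; consistency comes from having a model.\<close>

definition complete_theory :: "('s, 'f, 'r, 'z) lang_scheme \<Rightarrow> ('s, 'f, 'r) fml set \<Rightarrow> bool" where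
  "complete_theory L T \<longleftrightarrow> T \<subseteq> sentences L \<and> (\<forall>\<phi>\<in>sentences L. \<phi> \<in> T \<or> FNot \<phi> \<in> T)"

definition is_model :: "('s, 'f, 'r, 'm) struct \<Rightarrow> ('s, 'f, 'r) fml set \<Rightarrow> bool" where
  "is_model M T \<longleftrightarrow> wf_struct M \<and> (\<forall>\<phi>\<in>T. \<forall>v. sat M v \<phi>)"

section \<open>Types, closures, automorphisms\<close>

text \<open>
  A pair \<open>(\<phi>, v)\<close> stands for the formula obtained from \<open>\<phi>\<close> by replacing each free variable \<open>x\<close> by
  \<open>v x\<close>, which is either \<open>Inl i\<close>, the type variable of index \<open>i\<close>, or \<open>Inr c\<close>, the parameter \<open>c\<close>.
  \<open>pformulas M \<tau> A\<close> are the formulas over \<open>A\<close> whose type variable of index \<open>i\<close> has sort \<open>\<tau> i\<close>.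
  A tuple is a function from an index type into \<open>'m\<close>.
\<close>

type_synonym ('s, 'f, 'r, 'x, 'm) pformula = "('s, 'f, 'r) fml \<times> ('s var \<Rightarrow> 'x + 'm)"

definition pformulas ::
  "('s, 'f, 'r, 'm) struct \<Rightarrow> ('x \<Rightarrow> 's) \<Rightarrow> 'm set \<Rightarrow> ('s, 'f, 'r, 'x, 'm) pformula set" where
  "pformulas M \<tau> A = {(\<phi>, v). wf_fml M \<phi> \<and>
     (\<forall>x\<in>fvars \<phi>. case v x of Inl i \<Rightarrow> \<tau> i = fst x | Inr c \<Rightarrow> c \<in> A \<and> sort_of M c = fst x)}"

definition holds ::
  "('s, 'f, 'r, 'm) struct \<Rightarrow> ('x \<Rightarrow> 'm) \<Rightarrow> ('s, 'f, 'r, 'x, 'm) pformula \<Rightarrow> bool" where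
  "holds M a q \<longleftrightarrow> sat M (\<lambda>x. case_sum a id (snd q x)) (fst q)"

definition tp ::
  "('s, 'f, 'r, 'm) struct \<Rightarrow> 'm set \<Rightarrow> ('x \<Rightarrow> 'm) \<Rightarrow> ('s, 'f, 'r, 'x, 'm) pformula set" where
  "tp M A a = {q \<in> pformulas M (\<lambda>i. sort_of M (a i)) A. holds M a q}"

definition solutions ::
  "('s, 'f, 'r, 'm) struct \<Rightarrow> 's \<Rightarrow> ('s, 'f, 'r, unit, 'm) pformula \<Rightarrow> 'm set" where
  "solutions M s q = {c. sort_of M c = s \<and> holds M (\<lambda>_. c) q}"

definition acl :: "('s, 'f, 'r, 'm) struct \<Rightarrow> 'm set \<Rightarrow> 'm set" where
  "acl M A = {b. \<exists>q\<in>pformulas M (\<lambda>_. sort_of M b) A.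
     b \<in> solutions M (sort_of M b) q \<and> finite (solutions M (sort_of M b) q)}"

definition dcl :: "('s, 'f, 'r, 'm) struct \<Rightarrow> 'm set \<Rightarrow> 'm set" where
  "dcl M A = {b. \<exists>q\<in>pformulas M (\<lambda>_. sort_of M b) A. solutions M (sort_of M b) q = {b}}"

definition elementary_on :: "('s, 'f, 'r, 'm) struct \<Rightarrow> 'm set \<Rightarrow> ('m \<Rightarrow> 'm) \<Rightarrow> bool" where
  "elementary_on M X g \<longleftrightarrow> (\<forall>x\<in>X. sort_of M (g x) = sort_of M x) \<and>
     (\<forall>\<phi> v. wf_fml M \<phi> \<and> (\<forall>x\<in>fvars \<phi>. v x \<in> X \<and> sort_of M (v x) = fst x) \<longrightarrow>
        (sat M v \<phi> \<longleftrightarrow> sat M (g \<circ> v) \<phi>))"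

definition equiv_over :: "('s, 'f, 'r, 'm) struct \<Rightarrow> 'm set \<Rightarrow> 'm set \<Rightarrow> 'm set \<Rightarrow> bool" where
  "equiv_over M E A A' \<longleftrightarrow>
     (\<exists>g. elementary_on M (A \<union> E) g \<and> (\<forall>e\<in>E. g e = e) \<and> g ` A = A')"

definition Aut :: "('s, 'f, 'r, 'm) struct \<Rightarrow> ('m \<Rightarrow> 'm) set" where
  "Aut M = {\<sigma>. bij \<sigma> \<and> (\<forall>x. sort_of M (\<sigma> x) = sort_of M x) \<and>
     (\<forall>f\<in>funs M. \<forall>xs. map (sort_of M) xs = fdom M f \<longrightarrow> \<sigma> (fint M f xs) = fint M f (map \<sigma> xs)) \<and>
     (\<forall>r\<in>rels M. \<forall>xs. map (sort_of M) xs = rdom M r \<longrightarrow> (rint M r (map \<sigma> xs) \<longleftrightarrow> rint M r xs))}"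

definition AutOver :: "('s, 'f, 'r, 'm) struct \<Rightarrow> 'm set \<Rightarrow> ('m \<Rightarrow> 'm) set" where
  "AutOver M B = {\<sigma> \<in> Aut M. \<forall>b\<in>B. \<sigma> b = b}"

section \<open>The monster model\<close>

definition small :: "'m set \<Rightarrow> bool" where
  "small A \<longleftrightarrow> A \<prec> (UNIV :: 'm set)"

text \<open>Large means of cardinality greater than the number of formulas of the language.\<close>

definition monster :: "('s, 'f, 'r, 'm) struct \<Rightarrow> bool" where
  "monster M \<longleftrightarrow> {\<phi>. wf_fml M \<phi>} \<prec> (UNIV :: 'm set) \<and>
     (\<forall>A s. \<forall>\<Sigma> \<subseteq> pformulas M (\<lambda>_::unit. s) A. small A \<longrightarrow>
        (\<forall>\<Phi> \<subseteq> \<Sigma>. finite \<Phi> \<longrightarrow> (\<exists>c. \<forall>q\<in>\<Phi>. c \<in> solutions M s q)) \<longrightarrow>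
        (\<exists>c. \<forall>q\<in>\<Sigma>. c \<in> solutions M s q))"

definition definable0 :: "('s, 'f, 'r, 'm) struct \<Rightarrow> 's list \<Rightarrow> 'm list set \<Rightarrow> bool" where
  "definable0 M ss D \<longleftrightarrow> (\<exists>\<phi>. wf_fml M \<phi> \<and> fvars \<phi> \<subseteq> {(ss ! i, i) | i. i < length ss} \<and>
     D = {xs. map (sort_of M) xs = ss \<and> sat M (\<lambda>x. xs ! snd x) \<phi>})"

text \<open>
  \<open>M = M\<^sup>e\<^sup>q\<close>: every class of a \<open>\<emptyset>\<close>-definable equivalence relation \<open>E\<close> on a finite product of sorts
  is, uniformly and \<open>\<emptyset>\<close>-definably, an element of \<open>M\<close>.
\<close>

definition has_imaginaries :: "('s, 'f, 'r, 'm) struct \<Rightarrow> bool" where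
  "has_imaginaries M \<longleftrightarrow> (\<forall>ss E. equiv {xs. map (sort_of M) xs = ss} E \<longrightarrow>
     definable0 M (ss @ ss) {xs @ ys | xs ys. (xs, ys) \<in> E} \<longrightarrow>
     (\<exists>s h. (\<forall>xs. map (sort_of M) xs = ss \<longrightarrow> sort_of M (h xs) = s) \<and>
        definable0 M (ss @ [s]) {xs @ [h xs] | xs. map (sort_of M) xs = ss} \<and>
        (\<forall>xs ys. map (sort_of M) xs = ss \<longrightarrow> map (sort_of M) ys = ss \<longrightarrow>
           ((xs, ys) \<in> E \<longleftrightarrow> h xs = h ys))))"

section \<open>The independence relation\<close>

text \<open>\<open>ind A C D\<close> reads: \<open>A\<close> is \<open>*\<close>-independent from \<open>D\<close> over \<open>C\<close>.\<close>

type_synonym 'm indrel = "'m set \<Rightarrow> 'm set \<Rightarrow> 'm set \<Rightarrow> bool"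

definition star_independence :: "('s, 'f, 'r, 'm) struct \<Rightarrow> 'm indrel \<Rightarrow> bool" where
  "star_independence M ind \<longleftrightarrow>
     (\<forall>\<sigma>\<in>Aut M. \<forall>A C D. small A \<and> small C \<and> small D \<longrightarrow>
        (ind (\<sigma> ` A) (\<sigma> ` C) (\<sigma> ` D) \<longleftrightarrow> ind A C D)) \<and>
     (\<forall>A C D. small A \<and> small C \<and> small D \<longrightarrow>
        (ind A C D \<longleftrightarrow> (\<forall>A\<^sub>0 D\<^sub>0. finite A\<^sub>0 \<and> A\<^sub>0 \<subseteq> A \<and> finite D\<^sub>0 \<and> D\<^sub>0 \<subseteq> D \<longrightarrow> ind A\<^sub>0 C D\<^sub>0))) \<and>
     (\<forall>A C D. small A \<and> small C \<and> small D \<longrightarrow> ind A C D \<longrightarrow> ind A C (acl M (D \<union> C))) \<and>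
     (\<forall>A C D. small A \<and> small C \<and> small D \<longrightarrow> (ind A C D \<longleftrightarrow> ind D C A)) \<and>
     (\<forall>A E C D. small A \<and> small D \<and> E \<subseteq> C \<and> C \<subseteq> D \<longrightarrow>
        (ind A E D \<longleftrightarrow> ind A E C \<and> ind A C D)) \<and>
     (\<forall>A E C. small A \<and> small C \<and> E \<subseteq> C \<longrightarrow> (\<exists>A'. equiv_over M E A A' \<and> ind A' E C))"

definition independent_family :: "'m indrel \<Rightarrow> 'm set \<Rightarrow> 'i set \<Rightarrow> ('i \<Rightarrow> 'm set) \<Rightarrow> bool" where
  "independent_family ind C I X \<longleftrightarrow> (\<forall>i\<in>I. ind (X i) C (\<Union>j\<in>I - {i}. X j))"

section \<open>Functors on power sets\<close>

text \<open>
  A functor from \<open>\<P>(s)\<close> to the category of small sets containing \<open>B\<close> with elementary maps over \<open>B\<close>,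
  stored with its domain \<open>s = supp f\<close>. To make equality of functors extensional, \<open>obj\<close> and \<open>mor\<close>
  take fixed values off \<open>\<P>(s)\<close>, and each \<open>mor f u v\<close> is undefined off \<open>obj f u\<close>.
\<close>

record 'm pfunctor =
  supp :: "nat set"
  obj :: "nat set \<Rightarrow> 'm set"
  mor :: "nat set \<Rightarrow> nat set \<Rightarrow> 'm \<Rightarrow> 'm"

definition C_obj :: "'m set \<Rightarrow> 'm set set" where
  "C_obj B = {X. small X \<and> B \<subseteq> X}"

definition C_hom :: "('s, 'f, 'r, 'm) struct \<Rightarrow> 'm set \<Rightarrow> 'm set \<Rightarrow> 'm set \<Rightarrow> ('m \<Rightarrow> 'm) set" where
  "C_hom M B X Y = {g \<in> X \<rightarrow>\<^sub>E Y. elementary_on M X g \<and> (\<forall>b\<in>B. g b = b)}"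

definition is_pfunctor :: "('s, 'f, 'r, 'm) struct \<Rightarrow> 'm set \<Rightarrow> 'm pfunctor \<Rightarrow> bool" where
  "is_pfunctor M B f \<longleftrightarrow> finite (supp f) \<and>
     (\<forall>u. u \<subseteq> supp f \<longrightarrow> obj f u \<in> C_obj B) \<and>
     (\<forall>u v. u \<subseteq> v \<and> v \<subseteq> supp f \<longrightarrow> mor f u v \<in> C_hom M B (obj f u) (obj f v)) \<and>
     (\<forall>u. u \<subseteq> supp f \<longrightarrow> mor f u u = (\<lambda>x\<in>obj f u. x)) \<and>
     (\<forall>u v w. u \<subseteq> v \<and> v \<subseteq> w \<and> w \<subseteq> supp f \<longrightarrow>
        mor f u w = compose (obj f u) (mor f v w) (mor f u v)) \<and>
     (\<forall>u. \<not> u \<subseteq> supp f \<longrightarrow> obj f u = {}) \<and>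
     (\<forall>u v. \<not> (u \<subseteq> v \<and> v \<subseteq> supp f) \<longrightarrow> mor f u v = (\<lambda>_. undefined))"

definition pfunctor_restrict :: "'m pfunctor \<Rightarrow> nat set \<Rightarrow> 'm pfunctor" where
  "pfunctor_restrict f t = \<lparr>supp = t,
     obj = (\<lambda>u. if u \<subseteq> t then obj f u else {}),
     mor = (\<lambda>u v. if u \<subseteq> v \<and> v \<subseteq> t then mor f u v else (\<lambda>_. undefined))\<rparr>"

section \<open>Homology\<close>

text \<open>
  The elements of \<open>B\<close> are not added to the language; instead \<open>B\<close> is a parameter of all notions, so
  that \<open>acl M (X \<union> B)\<close> is the algebraic closure of \<open>X\<close> in the language with names for \<open>B\<close>.
\<close>

definition realizations ::
  "('s, 'f, 'r, 'm) struct \<Rightarrow> 'm set \<Rightarrow> ('s, 'f, 'r, 'x, 'm) pformula set \<Rightarrow> ('x \<Rightarrow> 'm) set" where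
  "realizations M B p = {b. tp M B b = p}"

context
  fixes M :: "('s, 'f, 'r, 'm) struct"
    and B :: "'m set"
    and ind :: "'m indrel"
    and p :: "('s, 'f, 'r, 'x, 'm) pformula set"
begin

definition simplex :: "nat \<Rightarrow> 'm pfunctor \<Rightarrow> bool" where
  "simplex n f \<longleftrightarrow> is_pfunctor M B f \<and> card (supp f) = n + 1 \<and>
     obj f {} = B \<and>
     (\<forall>i\<in>supp f. \<exists>b\<in>realizations M B p. obj f {i} = acl M (range b \<union> B)) \<and>
     (\<forall>u. u \<noteq> {} \<and> u \<subseteq> supp f \<longrightarrow>
        obj f u = acl M ((\<Union>i\<in>u. mor f {i} u ` obj f {i}) \<union> B) \<and>
        independent_family ind B u (\<lambda>i. mor f {i} u ` obj f {i}))"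

definition face :: "nat \<Rightarrow> 'm pfunctor \<Rightarrow> 'm pfunctor" where
  "face i f = pfunctor_restrict f (supp f - {sorted_list_of_set (supp f) ! i})"

definition chain_group :: "nat \<Rightarrow> ('m pfunctor \<Rightarrow>\<^sub>0 int) monoid" where
  "chain_group n = free_Abelian_group {f. simplex n f}"

definition boundary :: "nat \<Rightarrow> ('m pfunctor \<Rightarrow>\<^sub>0 int) \<Rightarrow> ('m pfunctor \<Rightarrow>\<^sub>0 int)" where
  "boundary n c = (if n = 0 then 0
     else frag_extend (\<lambda>f. \<Sum>i\<le>n. frag_cmul ((-1) ^ i) (frag_of (face i f))) c)"

definition cycle_group :: "nat \<Rightarrow> ('m pfunctor \<Rightarrow>\<^sub>0 int) monoid" where
  "cycle_group n =
     (chain_group n)\<lparr>carrier := {c \<in> carrier (chain_group n). boundary n c = 0}\<rparr>"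

definition boundaries :: "nat \<Rightarrow> ('m pfunctor \<Rightarrow>\<^sub>0 int) set" where
  "boundaries n = boundary (Suc n) ` carrier (chain_group (Suc n))"

definition homology :: "nat \<Rightarrow> ('m pfunctor \<Rightarrow>\<^sub>0 int) set monoid" where
  "homology n = cycle_group n Mod boundaries n"

definition homology_class :: "nat \<Rightarrow> ('m pfunctor \<Rightarrow>\<^sub>0 int) \<Rightarrow> ('m pfunctor \<Rightarrow>\<^sub>0 int) set" where
  "homology_class n c = boundaries n #>\<^bsub>cycle_group n\<^esub> c"

text \<open>
  A 1-shell \<open>f\<^sub>0 - f\<^sub>1 + f\<^sub>2\<close> is given by its simplices \<open>f 0, f 1, f 2\<close>, which its chain determines
  because their supports differ. In double-index notation \<open>f 0 = f\<^sub>1\<^sub>2\<close>, \<open>f 1 = f\<^sub>0\<^sub>2\<close>, \<open>f 2 = f\<^sub>0\<^sub>1\<close>.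
\<close>

definition one_shell :: "(nat \<Rightarrow> 'm pfunctor) \<Rightarrow> bool" where
  "one_shell f \<longleftrightarrow> (\<forall>j\<le>2. simplex 1 (f j)) \<and>
     (\<forall>i j. i < j \<and> j \<le> 2 \<longrightarrow> face i (f j) = face (j - 1) (f i))"

definition shell_chain :: "(nat \<Rightarrow> 'm pfunctor) \<Rightarrow> ('m pfunctor \<Rightarrow>\<^sub>0 int)" where
  "shell_chain f = frag_of (f 0) - frag_of (f 1) + frag_of (f 2)"

definition shell_supp :: "(nat \<Rightarrow> 'm pfunctor) \<Rightarrow> nat set" where
  "shell_supp f = (\<Union>j\<le>2. supp (f j))"

definition pair_equiv :: "('x \<Rightarrow> 'm) \<times> ('x \<Rightarrow> 'm) \<Rightarrow> ('x \<Rightarrow> 'm) \<times> ('x \<Rightarrow> 'm) \<Rightarrow> bool" where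
  "pair_equiv a b \<longleftrightarrow> tp M B (case_sum (fst a) (snd a)) = tp M B (case_sum (fst b) (snd b))"

definition representation ::
  "(nat \<Rightarrow> 'm pfunctor) \<Rightarrow> ('x \<Rightarrow> 'm) \<Rightarrow> ('x \<Rightarrow> 'm) \<Rightarrow> ('x \<Rightarrow> 'm) \<Rightarrow> ('x \<Rightarrow> 'm) \<Rightarrow> bool" where
  "representation f a\<^sub>0 a\<^sub>1 a\<^sub>2 a\<^sub>3 \<longleftrightarrow> {a\<^sub>0, a\<^sub>1, a\<^sub>2, a\<^sub>3} \<subseteq> realizations M B p \<and>
     (\<exists>n\<^sub>0 n\<^sub>1 n\<^sub>2 e\<^sub>0 e\<^sub>1 e\<^sub>2. n\<^sub>0 < n\<^sub>1 \<and> n\<^sub>1 < n\<^sub>2 \<and>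
        supp (f 0) = {n\<^sub>1, n\<^sub>2} \<and> supp (f 1) = {n\<^sub>0, n\<^sub>2} \<and> supp (f 2) = {n\<^sub>0, n\<^sub>1} \<and>
        {e\<^sub>0, e\<^sub>1, e\<^sub>2} \<subseteq> realizations M B p \<and>
        acl M (range e\<^sub>0 \<union> B) = obj (f 2) {n\<^sub>0} \<and>
        acl M (range e\<^sub>1 \<union> B) = obj (f 2) {n\<^sub>1} \<and>
        acl M (range e\<^sub>2 \<union> B) = obj (f 0) {n\<^sub>2} \<and>
        pair_equiv (a\<^sub>0, a\<^sub>1) (mor (f 2) {n\<^sub>0} {n\<^sub>0, n\<^sub>1} \<circ> e\<^sub>0, mor (f 2) {n\<^sub>1} {n\<^sub>0, n\<^sub>1} \<circ> e\<^sub>1) \<and>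
        pair_equiv (a\<^sub>1, a\<^sub>2) (mor (f 0) {n\<^sub>1} {n\<^sub>1, n\<^sub>2} \<circ> e\<^sub>1, mor (f 0) {n\<^sub>2} {n\<^sub>1, n\<^sub>2} \<circ> e\<^sub>2) \<and>
        pair_equiv (a\<^sub>3, a\<^sub>2) (mor (f 1) {n\<^sub>0} {n\<^sub>0, n\<^sub>2} \<circ> e\<^sub>0, mor (f 1) {n\<^sub>2} {n\<^sub>0, n\<^sub>2} \<circ> e\<^sub>2))"

definition endpoint_pair :: "(nat \<Rightarrow> 'm pfunctor) \<Rightarrow> ('x \<Rightarrow> 'm) \<Rightarrow> ('x \<Rightarrow> 'm) \<Rightarrow> bool" where
  "endpoint_pair f a b \<longleftrightarrow> (\<exists>a\<^sub>1 a\<^sub>2. representation f a a\<^sub>1 a\<^sub>2 b)"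

definition bracket :: "('x \<Rightarrow> 'm) \<Rightarrow> ('x \<Rightarrow> 'm) \<Rightarrow> ('m pfunctor \<Rightarrow>\<^sub>0 int) set" where
  "bracket a b = (THE c. \<exists>f. one_shell f \<and> shell_supp f = {0, 1, 2} \<and> endpoint_pair f a b \<and>
     c = homology_class 1 (shell_chain f))"

definition AutP :: "(('x \<Rightarrow> 'm) \<Rightarrow> ('x \<Rightarrow> 'm)) monoid" where
  "AutP = (BijGroup (realizations M B p))
     \<lparr>carrier := {\<lambda>a\<in>realizations M B p. \<sigma> \<circ> a | \<sigma>. \<sigma> \<in> AutOver M B}\<rparr>"

text \<open>The value \<open>[a, \<sigma>(a)]\<close> common to all realizations \<open>a\<close> of \<open>p\<close>.\<close>

definition psi :: "(('x \<Rightarrow> 'm) \<Rightarrow> ('x \<Rightarrow> 'm)) \<Rightarrow> ('m pfunctor \<Rightarrow>\<^sub>0 int) set" where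
  "psi g = (THE c. \<forall>a\<in>realizations M B p. c = bracket a (g a))"

end

end

theory Submission
  imports Defs
begin

text \<open>
  Write \<open>X\<close> for the set of realizations of \<open>p\<close>, on which \<open>G\<close> acts transitively, and \<open>K\<^sub>0\<close> for the group
  of all \<open>g\<close> in \<open>G\<close> that preserve every orbit of \<open>G'\<close>. Since \<open>G/G'\<close> is abelian and acts transitively
  on the \<open>G'\<close>-orbits, \<open>g\<close> belongs to \<open>K\<^sub>0\<close> as soon as \<open>g a \<in> G' a\<close> for one \<open>a\<close> (lemma \<open>K0_I\<close>), and
  \<open>G/K\<^sub>0\<close> is abelian and acts simply transitively on these orbits. So a pair \<open>(a, b)\<close> determines an
  element \<open>delta a b\<close> of \<open>G/K\<^sub>0\<close>, the class of the \<open>g\<close> with \<open>g a = b\<close>; it is additive and invariant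
  under automorphisms. All of the theorem follows once \<open>H\<^sub>1(p)\<close> is identified with \<open>G/K\<^sub>0\<close> in such a
  way that \<open>[a, b]\<close> corresponds to \<open>delta a b\<close>.

  From \<open>H\<^sub>1(p)\<close> to \<open>G/K\<^sub>0\<close>: choose for each vertex a realization generating it, and send a 1-simplex to
  \<open>delta a b\<close>, where \<open>a\<close> and \<open>b\<close> are the images of the realizations chosen for its two vertices.
  Elementary maps preserve \<open>delta\<close>, so the boundary of a 2-simplex is sent to the unit by additivity
  (lemma \<open>D_Bd\<close>).

  From \<open>G/K\<^sub>0\<close> to \<open>H\<^sub>1(p)\<close>: by the hypothesis on \<open>p\<close>, an automorphism over \<open>B\<close> is determined on
  \<open>acl (aB)\<close> by its action on \<open>a\<close> (lemma \<open>fixes_cl\<close>), so a 1-simplex amounts to two indexed vertices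
  and the type of an independent pair \<open>(a, b)\<close>. Three 1-simplices coming from an independent triple
  bound a 2-simplex (lemma \<open>triangle\<close>). Given \<open>a\<close> and \<open>b\<close>, independent or not, placed at two indexed
  vertices, one obtains a 1-chain from the one to the other by passing through a realization \<open>c\<close>
  independent from \<open>a\<close> and \<open>b\<close> at a vertex of larger index. Modulo boundaries it does not depend on
  \<open>c\<close>: compare two choices with a third one, independent from everything (lemma \<open>path_unique\<close>). For
  the same reason these chains, called \<open>transport\<close>, are additive, invariant under automorphisms, and
  extend the 1-simplices. At a fixed vertex they give loops \<open>tau a b\<close>, and \<open>g \<mapsto> tau a (g a)\<close> is a
  homomorphism to an abelian group. Every 1-simplex is homologous to \<open>tau a b\<close> plus a term
  \<open>mu i e - mu j e'\<close> depending on its two vertices only. In a cycle the latter terms cancel, so every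
  cycle is homologous to some \<open>tau a b\<close> (lemma \<open>cycle_tau\<close>), while a 1-shell with endpoint pair
  \<open>(a, b)\<close> is homologous to \<open>tau a b\<close> (lemma \<open>shell_tau\<close>). In particular \<open>[a, b]\<close> is well defined, \<open>\<psi>\<close>
  is a surjective homomorphism, and its kernel contains \<open>G'\<close> and stabilizers, hence \<open>K\<^sub>0\<close>; it is
  contained in \<open>K\<^sub>0\<close> because \<open>tau a (g a)\<close> is mapped to the class of \<open>g\<close> in \<open>G/K\<^sub>0\<close>.

  The model theory used is: saturated models are homogeneous (lemma \<open>tp_eq_conjugate\<close>), which rests on
  a back-and-forth construction along a well-order of the universe; over small sets, algebraic means
  having finitely many conjugates, whence algebraic closure is idempotent; and the closure of a small
  set is small.
\<close>

section \<open>Manipulating formulas\<close>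

fun rename_trm :: "('s var \<Rightarrow> 's var) \<Rightarrow> ('s, 'f) trm \<Rightarrow> ('s, 'f) trm" where
  "rename_trm \<rho> (V x) = V (\<rho> x)"
| "rename_trm \<rho> (F f ts) = F f (map (rename_trm \<rho>) ts)"

text \<open>Renaming of all variables, the bound ones included; there is no capture for injective \<open>\<rho>\<close>.\<close>

primrec rename_fml :: "('s var \<Rightarrow> 's var) \<Rightarrow> ('s, 'f, 'r) fml \<Rightarrow> ('s, 'f, 'r) fml" where
  "rename_fml \<rho> (FEq t t') = FEq (rename_trm \<rho> t) (rename_trm \<rho> t')"
| "rename_fml \<rho> (FRel r ts) = FRel r (map (rename_trm \<rho>) ts)"
| "rename_fml \<rho> (FNot \<phi>) = FNot (rename_fml \<rho> \<phi>)"
| "rename_fml \<rho> (FAnd \<phi> \<chi>) = FAnd (rename_fml \<rho> \<phi>) (rename_fml \<rho> \<chi>)"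
| "rename_fml \<rho> (FEx x \<phi>) = FEx (\<rho> x) (rename_fml \<rho> \<phi>)"

lemma teval_rename: "teval M v (rename_trm \<rho> t) = teval M (v \<circ> \<rho>) t"
proof (induction t)
  case (F f ts)
  then show ?case by (auto intro!: arg_cong[where f = "fint M f"])
qed simp

lemma tvars_rename: "tvars (rename_trm \<rho> t) = \<rho> ` tvars t"
  by (induction t) auto

lemma fvars_rename: "inj \<rho> \<Longrightarrow> fvars (rename_fml \<rho> \<phi>) = \<rho> ` fvars \<phi>"
  by (induction \<phi>) (auto simp: tvars_rename inj_eq)

lemma tsort_rename: "(\<And>x. fst (\<rho> x) = fst x) \<Longrightarrow> tsort L (rename_trm \<rho> t) = tsort L t"
  by (cases t) auto

lemma wf_trm_rename:
  assumes "\<And>x. fst (\<rho> x) = fst x"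
  shows "wf_trm L (rename_trm \<rho> t) \<longleftrightarrow> wf_trm L t"
proof (induction t)
  case (F f ts)
  have "tsort L \<circ> rename_trm \<rho> = tsort L"
    by (rule ext) (simp add: tsort_rename assms)
  then show ?case using F by auto
qed simp

lemma wf_fml_rename:
  assumes "\<And>x. fst (\<rho> x) = fst x"
  shows "wf_fml L (rename_fml \<rho> \<phi>) \<longleftrightarrow> wf_fml L \<phi>"
  by (induction \<phi>) (auto simp: wf_trm_rename[OF assms] tsort_rename[OF assms] comp_def)

lemma sat_rename:
  assumes "inj \<rho>" and "\<And>x. fst (\<rho> x) = fst x"
  shows "sat M v (rename_fml \<rho> \<phi>) \<longleftrightarrow> sat M (v \<circ> \<rho>) \<phi>"
proof (induction \<phi> arbitrary: v)
  case (FRel r ts)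
  have "teval M v \<circ> rename_trm \<rho> = teval M (v \<circ> \<rho>)"
    by (simp add: teval_rename fun_eq_iff)
  then show ?case by (simp only: rename_fml.simps sat.simps map_map)
next
  case (FEx x \<phi>)
  have "v(\<rho> x := c) \<circ> \<rho> = (v \<circ> \<rho>)(x := c)" for c
    using assms(1) by (auto simp: fun_eq_iff inj_eq)
  then show ?case
    by (simp only: rename_fml.simps sat.simps FEx.IH assms(2))
qed (simp_all add: teval_rename)

lemma teval_cong: "(\<And>x. x \<in> tvars t \<Longrightarrow> v x = w x) \<Longrightarrow> teval M v t = teval M w t"
proof (induction t)
  case (F f ts)
  have "teval M v t = teval M w t" if "t \<in> set ts" for t
    using that F.prems by (intro F.IH) auto
  then have "map (teval M v) ts = map (teval M w) ts" by simp
  then show ?case by (simp only: teval.simps)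
qed simp

lemma sat_cong: "(\<And>x. x \<in> fvars \<phi> \<Longrightarrow> v x = w x) \<Longrightarrow> sat M v \<phi> \<longleftrightarrow> sat M w \<phi>"
proof (induction \<phi> arbitrary: v w)
  case (FEq t t')
  then show ?case using teval_cong[of t v w M] teval_cong[of t' v w M] by auto
next
  case (FRel r ts)
  then have "teval M v t = teval M w t" if "t \<in> set ts" for t
    using that by (intro teval_cong) auto
  then have "map (teval M v) ts = map (teval M w) ts" by simp
  then show ?case by (simp only: sat.simps)
next
  case (FAnd \<phi> \<chi>)
  have "sat M v \<phi> \<longleftrightarrow> sat M w \<phi>"
    by (rule FAnd.IH(1)) (simp add: FAnd.prems)
  moreover have "sat M v \<chi> \<longleftrightarrow> sat M w \<chi>"
    by (rule FAnd.IH(2)) (simp add: FAnd.prems)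
  ultimately show ?case by (simp only: sat.simps)
next
  case (FEx x \<phi>)
  have "sat M (v(x := c)) \<phi> \<longleftrightarrow> sat M (w(x := c)) \<phi>" for c
    using FEx.prems by (intro FEx.IH) auto
  then show ?case by (simp only: sat.simps)
next
  case (FNot \<phi>)
  have "sat M v \<phi> \<longleftrightarrow> sat M w \<phi>"
    using FNot.prems by (intro FNot.IH) auto
  then show ?case by (simp only: sat.simps)
qed

lemma finite_tvars: "finite (tvars t)"
  by (induction t) auto

lemma finite_fvars: "finite (fvars \<phi>)"
  by (induction \<phi>) (auto simp: finite_tvars)

text \<open>
  A pair \<open>(\<phi>, u)\<close> stands for the formula \<open>\<phi>\<close> with the elements of an arbitrary type \<open>'y\<close> put for
  its free variables through \<open>u\<close>; an element \<open>y\<close> has sort \<open>\<tau> y\<close>, and only elements of \<open>Y\<close> occur.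
  With \<open>'y = 'x + 'm\<close> this gives formulas over parameters, with \<open>'y = 'm \<times> 'm\<close> it serves to speak
  of partial elementary maps.
\<close>

definition instances ::
  "('s, 'f, 'r, 'm) struct \<Rightarrow> ('y \<Rightarrow> 's) \<Rightarrow> 'y set \<Rightarrow> (('s, 'f, 'r) fml \<times> ('s var \<Rightarrow> 'y)) set" where
  "instances M \<tau> Y = {(\<phi>, u). wf_fml M \<phi> \<and> (\<forall>x\<in>fvars \<phi>. u x \<in> Y \<and> \<tau> (u x) = fst x)}"

definition holds_at ::
  "('s, 'f, 'r, 'm) struct \<Rightarrow> ('y \<Rightarrow> 'm) \<Rightarrow> ('s, 'f, 'r) fml \<times> ('s var \<Rightarrow> 'y) \<Rightarrow> bool" where
  "holds_at M w q \<longleftrightarrow> sat M (w \<circ> snd q) (fst q)"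

lemma instances_iff:
  "q \<in> instances M \<tau> Y \<longleftrightarrow>
    wf_fml M (fst q) \<and> (\<forall>x\<in>fvars (fst q). snd q x \<in> Y \<and> \<tau> (snd q x) = fst x)"
  by (simp add: instances_def case_prod_beta)

lemma instances_var:
  assumes "q \<in> instances M \<tau> Y" "x \<in> fvars (fst q)"
  shows "snd q x \<in> Y" "\<tau> (snd q x) = fst x"
  using assms by (simp_all add: instances_iff)

lemma pformulas_eq_instances:
  "pformulas M \<tau> A = instances M (case_sum \<tau> (sort_of M)) (UNIV <+> A)"
  unfolding pformulas_def instances_def
  by (auto split: sum.splits)

lemma holds_eq_holds_at: "holds M a q \<longleftrightarrow> holds_at M (case_sum a id) q"
  by (simp add: holds_def holds_at_def comp_def)

lemma instances_mono: "Y \<subseteq> Z \<Longrightarrow> instances M \<tau> Y \<subseteq> instances M \<tau> Z"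
  unfolding instances_def by auto

lemma instances_not: "(\<phi>, u) \<in> instances M \<tau> Y \<Longrightarrow> (FNot \<phi>, u) \<in> instances M \<tau> Y"
  unfolding instances_def by auto

lemma instances_eq:
  assumes "y \<in> Y" "z \<in> Y" "\<tau> y = \<tau> z"
  obtains q where "q \<in> instances M \<tau> Y" "\<And>w. holds_at M w q \<longleftrightarrow> w y = w z"
    "snd q ` fvars (fst q) \<subseteq> {y, z}"
proof -
  define u where "u x = (if x = (\<tau> y, 0::nat) then y else z)" for x
  have "(FEq (V (\<tau> y, 0)) (V (\<tau> y, 1)), u) \<in> instances M \<tau> Y"
    using assms by (auto simp: instances_def u_def)
  then show thesis by (rule that) (auto simp: holds_at_def u_def)
qed

lemma instances_and:
  fixes M :: "('s, 'f, 'r, 'm) struct"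
  assumes "q \<in> instances M \<tau> Y" "q' \<in> instances M \<tau> Y"
  shows "\<exists>p\<in>instances M \<tau> Y. \<forall>w. holds_at M w p \<longleftrightarrow> holds_at M w q \<and> holds_at M w q'"
proof -
  obtain \<phi> u \<phi>' u' where q: "q = (\<phi>, u)" "q' = (\<phi>', u')" by fastforce
  \<comment> \<open>the free variables of the two formulas are made disjoint\<close>
  define \<rho> :: "nat \<Rightarrow> 's var \<Rightarrow> 's var" where "\<rho> i x = (fst x, 2 * snd x + i)" for i x
  have inj: "inj (\<rho> i)" for i unfolding \<rho>_def inj_def by auto
  have fst_\<rho>: "fst (\<rho> i x) = fst x" for i x by (simp add: \<rho>_def)
  define t where "t x = (if even (snd x) then u (fst x, snd x div 2) else u' (fst x, snd x div 2))"
    for x :: "'s var"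
  have t: "t (\<rho> 0 x) = u x" "t (\<rho> (Suc 0) x) = u' x" for x
    by (simp_all add: t_def \<rho>_def)
  let ?\<chi> = "FAnd (rename_fml (\<rho> 0) \<phi>) (rename_fml (\<rho> (Suc 0)) \<phi>')"
  have "(?\<chi>, t) \<in> instances M \<tau> Y"
    using assms unfolding q
    by (auto simp: instances_def wf_fml_rename[OF fst_\<rho>] fvars_rename[OF inj] t fst_\<rho>)
  moreover have "w \<circ> t \<circ> \<rho> 0 = w \<circ> u" "w \<circ> t \<circ> \<rho> (Suc 0) = w \<circ> u'" for w :: "'a \<Rightarrow> 'm"
    by (auto simp: t)
  ultimately show ?thesis
    unfolding q by (intro bexI[of _ "(?\<chi>, t)"]) (simp_all add: holds_at_def sat_rename[OF inj fst_\<rho>])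
qed

text \<open>For empty \<open>\<Phi>\<close> this needs a valid sentence.\<close>

lemma instances_conj:
  assumes "finite \<Phi>" "\<Phi> \<subseteq> instances M \<tau> Y"
  shows "\<exists>p\<in>instances M \<tau> Y. \<forall>w. holds_at M w p \<longleftrightarrow> (\<forall>q\<in>\<Phi>. holds_at M w q)"
  using assms
proof (induction \<Phi> rule: finite_induct)
  case empty
  let ?\<chi> = "FNot (FEx undefined (FNot (FEq (V undefined) (V undefined))))"
  show ?case by (rule bexI[of _ "(?\<chi>, undefined)"]) (auto simp: instances_def holds_at_def)
next
  case (insert q \<Phi>)
  then obtain p where p: "p \<in> instances M \<tau> Y"
    "\<And>w. holds_at M w p \<longleftrightarrow> (\<forall>q\<in>\<Phi>. holds_at M w q)" by blast
  have "q \<in> instances M \<tau> Y" using insert.prems by blast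
  from instances_and[OF this p(1)] show ?case using p(2) by auto
qed

text \<open>
  \<open>ident z ys \<phi>\<close> says that \<open>\<phi>\<close> holds when all variables in \<open>ys\<close> take the value of \<open>z\<close>. It replaces
  the substitution of \<open>z\<close> for \<open>ys\<close>, which could capture variables.
\<close>

primrec ident :: "'s var \<Rightarrow> 's var list \<Rightarrow> ('s, 'f, 'r) fml \<Rightarrow> ('s, 'f, 'r) fml" where
  "ident z [] \<phi> = \<phi>"
| "ident z (y # ys) \<phi> = FEx y (FAnd (FEq (V y) (V z)) (ident z ys \<phi>))"

lemma sat_ident:
  assumes "z \<notin> set ys" "\<And>y. y \<in> set ys \<Longrightarrow> fst y = fst z" "sort_of M (v z) = fst z"
  shows "sat M v (ident z ys \<phi>) \<longleftrightarrow> sat M (\<lambda>x. if x \<in> set ys then v z else v x) \<phi>"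
  using assms
proof (induction ys arbitrary: v)
  case (Cons y ys)
  have zy: "z \<noteq> y" "fst y = fst z" using Cons.prems by auto
  have "sat M v (ident z (y # ys) \<phi>) \<longleftrightarrow> sat M (v(y := v z)) (ident z ys \<phi>)"
    using zy Cons.prems(3) by auto
  also have "\<dots> \<longleftrightarrow> sat M (\<lambda>x. if x \<in> set ys then (v(y := v z)) z else (v(y := v z)) x) \<phi>"
    using zy Cons.prems by (intro Cons.IH) auto
  also have "(\<lambda>x. if x \<in> set ys then (v(y := v z)) z else (v(y := v z)) x)
    = (\<lambda>x. if x \<in> set (y # ys) then v z else v x)"
    using zy by auto
  finally show ?case .
qed simp

lemma wf_ident: "wf_fml L \<phi> \<Longrightarrow> (\<And>y. y \<in> set ys \<Longrightarrow> fst y = fst z) \<Longrightarrow> wf_fml L (ident z ys \<phi>)"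
  by (induction ys) auto

lemma fvars_ident: "z \<notin> set ys \<Longrightarrow> fvars (ident z ys \<phi>) \<subseteq> insert z (fvars \<phi> - set ys)"
  by (induction ys) auto

text \<open>
  Quantifying over \<open>y\<close>: the variables for which \<open>y\<close> is put are identified with one fresh variable.
\<close>

lemma instances_ex:
  fixes M :: "('s, 'f, 'r, 'm) struct"
  assumes "q \<in> instances M \<tau> Y"
  shows "\<exists>p\<in>instances M \<tau> (Y - {y}). \<forall>w. holds_at M w p \<longleftrightarrow>
    (\<exists>c. sort_of M c = \<tau> y \<and> holds_at M (w(y := c)) q)"
proof -
  obtain \<phi> u where q: "q = (\<phi>, u)" by fastforce
  define \<rho> :: "'s var \<Rightarrow> 's var" where "\<rho> x = (fst x, Suc (snd x))" for x
  have inj: "inj \<rho>" unfolding \<rho>_def inj_def by auto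
  have fst_\<rho>: "fst (\<rho> x) = fst x" for x by (simp add: \<rho>_def)
  define t where "t x = u (fst x, snd x - 1)" for x :: "'s var"
  have t: "t (\<rho> x) = u x" for x by (simp add: t_def \<rho>_def)
  define z :: "'s var" where "z = (\<tau> y, 0)"
  define \<phi>' where "\<phi>' = rename_fml \<rho> \<phi>"
  have fv: "fvars \<phi>' = \<rho> ` fvars \<phi>" by (simp add: \<phi>'_def fvars_rename[OF inj])
  obtain ys where ys: "set ys = {x \<in> fvars \<phi>'. t x = y}"
    using finite_list[of "{x \<in> fvars \<phi>'. t x = y}"] finite_fvars[of \<phi>'] by auto
  have zn: "z \<notin> fvars \<phi>'" by (auto simp: fv z_def \<rho>_def)
  have zys: "z \<notin> set ys" using zn ys by auto
  have \<phi>': "t x \<in> Y" "\<tau> (t x) = fst x" if "x \<in> fvars \<phi>'" for x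
    using that assms unfolding q by (auto simp: fv t fst_\<rho> instances_def)
  have sys: "fst x = fst z" if "x \<in> set ys" for x
    using that \<phi>'(2)[of x] by (simp add: ys z_def)
  let ?\<chi> = "FEx z (ident z ys \<phi>')"
  have wf: "wf_fml M ?\<chi>"
    using assms sys unfolding q by (auto intro!: wf_ident simp: \<phi>'_def wf_fml_rename[OF fst_\<rho>] instances_def)
  have sub: "fvars ?\<chi> \<subseteq> fvars \<phi>' - set ys"
    using fvars_ident[OF zys] by auto
  have "(?\<chi>, t) \<in> instances M \<tau> (Y - {y})"
    using wf sub \<phi>' ys unfolding instances_def by blast
  moreover have "holds_at M w (?\<chi>, t) \<longleftrightarrow> (\<exists>c. sort_of M c = \<tau> y \<and> holds_at M (w(y := c)) (\<phi>, u))" for w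
  proof -
    have "sat M ((w \<circ> t)(z := c)) (ident z ys \<phi>') \<longleftrightarrow> holds_at M (w(y := c)) (\<phi>, u)"
      if c: "sort_of M c = \<tau> y" for c
    proof -
      let ?v = "(w \<circ> t)(z := c)"
      have "sat M ?v (ident z ys \<phi>') \<longleftrightarrow> sat M (\<lambda>x. if x \<in> set ys then ?v z else ?v x) \<phi>'"
        using zys sys c by (intro sat_ident) (auto simp: z_def)
      also have "\<dots> \<longleftrightarrow> sat M (w(y := c) \<circ> t) \<phi>'"
        using zn by (intro sat_cong) (auto simp: ys)
      also have "\<dots> \<longleftrightarrow> sat M (w(y := c) \<circ> t \<circ> \<rho>) \<phi>"
        by (simp add: \<phi>'_def sat_rename[OF inj fst_\<rho>])
      also have "w(y := c) \<circ> t \<circ> \<rho> = w(y := c) \<circ> u" by (auto simp: t)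
      finally show ?thesis unfolding holds_at_def fst_conv snd_conv .
    qed
    then show ?thesis
      unfolding holds_at_def fst_conv snd_conv sat.simps z_def by auto
  qed
  ultimately show ?thesis unfolding q by blast
qed

section \<open>Homogeneity of the monster model\<close>

unbundle cardinal_syntax

lemma lepoll_iff_ordLeq: "A \<lesssim> B \<longleftrightarrow> |A| \<le>o |B|"
  by (simp add: lepoll_def card_of_ordLeq[symmetric])

lemma lesspoll_iff_ordLess: "A \<prec> B \<longleftrightarrow> |A| <o |B|"
  unfolding lesspoll_def lepoll_iff_ordLeq eqpoll_iff_card_of_ordIso
  using ordLeq_iff_ordLess_or_ordIso not_ordLess_ordIso ordLess_imp_ordLeq by blast

lemma small_iff: "small (A :: 'm set) \<longleftrightarrow> |A| <o |UNIV :: 'm set|"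
  by (simp add: small_def lesspoll_iff_ordLess)

lemma small_subset: "small A \<Longrightarrow> A' \<subseteq> A \<Longrightarrow> small A'"
  unfolding small_iff using card_of_mono1 ordLeq_ordLess_trans by blast

lemma small_image: "|A| <o |UNIV :: 'm set| \<Longrightarrow> small (f ` A :: 'm set)"
  unfolding small_iff using card_of_image ordLeq_ordLess_trans by blast

text \<open>
  A partial elementary map as a set of pairs; in this form the definition is symmetric in the two
  coordinates, so that extending domains and extending ranges are the same thing.
\<close>

definition partial_elementary :: "('s, 'f, 'r, 'm) struct \<Rightarrow> ('m \<times> 'm) set \<Rightarrow> bool" where
  "partial_elementary M R \<longleftrightarrow> (\<forall>(x, y)\<in>R. sort_of M x = sort_of M y) \<and>
     (\<forall>q\<in>instances M (\<lambda>z. sort_of M (fst z)) R. holds_at M fst q \<longleftrightarrow> holds_at M snd q)"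

lemma partial_elementary_mono: "partial_elementary M R \<Longrightarrow> S \<subseteq> R \<Longrightarrow> partial_elementary M S"
  unfolding partial_elementary_def using instances_mono by blast

lemma partial_elementary_finite_subsets:
  assumes "\<And>S. finite S \<Longrightarrow> S \<subseteq> R \<Longrightarrow> partial_elementary M S"
  shows "partial_elementary M R"
  unfolding partial_elementary_def
proof (intro conjI ballI)
  fix z assume "z \<in> R"
  then have "partial_elementary M {z}" using assms by simp
  then show "case z of (x, y) \<Rightarrow> sort_of M x = sort_of M y"
    by (auto simp: partial_elementary_def)
next
  fix q assume q: "q \<in> instances M (\<lambda>z. sort_of M (fst z)) R"
  let ?S = "snd q ` fvars (fst q)"
  have "?S \<subseteq> R" using q by (auto simp: instances_def)
  then have "partial_elementary M ?S" by (intro assms finite_imageI finite_fvars)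
  moreover have "q \<in> instances M (\<lambda>z. sort_of M (fst z)) ?S"
    using q by (auto simp: instances_def)
  ultimately show "holds_at M fst q \<longleftrightarrow> holds_at M snd q"
    by (simp add: partial_elementary_def)
qed

lemma partial_elementary_sort:
  "partial_elementary M R \<Longrightarrow> (x, y) \<in> R \<Longrightarrow> sort_of M x = sort_of M y"
  unfolding partial_elementary_def by blast

lemma partial_elementary_holds:
  "partial_elementary M R \<Longrightarrow> q \<in> instances M (\<lambda>z. sort_of M (fst z)) R \<Longrightarrow>
    holds_at M fst q \<longleftrightarrow> holds_at M snd q"
  by (simp add: partial_elementary_def)

lemma partial_elementary_converse:
  assumes R: "partial_elementary M R"
  shows "partial_elementary M (R\<inverse>)"
  unfolding partial_elementary_def
proof (intro conjI ballI)
  fix z assume "z \<in> R\<inverse>"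
  then show "case z of (x, y) \<Rightarrow> sort_of M x = sort_of M y"
    using partial_elementary_sort[OF R, of "snd z" "fst z"] by auto
next
  fix q assume q: "q \<in> instances M (\<lambda>z. sort_of M (fst z)) (R\<inverse>)"
  let ?q = "(fst q, prod.swap \<circ> snd q)"
  have "prod.swap (snd q x) \<in> R \<and> sort_of M (fst (prod.swap (snd q x))) = fst x"
    if x: "x \<in> fvars (fst q)" for x
  proof -
    obtain a b where ab: "snd q x = (a, b)" by fastforce
    have ba: "(b, a) \<in> R" "sort_of M a = fst x"
      using instances_var[OF q x] by (simp_all add: ab)
    then show ?thesis using partial_elementary_sort[OF R ba(1)] by (simp add: ab)
  qed
  then have "?q \<in> instances M (\<lambda>z. sort_of M (fst z)) R"
    using q by (simp add: instances_iff)
  then have "holds_at M fst ?q \<longleftrightarrow> holds_at M snd ?q"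
    using R partial_elementary_holds by blast
  then show "holds_at M fst q \<longleftrightarrow> holds_at M snd q"
    by (simp add: holds_at_def comp_def)
qed

lemma partial_elementary_eq_iff:
  assumes "partial_elementary M R" "(x, y) \<in> R" "(x', y') \<in> R"
  shows "x = x' \<longleftrightarrow> y = y'"
proof -
  have eq: "x = x' \<longleftrightarrow> y = y'" if s: "sort_of M x = sort_of M x'"
  proof -
    obtain q where q: "q \<in> instances M (\<lambda>z. sort_of M (fst z)) R"
      "\<And>w. holds_at M w q \<longleftrightarrow> w (x, y) = w (x', y')"
      by (rule instances_eq[of "(x, y)" R "(x', y')" "\<lambda>z. sort_of M (fst z)" M]) (use assms s in simp_all)
    then show ?thesis using partial_elementary_holds[OF assms(1) q(1)] by simp
  qed
  have "sort_of M x = sort_of M y" "sort_of M x' = sort_of M y'"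
    by (rule partial_elementary_sort[OF assms(1,2)], rule partial_elementary_sort[OF assms(1,3)])
  then show ?thesis using eq by metis
qed

lemma partial_elementary_graph:
  "partial_elementary M ((\<lambda>x. (x, g x)) ` X) \<longleftrightarrow> elementary_on M X g"
proof -
  let ?R = "(\<lambda>x. (x, g x)) ` X" and ?\<tau> = "\<lambda>z. sort_of M (fst z)"
  have "(\<forall>q\<in>instances M ?\<tau> ?R. holds_at M fst q \<longleftrightarrow> holds_at M snd q) \<longleftrightarrow>
     (\<forall>\<phi> v. wf_fml M \<phi> \<and> (\<forall>x\<in>fvars \<phi>. v x \<in> X \<and> sort_of M (v x) = fst x) \<longrightarrow>
        (sat M v \<phi> \<longleftrightarrow> sat M (g \<circ> v) \<phi>))" (is "?L \<longleftrightarrow> ?RR")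
  proof
    assume L: ?L
    show ?RR
    proof (intro allI impI)
      fix \<phi> v assume "wf_fml M \<phi> \<and> (\<forall>x\<in>fvars \<phi>. v x \<in> X \<and> sort_of M (v x) = fst x)"
      then have "(\<phi>, \<lambda>x. (v x, g (v x))) \<in> instances M ?\<tau> ?R" by (auto simp: instances_def)
      then have "holds_at M fst (\<phi>, \<lambda>x. (v x, g (v x))) \<longleftrightarrow> holds_at M snd (\<phi>, \<lambda>x. (v x, g (v x)))"
        using L by blast
      then show "sat M v \<phi> \<longleftrightarrow> sat M (g \<circ> v) \<phi>" by (simp add: holds_at_def comp_def)
    qed
  next
    assume R: ?RR
    show ?L
    proof
      fix q assume q: "q \<in> instances M ?\<tau> ?R"
      have g: "fst (snd q x) \<in> X \<and> snd (snd q x) = g (fst (snd q x))" if "x \<in> fvars (fst q)" for x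
        using instances_var(1)[OF q that] by auto
      have "sat M (fst \<circ> snd q) (fst q) \<longleftrightarrow> sat M (g \<circ> (fst \<circ> snd q)) (fst q)"
        using q g by (intro R[rule_format]) (simp add: instances_iff)
      moreover have "sat M (g \<circ> (fst \<circ> snd q)) (fst q) \<longleftrightarrow> sat M (snd \<circ> snd q) (fst q)"
        using g by (intro sat_cong) simp
      ultimately show "holds_at M fst q \<longleftrightarrow> holds_at M snd q" by (simp add: holds_at_def)
    qed
  qed
  then show ?thesis
    unfolding partial_elementary_def elementary_on_def by auto
qed

lemma partial_elementary_chain:
  assumes "\<C> \<noteq> {}" "\<And>R. R \<in> \<C> \<Longrightarrow> partial_elementary M R" "chain\<^sub>\<subseteq> \<C>"
  shows "partial_elementary M (\<Union>\<C>)"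
proof (rule partial_elementary_finite_subsets)
  fix S assume "finite S" "S \<subseteq> \<Union>\<C>"
  then obtain R where "R \<in> \<C>" "S \<subseteq> R"
    using finite_subset_Union_chain[of S \<C> \<C>] assms
    by (auto simp: subset_chain_def chain_subset_def)
  then show "partial_elementary M S" using assms(2) partial_elementary_mono by metis
qed

locale monster_model =
  fixes M :: "('s, 'f, 'r, 'm) struct"
  assumes wf_M: "wf_struct M" and monster_M: "monster M"
begin

lemma formulas_infinite: "infinite {\<phi>. wf_fml M \<phi>}"
proof -
  let ?h = "\<lambda>n. FEq (V (undefined, n)) (V (undefined, n))"
  have "inj ?h" by (auto simp: inj_def)
  then have "infinite (range ?h)" using finite_imageD by blast
  moreover have "range ?h \<subseteq> {\<phi>. wf_fml M \<phi>}" by auto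
  ultimately show ?thesis using finite_subset by blast
qed

lemma formulas_small: "|{\<phi>. wf_fml M \<phi>}| <o |UNIV :: 'm set|"
  using monster_M by (simp add: monster_def lesspoll_iff_ordLess)

lemma infinite_UNIV: "infinite (UNIV :: 'm set)"
  using formulas_infinite formulas_small card_of_ordLeq_infinite ordLess_imp_ordLeq by blast

lemma small_Un: "small (A :: 'm set) \<Longrightarrow> small A' \<Longrightarrow> small (A \<union> A')"
  unfolding small_iff using card_of_Un_ordLess_infinite[OF infinite_UNIV] by blast

lemma small_finite: "finite (A :: 'm set) \<Longrightarrow> small A"
  unfolding small_iff using infinite_UNIV card_of_ordLeq_infinite
  by (metis card_of_Well_order not_ordLeq_iff_ordLess)

lemma small_UN: "finite I \<Longrightarrow> (\<And>i. i \<in> I \<Longrightarrow> small (A i :: 'm set)) \<Longrightarrow> small (\<Union>i\<in>I. A i)"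
  by (induction I rule: finite_induct) (auto intro: small_Un small_finite)

lemma saturation:
  assumes "small A" "\<Sigma> \<subseteq> pformulas M (\<lambda>_::unit. s) A"
    and "\<And>\<Phi>. finite \<Phi> \<Longrightarrow> \<Phi> \<subseteq> \<Sigma> \<Longrightarrow> \<exists>c. sort_of M c = s \<and> (\<forall>q\<in>\<Phi>. holds M (\<lambda>_. c) q)"
  shows "\<exists>c. sort_of M c = s \<and> (\<forall>q\<in>\<Sigma>. holds M (\<lambda>_. c) q)"
proof -
  have "\<exists>c. \<forall>q\<in>\<Phi>. c \<in> solutions M s q" if "\<Phi> \<subseteq> \<Sigma>" "finite \<Phi>" for \<Phi>
    using assms(3)[OF that(2,1)] by (auto simp: solutions_def)
  then have "\<exists>c. \<forall>q\<in>\<Sigma>. c \<in> solutions M s q"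
    using monster_M assms(1,2) unfolding monster_def by blast
  then obtain c where c: "\<forall>q\<in>\<Sigma>. c \<in> solutions M s q" ..
  obtain c0 where "sort_of M c0 = s" using wf_M unfolding wf_struct_def by (metis surjD)
  then show ?thesis using c by (cases "\<Sigma> = {}") (auto simp: solutions_def)
qed

text \<open>The forth step: the type of \<open>b\<close> over the domain, carried to the range, is realized.\<close>

lemma partial_elementary_extend:
  assumes R: "partial_elementary M R" and small: "|R| <o |UNIV :: 'm set|"
  shows "\<exists>c. partial_elementary M (insert (b, c) R)"
proof -
  let ?s = "sort_of M b"
  let ?\<tau> = "case_sum (\<lambda>_::unit. ?s) (\<lambda>z. sort_of M (fst z))"
  let ?b = "case_sum (\<lambda>_::unit. b) fst" and ?c = "\<lambda>c. case_sum (\<lambda>_::unit. c) snd"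
  define T where "T = {q \<in> instances M ?\<tau> (UNIV <+> R). holds_at M ?b q}"
  define h where "h q = (fst q, map_sum (\<lambda>_. ()) snd \<circ> snd q)"
    for q :: "('s, 'f, 'r) fml \<times> ('s var \<Rightarrow> unit + 'm \<times> 'm)"
  have sR: "sort_of M x = sort_of M y" if "(x, y) \<in> R" for x y
    using R that by (rule partial_elementary_sort)
  have h_holds: "holds M (\<lambda>_. c) (h q) \<longleftrightarrow> holds_at M (?c c) q" for c q
  proof -
    have "case_sum (\<lambda>_. c) id (map_sum (\<lambda>_. ()) snd z) = ?c c z" for z :: "unit + 'm \<times> 'm"
      by (cases z) auto
    then show ?thesis by (simp add: holds_def holds_at_def h_def comp_def)
  qed
  have h_pf: "h q \<in> pformulas M (\<lambda>_. ?s) (snd ` R)" if "q \<in> instances M ?\<tau> (UNIV <+> R)" for q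
  proof -
    have "map_sum (\<lambda>_. ()) snd (snd q x) \<in> UNIV <+> snd ` R \<and>
        case_sum (\<lambda>_. ?s) (sort_of M) (map_sum (\<lambda>_. ()) snd (snd q x)) = fst x"
      if x: "x \<in> fvars (fst q)" for x
    proof (cases "snd q x")
      case (Inl i)
      then show ?thesis using instances_var[OF \<open>q \<in> _\<close> x] by auto
    next
      case (Inr z)
      then have "z \<in> R" "sort_of M (fst z) = fst x" using instances_var[OF \<open>q \<in> _\<close> x] by auto
      then show ?thesis using sR[of "fst z" "snd z"] Inr by auto
    qed
    then show ?thesis using that by (simp add: pformulas_eq_instances instances_iff h_def)
  qed
  have fin_sat: "\<exists>c. sort_of M c = ?s \<and> (\<forall>q\<in>\<Phi>. holds_at M (?c c) q)"
    if \<Phi>: "finite \<Phi>" "\<Phi> \<subseteq> T" for \<Phi>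
  proof -
    have "\<Phi> \<subseteq> instances M ?\<tau> (UNIV <+> R)" using \<Phi>(2) by (auto simp: T_def)
    from instances_conj[OF \<Phi>(1) this] obtain \<chi> where \<chi>: "\<chi> \<in> instances M ?\<tau> (UNIV <+> R)"
      "\<And>w. holds_at M w \<chi> \<longleftrightarrow> (\<forall>q\<in>\<Phi>. holds_at M w q)" by blast
    from instances_ex[OF \<chi>(1), of "Inl ()"]
    obtain \<chi>' where \<chi>': "\<chi>' \<in> instances M ?\<tau> ((UNIV <+> R) - {Inl ()})"
      "\<And>w. holds_at M w \<chi>' \<longleftrightarrow> (\<exists>c. sort_of M c = ?s \<and> holds_at M (w(Inl () := c)) \<chi>)"
      by auto
    let ?q = "(fst \<chi>', projr \<circ> snd \<chi>')"
    have t': "\<exists>z\<in>R. snd \<chi>' x = Inr z \<and> sort_of M (fst z) = fst x" if "x \<in> fvars (fst \<chi>')" for x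
      using instances_var[OF \<chi>'(1), of x] that by auto
    have "?q \<in> instances M (\<lambda>z. sort_of M (fst z)) R"
      using \<chi>'(1) t' by (fastforce simp: instances_iff)
    then have "holds_at M fst ?q \<longleftrightarrow> holds_at M snd ?q"
      by (rule partial_elementary_holds[OF R])
    moreover have "holds_at M f ?q \<longleftrightarrow> holds_at M (case_sum g f) \<chi>'"
      for f :: "'m \<times> 'm \<Rightarrow> 'm" and g
      unfolding holds_at_def fst_conv snd_conv using t' by (intro sat_cong) fastforce
    ultimately have eq: "holds_at M ?b \<chi>' \<longleftrightarrow> holds_at M (?c b) \<chi>'" by blast
    have upd: "(case_sum g f)(Inl () := c) = case_sum (\<lambda>_. c) f" for g c and f :: "'m \<times> 'm \<Rightarrow> 'm"
      by (auto simp: fun_eq_iff split: sum.splits)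
    have "holds_at M ?b \<chi>" using \<chi>(2) \<Phi>(2) by (auto simp: T_def)
    then have "holds_at M (?b(Inl () := b)) \<chi>" by (simp only: upd)
    then have "holds_at M (?c b) \<chi>'" using \<chi>'(2) eq by blast
    then obtain c where "sort_of M c = ?s" "holds_at M ((?c b)(Inl () := c)) \<chi>" using \<chi>'(2) by blast
    then show ?thesis using \<chi>(2) by (auto simp only: upd)
  qed
  have "\<exists>c. sort_of M c = ?s \<and> (\<forall>q\<in>h ` T. holds M (\<lambda>_. c) q)"
  proof (rule saturation)
    show "small (snd ` R)" using small by (rule small_image)
    show "h ` T \<subseteq> pformulas M (\<lambda>_. ?s) (snd ` R)" using h_pf by (auto simp: T_def)
    fix \<Phi> assume "finite \<Phi>" "\<Phi> \<subseteq> h ` T"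
    then obtain \<Phi>' where "finite \<Phi>'" "\<Phi>' \<subseteq> T" "\<Phi> = h ` \<Phi>'" by (metis finite_subset_image)
    moreover from this fin_sat obtain c where "sort_of M c = ?s" "\<forall>q\<in>\<Phi>'. holds_at M (?c c) q"
      by blast
    ultimately show "\<exists>c. sort_of M c = ?s \<and> (\<forall>q\<in>\<Phi>. holds M (\<lambda>_. c) q)"
      by (intro exI[of _ c]) (simp add: h_holds)
  qed
  then obtain c where c: "sort_of M c = ?s" "\<And>q. q \<in> T \<Longrightarrow> holds_at M (?c c) q"
    by (auto simp: h_holds)
  have "partial_elementary M (insert (b, c) R)"
    unfolding partial_elementary_def
  proof (intro conjI ballI)
    fix q assume q: "q \<in> instances M (\<lambda>z. sort_of M (fst z)) (insert (b, c) R)"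
    define k where "k z = (if z = (b, c) then Inl () else Inr z)" for z :: "'m \<times> 'm"
    let ?q = "(fst q, k \<circ> snd q)"
    have q': "?q \<in> instances M ?\<tau> (UNIV <+> R)"
    proof -
      have "k (snd q x) \<in> UNIV <+> R \<and> ?\<tau> (k (snd q x)) = fst x" if "x \<in> fvars (fst q)" for x
        using instances_var[OF q that] by (auto simp: k_def)
      then show ?thesis using q by (simp add: instances_iff)
    qed
    then have nq': "(FNot (fst q), k \<circ> snd q) \<in> instances M ?\<tau> (UNIV <+> R)"
      by (rule instances_not)
    have "?b \<circ> k = fst" "?c c \<circ> k = snd" by (auto simp: k_def)
    then have b: "holds_at M ?b (\<phi>, k \<circ> snd q) \<longleftrightarrow> holds_at M fst (\<phi>, snd q)"
      and c': "holds_at M (?c c) (\<phi>, k \<circ> snd q) \<longleftrightarrow> holds_at M snd (\<phi>, snd q)" for \<phi>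
      by (simp_all add: holds_at_def comp_assoc[symmetric])
    have "holds_at M snd q" if "holds_at M fst q"
      using c(2)[of ?q] q' b[of "fst q"] c'[of "fst q"] that by (simp add: T_def)
    moreover have "\<not> holds_at M snd q" if "\<not> holds_at M fst q"
      using c(2)[of "(FNot (fst q), k \<circ> snd q)"] nq' b[of "FNot (fst q)"] c'[of "FNot (fst q)"] that
      by (simp add: T_def holds_at_def)
    ultimately show "holds_at M fst q \<longleftrightarrow> holds_at M snd q" by blast
  qed (use c(1) sR in auto)
  then show ?thesis ..
qed

text \<open>Forth, and back by symmetry.\<close>

lemma partial_elementary_extend_both:
  assumes R: "partial_elementary M R" and small: "|R| <o |UNIV :: 'm set|"
  shows "\<exists>c d. partial_elementary M (insert (b, c) (insert (d, b) R))"
proof -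
  have "R\<inverse> = prod.swap ` R" by force
  then have "|R\<inverse>| \<le>o |R|" using card_of_image[of prod.swap R] by simp
  then have "|R\<inverse>| <o |UNIV :: 'm set|" using small ordLeq_ordLess_trans by blast
  then obtain d where "partial_elementary M (insert (b, d) (R\<inverse>))"
    using partial_elementary_extend partial_elementary_converse[OF R] by blast
  then have "partial_elementary M ((insert (b, d) (R\<inverse>))\<inverse>)" by (rule partial_elementary_converse)
  moreover have "(insert (b, d) (R\<inverse>))\<inverse> = insert (d, b) R" by auto
  ultimately have "partial_elementary M (insert (d, b) R)" by simp
  moreover have "|insert (d, b) R| <o |UNIV :: 'm set|"
  proof -
    have "finite {(d, b)}" by simp
    then have "|{(d, b)}| <o |UNIV :: 'm set|"
      using infinite_UNIV card_of_ordLeq_infinite by (metis card_of_Well_order not_ordLeq_iff_ordLess)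
    then show ?thesis
      using card_of_Un_ordLess_infinite[OF infinite_UNIV _ small, of "{(d, b)}"] by simp
  qed
  ultimately show ?thesis using partial_elementary_extend by blast
qed

text \<open>
  Back and forth along a well-order of the universe whose proper initial segments are small.
\<close>

lemma partial_elementary_total:
  assumes R: "partial_elementary M R" and small: "|R| <o |UNIV :: 'm set|"
  obtains S where "partial_elementary M S" "R \<subseteq> S" "\<And>b. \<exists>c d. (b, c) \<in> S \<and> (d, b) \<in> S"
proof -
  let ?r = "|UNIV :: 'm set|"
  have Co: "Card_order ?r" and Wo: "Well_order ?r" and F: "Field ?r = UNIV"
    by (simp_all add: card_of_Card_order card_of_Well_order)
  have wo: "wo_rel ?r" using Wo by (simp add: wo_rel_def)
  \<comment> \<open>\<open>f x = (c, d)\<close> records that the pairs \<open>(x, c)\<close> and \<open>(d, x)\<close> are added at stage \<open>x\<close>; \<open>U f x\<close> is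
    what has been reached before stage \<open>x\<close>, and \<open>E f x\<close> what is reached after it\<close>
  define U where "U f x = R \<union> (\<Union>y\<in>underS ?r x. {(y, fst (f y)), (snd (f y), y)})"
    for f :: "'m \<Rightarrow> 'm \<times> 'm" and x
  define P where "P f x z \<longleftrightarrow> partial_elementary M (insert (x, fst z) (insert (snd z, x) (U f x)))"
    for f :: "'m \<Rightarrow> 'm \<times> 'm" and x and z :: "'m \<times> 'm"
  define E where "E f y = insert (y, fst (f y)) (insert (snd (f y), y) (U f y))"
    for f :: "'m \<Rightarrow> 'm \<times> 'm" and y
  have RE: "R \<subseteq> E f y" for f y by (auto simp: E_def U_def)
  have E_mono: "E f y \<subseteq> E f x" if "y \<in> underS ?r x" for f x y
  proof -
    have "underS ?r y \<subseteq> underS ?r x"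
      using underS_incr[of ?r y x] wo that by (auto simp: wo_rel.TRANS wo_rel.ANTISYM underS_def)
    then show ?thesis using that by (auto simp: E_def U_def)
  qed
  have lin: "E f y \<subseteq> E f y' \<or> E f y' \<subseteq> E f y" for f y y'
  proof -
    have "y = y' \<or> y \<in> underS ?r y' \<or> y' \<in> underS ?r y"
      using wo_rel.TOTALS[OF wo] F by (auto simp: underS_def)
    then show ?thesis using E_mono by blast
  qed
  have "\<exists>f. \<forall>x. P f x (f x)"
  proof (rule dependent_wf_choice)
    show "wf (?r - Id)" using Wo by (simp add: well_order_on_def)
    show "P f x z = P g x z" if "\<And>y. (y, x) \<in> ?r - Id \<Longrightarrow> f y = g y" for f g x z
    proof -
      have "U f x = U g x" unfolding U_def using that by (auto simp: underS_def)
      then show ?thesis by (simp add: P_def)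
    qed
    fix x f assume IH: "\<And>y. (y, x) \<in> ?r - Id \<Longrightarrow> P f y (f y)"
    have "partial_elementary M (\<Union>(insert R (E f ` underS ?r x)))"
    proof (rule partial_elementary_chain)
      show "chain\<^sub>\<subseteq> (insert R (E f ` underS ?r x))"
        using lin RE unfolding chain_subset_def by (metis imageE insertE order_refl)
      fix S assume "S \<in> insert R (E f ` underS ?r x)"
      then show "partial_elementary M S"
      proof
        assume "S \<in> E f ` underS ?r x"
        then obtain y where y: "y \<in> underS ?r x" "S = E f y" ..
        have "P f y (f y)" using y(1) by (intro IH) (auto simp: underS_def)
        then show ?thesis by (simp add: y(2) P_def E_def)
      qed (simp add: R)
    qed simp
    moreover have "U f x \<subseteq> \<Union>(insert R (E f ` underS ?r x))"
      by (auto simp: U_def E_def)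
    ultimately have "partial_elementary M (U f x)" by (rule partial_elementary_mono)
    moreover have "|U f x| <o |UNIV :: 'm set|"
    proof -
      let ?u = "underS ?r x"
      have u: "|?u| <o |UNIV :: 'm set|" using card_of_underS[OF Co] F by simp
      have "U f x = R \<union> ((\<lambda>y. (y, fst (f y))) ` ?u \<union> (\<lambda>y. (snd (f y), y)) ` ?u)"
        by (auto simp: U_def)
      moreover have "|(\<lambda>y. (y, fst (f y))) ` ?u| <o |UNIV :: 'm set|"
        "|(\<lambda>y. (snd (f y), y)) ` ?u| <o |UNIV :: 'm set|"
        using u card_of_image ordLeq_ordLess_trans by blast+
      ultimately show ?thesis
        by (simp only:) (intro card_of_Un_ordLess_infinite[OF infinite_UNIV] small)
    qed
    ultimately show "\<exists>z. P f x z"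
      using partial_elementary_extend_both unfolding P_def by (metis fst_conv snd_conv)
  qed
  then obtain f where f: "\<And>x. P f x (f x)" by blast
  have "partial_elementary M (\<Union>(range (E f)))"
  proof (rule partial_elementary_chain)
    show "chain\<^sub>\<subseteq> (range (E f))"
      using lin unfolding chain_subset_def by (metis imageE)
    show "partial_elementary M S" if "S \<in> range (E f)" for S
      using that f by (auto simp: P_def E_def)
  qed simp
  moreover have "R \<subseteq> \<Union>(range (E f))" using RE by auto
  moreover have "(b, fst (f b)) \<in> \<Union>(range (E f)) \<and> (snd (f b), b) \<in> \<Union>(range (E f))" for b
    by (auto simp: E_def)
  ultimately show thesis using that[of "\<Union>(range (E f))"] by blast
qed

end

section \<open>Automorphisms, types and algebraic closure\<close>

abbreviation inv_map :: "('m \<Rightarrow> 'm) \<Rightarrow> 'm \<Rightarrow> 'm" where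
  "inv_map f \<equiv> inv_into UNIV f"

text \<open>
  Conversely to \<open>Aut_sat\<close> below: preserving the formulas \<open>y = f x\<^sub>1 \<dots> x\<^sub>n\<close> and \<open>r x\<^sub>1 \<dots> x\<^sub>n\<close> is enough.
\<close>

lemma Aut_I:
  assumes wf: "wf_struct M" and bij: "bij \<sigma>" and el: "elementary_on M UNIV \<sigma>"
  shows "\<sigma> \<in> Aut M"
proof -
  have sort: "sort_of M (\<sigma> x) = sort_of M x" for x
    using el by (simp add: elementary_on_def)
  have sat: "sat M v \<phi> \<longleftrightarrow> sat M (\<sigma> \<circ> v) \<phi>"
    if "wf_fml M \<phi>" "\<And>x. x \<in> fvars \<phi> \<Longrightarrow> sort_of M (v x) = fst x" for v \<phi>
    using el that unfolding elementary_on_def by blast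
  define vs :: "'a list \<Rightarrow> ('a, 'b) trm list" where "vs ss = map (\<lambda>i. V (ss ! i, i)) [0..<length ss]" for ss
  define v where "v xs z x = (if snd x < length xs then xs ! snd x else z)"
    for xs :: "'d list" and z and x :: "'a var"
  have vs_sort: "map (tsort M) (vs ss) = ss" for ss
    by (simp add: vs_def comp_def map_nth)
  have vs_vars: "t \<in> set (vs ss) \<Longrightarrow> \<exists>i<length ss. t = V (ss ! i, i)" for ss t
    by (auto simp: vs_def)
  have vs_eval: "map (teval M (g \<circ> v xs z)) (vs (map (sort_of M) xs)) = map g xs"
    for g :: "'d \<Rightarrow> 'd" and xs z
    by (rule nth_equalityI) (simp_all add: vs_def v_def)
  have v_sort: "sort_of M (v xs z x) = fst x" if "x \<in> tvars t" "t \<in> set (vs (map (sort_of M) xs))"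
    for x t xs z
    using vs_vars[OF that(2)] that(1) by (auto simp: v_def)
  have vs_wf: "wf_trm M t" if "t \<in> set (vs ss)" for t ss
    using vs_vars[OF that] by auto
  have f: "\<sigma> (fint M f xs) = fint M f (map \<sigma> xs)"
    if f: "f \<in> funs M" and xs: "map (sort_of M) xs = fdom M f" for f xs
  proof -
    define ts where "ts = vs (map (sort_of M) xs)"
    define y :: "'a var" where "y = (fcod M f, length xs)"
    let ?\<phi> = "FEq (V y) (F f ts)" and ?v = "v xs (fint M f xs)"
    have "sort_of M (fint M f xs) = fcod M f"
      using wf f xs by (simp add: wf_struct_def)
    then have y: "sort_of M (?v y) = fst y" "?v y = fint M f xs" by (simp_all add: v_def y_def)
    have "wf_fml M ?\<phi>"
      using f xs vs_wf vs_sort by (auto simp: y_def ts_def)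
    moreover have "sort_of M (?v x) = fst x" if "x \<in> fvars ?\<phi>" for x
    proof -
      have "x = y \<or> (\<exists>t\<in>set ts. x \<in> tvars t)" using that by simp
      then show ?thesis using y(1) v_sort unfolding ts_def by blast
    qed
    ultimately have "sat M ?v ?\<phi> \<longleftrightarrow> sat M (\<sigma> \<circ> ?v) ?\<phi>" by (rule sat)
    then show ?thesis
      using vs_eval[of id xs "fint M f xs"] vs_eval[of \<sigma> xs "fint M f xs"] y(2) by (simp add: ts_def)
  qed
  have r: "rint M r (map \<sigma> xs) \<longleftrightarrow> rint M r xs"
    if r: "r \<in> rels M" and xs: "map (sort_of M) xs = rdom M r" for r xs
  proof -
    define ts where "ts = vs (map (sort_of M) xs)"
    let ?\<phi> = "FRel r ts" and ?v = "v xs undefined"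
    have "wf_fml M ?\<phi>"
      using r xs vs_wf vs_sort by (auto simp: ts_def)
    moreover have "sort_of M (?v x) = fst x" if "x \<in> fvars ?\<phi>" for x
    proof -
      have "\<exists>t\<in>set ts. x \<in> tvars t" using that by simp
      then show ?thesis using v_sort unfolding ts_def by blast
    qed
    ultimately have "sat M ?v ?\<phi> \<longleftrightarrow> sat M (\<sigma> \<circ> ?v) ?\<phi>" by (rule sat)
    then show ?thesis
      using vs_eval[of id xs undefined] vs_eval[of \<sigma> xs undefined] by (simp add: ts_def)
  qed
  show ?thesis using bij sort f r by (simp add: Aut_def)
qed

lemma Aut_sort: "\<sigma> \<in> Aut M \<Longrightarrow> sort_of M (\<sigma> x) = sort_of M x"
  by (simp add: Aut_def)

lemma Aut_bij: "\<sigma> \<in> Aut M \<Longrightarrow> bij \<sigma>"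
  by (simp add: Aut_def)

lemma Aut_fun:
  "\<sigma> \<in> Aut M \<Longrightarrow> f \<in> funs M \<Longrightarrow> map (sort_of M) xs = fdom M f \<Longrightarrow>
    \<sigma> (fint M f xs) = fint M f (map \<sigma> xs)"
  by (simp add: Aut_def)

lemma Aut_rel:
  "\<sigma> \<in> Aut M \<Longrightarrow> r \<in> rels M \<Longrightarrow> map (sort_of M) xs = rdom M r \<Longrightarrow>
    rint M r (map \<sigma> xs) \<longleftrightarrow> rint M r xs"
  by (simp add: Aut_def)

lemma Aut_comp:
  assumes "\<sigma> \<in> Aut M" "\<tau> \<in> Aut M"
  shows "\<sigma> \<circ> \<tau> \<in> Aut M"
proof -
  have m: "map (sort_of M) (map \<tau> xs) = map (sort_of M) xs" for xs
    using Aut_sort[OF assms(2)] by simp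
  have "(\<sigma> \<circ> \<tau>) (fint M f xs) = fint M f (map (\<sigma> \<circ> \<tau>) xs)"
    if "f \<in> funs M" "map (sort_of M) xs = fdom M f" for f xs
    using Aut_fun[OF assms(2) that] Aut_fun[OF assms(1) that(1), of "map \<tau> xs"] m[of xs] that(2)
    by simp
  moreover have "rint M r (map (\<sigma> \<circ> \<tau>) xs) \<longleftrightarrow> rint M r xs"
    if "r \<in> rels M" "map (sort_of M) xs = rdom M r" for r xs
    using Aut_rel[OF assms(2) that] Aut_rel[OF assms(1) that(1), of "map \<tau> xs"] m[of xs] that(2)
    by simp
  ultimately show ?thesis
    using assms Aut_sort[OF assms(1)] Aut_sort[OF assms(2)]
    by (auto simp: Aut_def[of M] intro: bij_comp Aut_bij)
qed

lemma AutOver_Aut: "\<sigma> \<in> AutOver M B \<Longrightarrow> \<sigma> \<in> Aut M"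
  by (simp add: AutOver_def)

lemma AutOver_fix: "\<sigma> \<in> AutOver M B \<Longrightarrow> b \<in> B \<Longrightarrow> \<sigma> b = b"
  by (simp add: AutOver_def)

lemma AutOver_comp: "\<sigma> \<in> AutOver M B \<Longrightarrow> \<tau> \<in> AutOver M B \<Longrightarrow> \<sigma> \<circ> \<tau> \<in> AutOver M B"
  by (simp add: AutOver_def Aut_comp)

lemma AutOver_id: "id \<in> AutOver M B"
  by (simp add: AutOver_def Aut_def)

lemma AutOver_image_fix: "\<sigma> \<in> AutOver M B \<Longrightarrow> \<sigma> ` B = B"
  by (simp add: AutOver_def)

lemma AutOver_inj: "\<sigma> \<in> AutOver M B \<Longrightarrow> inj \<sigma>"
  by (simp add: AutOver_def Aut_def bij_is_inj)

lemma AutOver_inv_apply: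
  assumes "\<sigma> \<in> AutOver M B"
  shows "inv_map \<sigma> (\<sigma> x) = x" "\<sigma> (inv_map \<sigma> x) = x" "inv_map \<sigma> \<circ> \<sigma> = id" "\<sigma> \<circ> inv_map \<sigma> = id"
proof -
  have "bij \<sigma>" using assms AutOver_Aut Aut_bij by blast
  then show "inv_map \<sigma> (\<sigma> x) = x" "\<sigma> (inv_map \<sigma> x) = x" "inv_map \<sigma> \<circ> \<sigma> = id" "\<sigma> \<circ> inv_map \<sigma> = id"
    by (simp_all add: bij_is_inj bij_is_surj surj_f_inv_f fun_eq_iff)
qed

lemma Aut_inv:
  assumes "\<sigma> \<in> Aut M"
  shows "inv_map \<sigma> \<in> Aut M"
proof -
  have bij: "bij \<sigma>" using assms Aut_bij by blast
  have s: "\<sigma> (inv_map \<sigma> x) = x" "inv_map \<sigma> (\<sigma> x) = x" for x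
    using bij by (simp_all add: bij_is_surj bij_is_inj surj_f_inv_f)
  have sort: "sort_of M (inv_map \<sigma> x) = sort_of M x" for x
    using Aut_sort[OF assms, of "inv_map \<sigma> x"] s by simp
  have m: "map (sort_of M) (map (inv_map \<sigma>) xs) = map (sort_of M) xs" "map \<sigma> (map (inv_map \<sigma>) xs) = xs" for xs
    by (simp_all add: sort s comp_def)
  have "inv_map \<sigma> (fint M f xs) = fint M f (map (inv_map \<sigma>) xs)"
    if "f \<in> funs M" "map (sort_of M) xs = fdom M f" for f xs
  proof -
    have "\<sigma> (fint M f (map (inv_map \<sigma>) xs)) = fint M f (map \<sigma> (map (inv_map \<sigma>) xs))"
      using that m(1)[of xs] by (intro Aut_fun[OF assms]) simp_all
    then show ?thesis using m(2) s by metis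
  qed
  moreover have "rint M r (map (inv_map \<sigma>) xs) \<longleftrightarrow> rint M r xs"
    if "r \<in> rels M" "map (sort_of M) xs = rdom M r" for r xs
  proof -
    have "rint M r (map \<sigma> (map (inv_map \<sigma>) xs)) \<longleftrightarrow> rint M r (map (inv_map \<sigma>) xs)"
      using that m(1)[of xs] by (intro Aut_rel[OF assms]) simp_all
    then show ?thesis using m(2)[of xs] by simp
  qed
  ultimately show ?thesis using bij_imp_bij_inv[OF bij] sort by (simp add: Aut_def)
qed

lemma AutOver_inv: "\<sigma> \<in> AutOver M B \<Longrightarrow> inv_map \<sigma> \<in> AutOver M B"
proof -
  assume \<sigma>: "\<sigma> \<in> AutOver M B"
  have "inv_map \<sigma> b = b" if "b \<in> B" for b
    using AutOver_inv_apply(1)[OF \<sigma>, of b] AutOver_fix[OF \<sigma> that] by simp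
  then show ?thesis using Aut_inv[OF AutOver_Aut[OF \<sigma>]] by (simp add: AutOver_def)
qed

context monster_model
begin

lemma Aut_teval:
  assumes "\<sigma> \<in> Aut M" "wf_trm M t" "\<And>x. x \<in> tvars t \<Longrightarrow> sort_of M (v x) = fst x"
  shows "teval M (\<sigma> \<circ> v) t = \<sigma> (teval M v t) \<and> sort_of M (teval M v t) = tsort M t"
  using assms(2,3)
proof (induction t)
  case (F f ts)
  have IH: "teval M (\<sigma> \<circ> v) t = \<sigma> (teval M v t)" "sort_of M (teval M v t) = tsort M t"
    if "t \<in> set ts" for t
  proof -
    have "teval M (\<sigma> \<circ> v) t = \<sigma> (teval M v t) \<and> sort_of M (teval M v t) = tsort M t"
    proof (rule F.IH[OF that])
      show "wf_trm M t" using F.prems(1) that by simp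
      show "sort_of M (v x) = fst x" if "x \<in> tvars t" for x
        by (rule F.prems(2)) (use that \<open>t \<in> set ts\<close> in auto)
    qed
    then show "teval M (\<sigma> \<circ> v) t = \<sigma> (teval M v t)" "sort_of M (teval M v t) = tsort M t"
      by blast+
  qed
  have m: "map (teval M (\<sigma> \<circ> v)) ts = map \<sigma> (map (teval M v) ts)"
    "map (sort_of M) (map (teval M v) ts) = fdom M f"
  proof -
    show "map (teval M (\<sigma> \<circ> v)) ts = map \<sigma> (map (teval M v) ts)"
      unfolding map_map by (rule map_cong) (simp_all add: IH(1))
    have "map (sort_of M) (map (teval M v) ts) = map (tsort M) ts"
      unfolding map_map by (rule map_cong) (simp_all add: IH(2))
    then show "map (sort_of M) (map (teval M v) ts) = fdom M f" using F.prems(1) by (simp only: wf_trm.simps)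
  qed
  have "f \<in> funs M" using F.prems by simp
  then have "\<sigma> (fint M f (map (teval M v) ts)) = fint M f (map \<sigma> (map (teval M v) ts))"
    "sort_of M (fint M f (map (teval M v) ts)) = fcod M f"
    using assms(1) wf_M m(2) unfolding Aut_def wf_struct_def by blast+
  then show ?case using m(1) by (simp only: teval.simps tsort.simps simp_thms)
qed simp

lemma Aut_sat:
  assumes \<sigma>: "\<sigma> \<in> Aut M" and "wf_fml M \<phi>" "\<And>x. x \<in> fvars \<phi> \<Longrightarrow> sort_of M (v x) = fst x"
  shows "sat M (\<sigma> \<circ> v) \<phi> \<longleftrightarrow> sat M v \<phi>"
  using assms(2,3)
proof (induction \<phi> arbitrary: v)
  case (FEq t t')
  have "teval M (\<sigma> \<circ> v) t = \<sigma> (teval M v t)" "teval M (\<sigma> \<circ> v) t' = \<sigma> (teval M v t')"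
    using Aut_teval[OF \<sigma>, of t v] Aut_teval[OF \<sigma>, of t' v] FEq.prems by simp_all
  then show ?case using Aut_bij[OF \<sigma>] by (simp only: sat.simps bij_is_inj inj_eq)
next
  case (FRel r ts)
  have "teval M (\<sigma> \<circ> v) t = \<sigma> (teval M v t) \<and> sort_of M (teval M v t) = tsort M t"
    if "t \<in> set ts" for t
    using FRel.prems that by (intro Aut_teval[OF \<sigma>]) (simp_all add: bexI[of _ t])
  then have m: "map (teval M (\<sigma> \<circ> v)) ts = map \<sigma> (map (teval M v) ts)"
    "map (sort_of M) (map (teval M v) ts) = map (tsort M) ts"
    unfolding map_map by (auto intro!: map_cong simp del: map_eq_conv)
  have "r \<in> rels M" "map (tsort M) ts = rdom M r" using FRel.prems by simp_all
  then have "rint M r (map \<sigma> (map (teval M v) ts)) \<longleftrightarrow> rint M r (map (teval M v) ts)"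
    using Aut_rel[OF \<sigma>] m(2) by metis
  then show ?case by (simp only: sat.simps m(1))
next
  case (FNot \<phi>)
  have "sat M (\<sigma> \<circ> v) \<phi> \<longleftrightarrow> sat M v \<phi>"
    by (rule FNot.IH) (use FNot.prems in simp_all)
  then show ?case by (simp only: sat.simps)
next
  case (FAnd \<phi> \<chi>)
  have "sat M (\<sigma> \<circ> v) \<phi> \<longleftrightarrow> sat M v \<phi>"
    by (rule FAnd.IH(1)) (use FAnd.prems in simp_all)
  moreover have "sat M (\<sigma> \<circ> v) \<chi> \<longleftrightarrow> sat M v \<chi>"
    by (rule FAnd.IH(2)) (use FAnd.prems in simp_all)
  ultimately show ?case by (simp only: sat.simps)
next
  case (FEx x \<phi>)
  have IH: "sat M (\<sigma> \<circ> v(x := c)) \<phi> \<longleftrightarrow> sat M (v(x := c)) \<phi>" if "sort_of M c = fst x" for c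
    by (rule FEx.IH) (use FEx.prems that in auto)
  have upd: "(\<sigma> \<circ> v)(x := \<sigma> c) = \<sigma> \<circ> v(x := c)" for c by auto
  have "surj \<sigma>" using Aut_bij[OF \<sigma>] by (rule bij_is_surj)
  then have "(\<exists>c. sort_of M c = fst x \<and> sat M ((\<sigma> \<circ> v)(x := c)) \<phi>) \<longleftrightarrow>
      (\<exists>c. sort_of M (\<sigma> c) = fst x \<and> sat M ((\<sigma> \<circ> v)(x := \<sigma> c)) \<phi>)"
    by (metis surjD)
  also have "\<dots> \<longleftrightarrow> (\<exists>c. sort_of M c = fst x \<and> sat M (v(x := c)) \<phi>)"
    using IH by (simp only: upd Aut_sort[OF \<sigma>]) blast
  finally show ?case by (simp only: sat.simps)
qed

lemma partial_elementary_extends: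
  assumes "partial_elementary M R" and "|R| <o |UNIV :: 'm set|"
  obtains \<sigma> where "\<sigma> \<in> Aut M" "\<And>x y. (x, y) \<in> R \<Longrightarrow> \<sigma> x = y"
proof -
  obtain S where S: "partial_elementary M S" "R \<subseteq> S" "\<And>b. \<exists>c d. (b, c) \<in> S \<and> (d, b) \<in> S"
    using partial_elementary_total[OF assms] by blast
  define \<sigma> where "\<sigma> b = (SOME c. (b, c) \<in> S)" for b
  have \<sigma>: "(b, \<sigma> b) \<in> S" for b
    unfolding \<sigma>_def using S(3) by (metis someI)
  have eq: "\<sigma> x = y" if "(x, y) \<in> S" for x y
    using partial_elementary_eq_iff[OF S(1) that \<sigma>, of x] by simp
  have "bij \<sigma>"
  proof (rule bijI)
    show "inj \<sigma>" using partial_elementary_eq_iff[OF S(1) \<sigma> \<sigma>] by (simp add: inj_def)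
    show "surj \<sigma>" using S(3) eq by (metis surjI)
  qed
  moreover have "elementary_on M UNIV \<sigma>"
    unfolding partial_elementary_graph[symmetric]
    using \<sigma> by (intro partial_elementary_mono[OF S(1)]) auto
  ultimately have "\<sigma> \<in> Aut M" using Aut_I[OF wf_M] by blast
  then show thesis using that eq S(2) by blast
qed

lemma elementary_on_extends:
  assumes "elementary_on M X g" "small X"
  obtains \<sigma> where "\<sigma> \<in> Aut M" "\<And>x. x \<in> X \<Longrightarrow> \<sigma> x = g x"
proof -
  have "|(\<lambda>x. (x, g x)) ` X| <o |UNIV :: 'm set|"
    using assms(2) card_of_image ordLeq_ordLess_trans unfolding small_iff by blast
  then obtain \<sigma> where "\<sigma> \<in> Aut M" "\<And>x y. (x, y) \<in> (\<lambda>x. (x, g x)) ` X \<Longrightarrow> \<sigma> x = y"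
    using partial_elementary_extends[OF assms(1)[folded partial_elementary_graph]] by blast
  then show thesis using that[of \<sigma>] by simp
qed

lemma Aut_elementary_on: "\<sigma> \<in> Aut M \<Longrightarrow> elementary_on M X \<sigma>"
  unfolding elementary_on_def by (simp add: Aut_sort Aut_sat)

lemma small_image_set: "small (A :: 'm set) \<Longrightarrow> small (f ` A :: 'm set)"
  using small_image small_iff by blast

section \<open>Types\<close>

lemma pformulas_var:
  assumes "q \<in> pformulas M \<tau> A" "x \<in> fvars (fst q)"
  obtains i where "snd q x = Inl i" "\<tau> i = fst x"
  | c where "snd q x = Inr c" "c \<in> A" "sort_of M c = fst x"
  using assms that by (cases "snd q x") (auto simp: pformulas_def case_prod_beta)

lemma pformulas_wf: "q \<in> pformulas M \<tau> A \<Longrightarrow> wf_fml M (fst q)"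
  by (simp add: pformulas_def case_prod_beta)

lemma tp_sort:
  assumes "tp M A a = tp M A a'"
  shows "sort_of M (a i) = sort_of M (a' i)"
proof -
  let ?x = "(sort_of M (a i), 0)"
  have "(FEq (V ?x) (V ?x), \<lambda>_. Inl i) \<in> tp M A a"
    by (simp add: tp_def pformulas_def holds_def)
  then have "(FEq (V ?x) (V ?x), \<lambda>_. Inl i) \<in> tp M A a'" using assms by simp
  then show ?thesis by (simp add: tp_def pformulas_def)
qed

lemma tp_eqI:
  assumes "\<And>i. sort_of M (a i) = sort_of M (a' i)"
    and "\<And>q. q \<in> pformulas M (\<lambda>i. sort_of M (a i)) A \<Longrightarrow> holds M a q \<Longrightarrow> holds M a' q"
  shows "tp M A a = tp M A a'"
proof -
  have "holds M a q" if q: "q \<in> pformulas M (\<lambda>i. sort_of M (a i)) A" and h: "holds M a' q" for q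
  proof (rule ccontr)
    assume "\<not> holds M a q"
    then have "holds M a (FNot (fst q), snd q)" by (simp add: holds_def)
    moreover have "(FNot (fst q), snd q) \<in> pformulas M (\<lambda>i. sort_of M (a i)) A"
      using q by (simp add: pformulas_def case_prod_beta)
    ultimately have "holds M a' (FNot (fst q), snd q)" using assms(2) by blast
    then show False using h by (simp add: holds_def)
  qed
  then show ?thesis using assms unfolding tp_def by auto
qed

lemma tp_Aut:
  assumes "\<sigma> \<in> AutOver M A"
  shows "tp M A (\<sigma> \<circ> a) = tp M A a"
proof (rule sym, rule tp_eqI)
  show "sort_of M (a i) = sort_of M ((\<sigma> \<circ> a) i)" for i
    using Aut_sort[OF AutOver_Aut[OF assms]] by simp
  fix q assume q: "q \<in> pformulas M (\<lambda>i. sort_of M (a i)) A" and "holds M a q"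
  let ?v = "\<lambda>x. case_sum a id (snd q x)"
  have *: "sort_of M (?v x) = fst x \<and> case_sum (\<sigma> \<circ> a) id (snd q x) = \<sigma> (?v x)"
    if "x \<in> fvars (fst q)" for x
    using pformulas_var[OF q that] AutOver_fix[OF assms] by cases simp_all
  have "sat M ?v (fst q)" using \<open>holds M a q\<close> by (simp add: holds_def)
  then have "sat M (\<sigma> \<circ> ?v) (fst q)"
    using Aut_sat[OF AutOver_Aut[OF assms], of "fst q" ?v] pformulas_wf[OF q] * by blast
  then show "holds M (\<sigma> \<circ> a) q"
    unfolding holds_def using * by (subst sat_cong[where w = "\<sigma> \<circ> ?v"]) simp_all
qed

text \<open>Homogeneity: tuples with the same type are conjugate.\<close>

lemma tp_eq_conjugate:
  fixes a a' :: "'y \<Rightarrow> 'm"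
  assumes eq: "tp M A a = tp M A a'" and A: "small A" and Y: "|UNIV :: 'y set| <o |UNIV :: 'm set|"
  obtains \<sigma> where "\<sigma> \<in> AutOver M A" "\<sigma> \<circ> a = a'"
proof -
  define R where "R = range (\<lambda>i. (a i, a' i)) \<union> (\<lambda>x. (x, x)) ` A"
  have "|R| <o |UNIV :: 'm set|"
    unfolding R_def using A Y unfolding small_iff
    by (intro card_of_Un_ordLess_infinite[OF infinite_UNIV] ordLeq_ordLess_trans[OF card_of_image])
  moreover have "partial_elementary M R"
    unfolding partial_elementary_def
  proof (intro conjI ballI)
    fix z assume "z \<in> R"
    then show "case z of (x, y) \<Rightarrow> sort_of M x = sort_of M y"
      unfolding R_def by (auto simp: tp_sort[OF eq])
  next
    fix q assume q: "q \<in> instances M (\<lambda>z. sort_of M (fst z)) R"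
    have "\<exists>k. k \<in> UNIV <+> A \<and> case_sum a id k = fst z \<and> case_sum a' id k = snd z" if "z \<in> R" for z
      using that unfolding R_def
    proof (elim UnE imageE)
      show ?thesis if "z = (a i, a' i)" for i using that by (intro exI[of _ "Inl i"]) auto
      show ?thesis if "z = (x, x)" "x \<in> A" for x using that by (intro exI[of _ "Inr x"]) auto
    qed
    then obtain k where k: "\<And>z. z \<in> R \<Longrightarrow> k z \<in> UNIV <+> A"
      "\<And>z. z \<in> R \<Longrightarrow> case_sum a id (k z) = fst z" "\<And>z. z \<in> R \<Longrightarrow> case_sum a' id (k z) = snd z"
      by metis
    let ?q = "(fst q, k \<circ> snd q)"
    have sort: "case_sum (\<lambda>i. sort_of M (b i)) (sort_of M) z = sort_of M (case_sum b id z)"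
      for b :: "'y \<Rightarrow> 'm" and z
      by (cases z) simp_all
    have pf: "?q \<in> pformulas M (\<lambda>i. sort_of M (a i)) A"
      using q k instances_var[OF q] by (simp add: pformulas_eq_instances instances_iff sort)
    have "(\<lambda>i. sort_of M (a i)) = (\<lambda>i. sort_of M (a' i))" using tp_sort[OF eq] by (rule ext)
    then have "holds M a ?q \<longleftrightarrow> holds M a' ?q" using pf eq by (auto simp: tp_def)
    moreover have "holds M a ?q \<longleftrightarrow> holds_at M fst q"
      unfolding holds_def holds_at_def
      using k instances_var(1)[OF q] by (simp, intro sat_cong) simp
    moreover have "holds M a' ?q \<longleftrightarrow> holds_at M snd q"
      unfolding holds_def holds_at_def
      using k instances_var(1)[OF q] by (simp, intro sat_cong) simp
    ultimately show "holds_at M fst q \<longleftrightarrow> holds_at M snd q" by simp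
  qed
  ultimately obtain \<sigma> where "\<sigma> \<in> Aut M" "\<And>x y. (x, y) \<in> R \<Longrightarrow> \<sigma> x = y"
    using partial_elementary_extends by blast
  then show thesis using that[of \<sigma>] by (auto simp: AutOver_def R_def fun_eq_iff)
qed

section \<open>Algebraic closure\<close>

lemma pformulas_Aut:
  assumes "\<sigma> \<in> Aut M" "q \<in> pformulas M \<tau> A"
  shows "(fst q, map_sum id \<sigma> \<circ> snd q) \<in> pformulas M \<tau> (\<sigma> ` A)"
proof -
  have "case map_sum id \<sigma> z of Inl i \<Rightarrow> \<tau> i = s | Inr c \<Rightarrow> c \<in> \<sigma> ` A \<and> sort_of M c = s"
    if "case z of Inl i \<Rightarrow> \<tau> i = s | Inr c \<Rightarrow> c \<in> A \<and> sort_of M c = s" for z s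
    using that Aut_sort[OF assms(1)] by (cases z) simp_all
  then show ?thesis using assms(2) by (simp add: pformulas_def case_prod_beta)
qed

lemma solutions_Aut:
  assumes "\<sigma> \<in> Aut M" "q \<in> pformulas M (\<lambda>_. s) A"
  shows "solutions M s (fst q, map_sum id \<sigma> \<circ> snd q) = \<sigma> ` solutions M s q"
proof -
  have eq: "\<sigma> c \<in> solutions M s (fst q, map_sum id \<sigma> \<circ> snd q) \<longleftrightarrow> c \<in> solutions M s q" for c
  proof (cases "sort_of M c = s")
    case True
    let ?v = "\<lambda>x. case_sum (\<lambda>_. c) id (snd q x)"
    have "sort_of M (?v x) = fst x" if "x \<in> fvars (fst q)" for x
      using pformulas_var[OF assms(2) that] True by cases simp_all
    then have "sat M (\<sigma> \<circ> ?v) (fst q) \<longleftrightarrow> sat M ?v (fst q)"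
      by (intro Aut_sat assms(1) pformulas_wf[OF assms(2)])
    moreover have "case_sum (\<lambda>_. \<sigma> c) id (map_sum id \<sigma> z) = \<sigma> (case_sum (\<lambda>_. c) id z)" for z
      by (cases z) simp_all
    then have "(\<lambda>x. case_sum (\<lambda>_. \<sigma> c) id ((map_sum id \<sigma> \<circ> snd q) x)) = \<sigma> \<circ> ?v"
      unfolding comp_def by blast
    ultimately show ?thesis using Aut_sort[OF assms(1)] by (simp add: solutions_def holds_def)
  qed (simp add: solutions_def Aut_sort[OF assms(1)])
  have "surj \<sigma>" using Aut_bij[OF assms(1)] by (rule bij_is_surj)
  then show ?thesis using eq by (auto simp: image_iff) (metis surjD)
qed

lemma pformula_fix:
  assumes "\<sigma> \<in> AutOver M A" "q \<in> pformulas M (\<lambda>_. s) A"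
  shows "solutions M s (fst q, map_sum id \<sigma> \<circ> snd q) = solutions M s q"
proof -
  have "case_sum (\<lambda>_. c) id (map_sum id \<sigma> (snd q x)) = case_sum (\<lambda>_. c) id (snd q x)"
    if "x \<in> fvars (fst q)" for c x
    using pformulas_var[OF assms(2) that] AutOver_fix[OF assms(1)] by cases simp_all
  then have "sat M (\<lambda>x. case_sum (\<lambda>_. c) id (map_sum id \<sigma> (snd q x))) (fst q) \<longleftrightarrow>
      sat M (\<lambda>x. case_sum (\<lambda>_. c) id (snd q x)) (fst q)" for c
    by (intro sat_cong)
  then show ?thesis by (simp add: solutions_def holds_def)
qed

lemma AutOver_solutions:
  assumes "\<sigma> \<in> AutOver M A" "q \<in> pformulas M (\<lambda>_. s) A" "b \<in> solutions M s q"
  shows "\<sigma> b \<in> solutions M s q"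
  using solutions_Aut[OF AutOver_Aut[OF assms(1)] assms(2)] pformula_fix[OF assms(1,2)] assms(3)
  by blast

lemma dcl_fixed: "\<sigma> \<in> AutOver M A \<Longrightarrow> b \<in> dcl M A \<Longrightarrow> \<sigma> b = b"
proof -
  assume \<sigma>: "\<sigma> \<in> AutOver M A" and "b \<in> dcl M A"
  then obtain q where "q \<in> pformulas M (\<lambda>_. sort_of M b) A" "solutions M (sort_of M b) q = {b}"
    unfolding dcl_def by blast
  then show "\<sigma> b = b" using AutOver_solutions[OF \<sigma>, of q "sort_of M b" b] by simp
qed

lemma acl_mono: "A \<subseteq> A' \<Longrightarrow> acl M A \<subseteq> acl M A'"
proof -
  assume "A \<subseteq> A'"
  then have "UNIV <+> A \<subseteq> UNIV <+> A'" by auto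
  then have "pformulas M (\<lambda>_::unit. s) A \<subseteq> pformulas M (\<lambda>_. s) A'" for s
    unfolding pformulas_eq_instances by (rule instances_mono)
  then show ?thesis unfolding acl_def by blast
qed

lemma acl_extensive: "A \<subseteq> acl M A"
proof
  fix b assume b: "b \<in> A"
  let ?x = "(sort_of M b, 0::nat)" and ?y = "(sort_of M b, 1::nat)"
  let ?q = "(FEq (V ?x) (V ?y), \<lambda>x. if x = ?x then Inl () else Inr b)"
  have "?q \<in> pformulas M (\<lambda>_. sort_of M b) A" using b by (auto simp: pformulas_def)
  moreover have "solutions M (sort_of M b) ?q = {b}" by (auto simp: solutions_def holds_def)
  ultimately show "b \<in> acl M A" unfolding acl_def by force
qed

lemma acl_Aut_subset:
  assumes "\<sigma> \<in> Aut M"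
  shows "\<sigma> ` acl M A \<subseteq> acl M (\<sigma> ` A)"
proof
  fix c assume "c \<in> \<sigma> ` acl M A"
  then obtain b q where b: "c = \<sigma> b" "q \<in> pformulas M (\<lambda>_. sort_of M b) A"
    "b \<in> solutions M (sort_of M b) q" "finite (solutions M (sort_of M b) q)"
    by (auto simp: acl_def)
  then show "c \<in> acl M (\<sigma> ` A)"
    using pformulas_Aut[OF assms b(2)] solutions_Aut[OF assms b(2)] Aut_sort[OF assms]
    unfolding acl_def by (intro CollectI bexI[of _ "(fst q, map_sum id \<sigma> \<circ> snd q)"]) auto
qed

lemma acl_Aut:
  assumes "\<sigma> \<in> Aut M"
  shows "acl M (\<sigma> ` A) = \<sigma> ` acl M A"
proof
  have bij: "bij \<sigma>" using Aut_bij[OF assms] .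
  have "inv_map \<sigma> ` acl M (\<sigma> ` A) \<subseteq> acl M (inv_map \<sigma> ` \<sigma> ` A)"
    using acl_Aut_subset[OF Aut_inv[OF assms]] .
  then have "\<sigma> ` inv_map \<sigma> ` acl M (\<sigma> ` A) \<subseteq> \<sigma> ` acl M A"
    using bij by (simp add: image_inv_f_f bij_is_inj image_mono)
  then show "acl M (\<sigma> ` A) \<subseteq> \<sigma> ` acl M A"
    using bij by (simp add: image_f_inv_f bij_is_surj)
qed (rule acl_Aut_subset[OF assms])

text \<open>Over small sets, algebraic means having finitely many conjugates.\<close>

lemma acl_finite_orbit:
  assumes "b \<in> acl M A"
  shows "finite {\<sigma> b | \<sigma>. \<sigma> \<in> AutOver M A}"
proof -
  obtain q where q: "q \<in> pformulas M (\<lambda>_. sort_of M b) A"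
    "b \<in> solutions M (sort_of M b) q" "finite (solutions M (sort_of M b) q)"
    using assms by (auto simp: acl_def)
  have "{\<sigma> b | \<sigma>. \<sigma> \<in> AutOver M A} \<subseteq> solutions M (sort_of M b) q"
    using AutOver_solutions[OF _ q(1,2)] by blast
  then show ?thesis using q(3) finite_subset by blast
qed

lemma finite_orbit_acl:
  assumes A: "small A" and fin: "finite {\<sigma> b | \<sigma>. \<sigma> \<in> AutOver M A}"
  shows "b \<in> acl M A"
proof (rule ccontr)
  assume nacl: "b \<notin> acl M A"
  define s where "s = sort_of M b"
  define orb where "orb = {\<sigma> b | \<sigma>. \<sigma> \<in> AutOver M A}"
  define T where "T = {q \<in> pformulas M (\<lambda>_::unit. s) A. holds M (\<lambda>_. b) q}"
  \<comment> \<open>If \<open>b\<close> is not algebraic, then its type \<open>T\<close> over \<open>A\<close> is realized outside the orbit of \<open>b\<close>, to which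
    homogeneity says that all realizations belong. The formulas in \<open>N\<close> express being outside.\<close>
  define N where "N = {q \<in> pformulas M (\<lambda>_::unit. s) (A \<union> orb).
    \<forall>c. sort_of M c = s \<longrightarrow> c \<notin> orb \<longrightarrow> holds M (\<lambda>_. c) q}"
  have pf_mono: "pformulas M (\<lambda>_::unit. s) A \<subseteq> pformulas M (\<lambda>_. s) (A \<union> orb)"
    unfolding pformulas_eq_instances by (rule instances_mono) auto
  have "\<exists>c. sort_of M c = s \<and> (\<forall>q\<in>T \<union> N. holds M (\<lambda>_. c) q)"
  proof (rule saturation)
    show "small (A \<union> orb)" using A small_finite[OF fin] unfolding orb_def by (rule small_Un)
    show "T \<union> N \<subseteq> pformulas M (\<lambda>_. s) (A \<union> orb)" using pf_mono by (auto simp: T_def N_def)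
    fix \<Phi> assume \<Phi>: "finite \<Phi>" "\<Phi> \<subseteq> T \<union> N"
    have "finite (\<Phi> \<inter> T)" "\<Phi> \<inter> T \<subseteq> pformulas M (\<lambda>_. s) A" using \<Phi> by (auto simp: T_def)
    from instances_conj[OF this[unfolded pformulas_eq_instances]]
    obtain p where p': "p \<in> pformulas M (\<lambda>_. s) A"
      and "\<forall>w. holds_at M w p \<longleftrightarrow> (\<forall>q\<in>\<Phi> \<inter> T. holds_at M w q)"
      unfolding pformulas_eq_instances by blast
    then have p: "p \<in> pformulas M (\<lambda>_. s) A"
      "\<And>c. holds M (\<lambda>_. c) p \<longleftrightarrow> (\<forall>q\<in>\<Phi> \<inter> T. holds M (\<lambda>_. c) q)"
      by (simp_all only: holds_eq_holds_at)
    have "b \<in> solutions M s p" using p(2) by (auto simp: solutions_def s_def T_def)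
    then have "infinite (solutions M s p)" using nacl p(1) unfolding acl_def s_def by blast
    then obtain c where c: "c \<in> solutions M s p" "c \<notin> orb"
      using finite_subset[OF _ fin[folded orb_def]] by blast
    then have "sort_of M c = s" "\<forall>q\<in>\<Phi> \<inter> T. holds M (\<lambda>_. c) q"
      using p(2)[of c] by (simp_all add: solutions_def)
    moreover from this(1) have "\<forall>q\<in>N. holds M (\<lambda>_. c) q" using c(2) by (simp add: N_def)
    ultimately show "\<exists>c. sort_of M c = s \<and> (\<forall>q\<in>\<Phi>. holds M (\<lambda>_. c) q)"
      using \<Phi>(2) by blast
  qed
  then obtain c where c: "sort_of M c = s" "\<And>q. q \<in> T \<Longrightarrow> holds M (\<lambda>_. c) q"
    "\<And>q. q \<in> N \<Longrightarrow> holds M (\<lambda>_. c) q" by blast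
  have "tp M A (\<lambda>_::unit. b) = tp M A (\<lambda>_. c)"
    using c(1,2) by (intro tp_eqI) (simp_all add: s_def T_def)
  moreover have "|UNIV :: unit set| <o |UNIV :: 'm set|"
    using infinite_UNIV finite_ordLess_infinite[OF card_of_Well_order card_of_Well_order]
    by (metis Field_card_of finite_UNIV)
  ultimately obtain \<sigma> where "\<sigma> \<in> AutOver M A" "\<sigma> \<circ> (\<lambda>_::unit. b) = (\<lambda>_. c)"
    using tp_eq_conjugate[OF _ A] by blast
  then have cO: "c \<in> orb" by (auto simp: fun_eq_iff orb_def)
  obtain q where q: "q \<in> instances M (case_sum (\<lambda>_. s) (sort_of M)) (UNIV <+> (A \<union> orb))"
    "\<And>w. holds_at M w q \<longleftrightarrow> w (Inl ()) = w (Inr c)"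
    by (rule instances_eq[of "Inl ()" "UNIV <+> (A \<union> orb)" "Inr c" "case_sum (\<lambda>_. s) (sort_of M)" M])
      (use cO c(1) in auto)
  have "(FNot (fst q), snd q) \<in> N"
    using q cO instances_not[of "fst q" "snd q"] unfolding N_def pformulas_eq_instances holds_eq_holds_at
    by (auto simp: holds_at_def)
  then have "holds M (\<lambda>_. c) (FNot (fst q), snd q)" by (rule c(3))
  then show False using q(2) by (simp add: holds_eq_holds_at holds_at_def)
qed

lemma acl_idem:
  assumes A: "small A"
  shows "acl M (acl M A) = acl M A"
proof
  show "acl M (acl M A) \<subseteq> acl M A"
  proof
    fix b assume "b \<in> acl M (acl M A)"
    then obtain q where q: "q \<in> pformulas M (\<lambda>_. sort_of M b) (acl M A)"
      "b \<in> solutions M (sort_of M b) q" "finite (solutions M (sort_of M b) q)"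
      by (auto simp: acl_def)
    \<comment> \<open>Let \<open>q\<close> isolate \<open>b\<close> up to finitely many elements, with parameters in \<open>acl M A\<close>. Each parameter has
      finitely many conjugates over \<open>A\<close>, so \<open>q\<close> has finitely many conjugates, each with finitely many
      solutions, and the conjugates of \<open>b\<close> are among these.\<close>
    define P where "P z = {map_sum id \<sigma> z | \<sigma>. \<sigma> \<in> AutOver M A}" for z :: "unit + 'm"
    let ?X = "fvars (fst q)"
    have "finite (P (snd q x))" if "x \<in> ?X" for x
    proof (cases "snd q x")
      case (Inl i)
      then show ?thesis by (auto simp: P_def)
    next
      case (Inr c)
      then have "c \<in> acl M A" using pformulas_var[OF q(1) that] by cases simp_all
      then have "finite (Inr ` {\<sigma> c | \<sigma>. \<sigma> \<in> AutOver M A} :: (unit + 'm) set)"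
        using acl_finite_orbit by blast
      moreover have "P (snd q x) = Inr ` {\<sigma> c | \<sigma>. \<sigma> \<in> AutOver M A}" using Inr by (auto simp: P_def)
      ultimately show ?thesis by simp
    qed
    then have "finite (PiE ?X (\<lambda>x. P (snd q x)))" by (rule finite_PiE[OF finite_fvars])
    moreover have "(\<lambda>\<sigma>. restrict (map_sum id \<sigma> \<circ> snd q) ?X) ` AutOver M A \<subseteq> PiE ?X (\<lambda>x. P (snd q x))"
      unfolding P_def by (intro image_subsetI restrict_PiE_iff[THEN iffD2] ballI CollectI) (auto simp only: comp_apply)
    ultimately have fin: "finite ((\<lambda>\<sigma>. restrict (map_sum id \<sigma> \<circ> snd q) ?X) ` AutOver M A)"
      by (rule finite_subset[rotated])
    let ?S = "\<lambda>u. solutions M (sort_of M b) (fst q, u)"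
    have S: "?S (restrict (map_sum id \<sigma> \<circ> snd q) ?X) = \<sigma> ` solutions M (sort_of M b) q"
      if "\<sigma> \<in> AutOver M A" for \<sigma>
    proof -
      have "sat M (\<lambda>x. case_sum (\<lambda>_. c) id (restrict (map_sum id \<sigma> \<circ> snd q) ?X x)) (fst q) \<longleftrightarrow>
          sat M (\<lambda>x. case_sum (\<lambda>_. c) id ((map_sum id \<sigma> \<circ> snd q) x)) (fst q)" for c
        by (rule sat_cong) simp
      then have "?S (restrict (map_sum id \<sigma> \<circ> snd q) ?X) = ?S (map_sum id \<sigma> \<circ> snd q)"
        by (simp add: solutions_def holds_def)
      then show ?thesis using solutions_Aut[OF AutOver_Aut[OF that] q(1)] by simp
    qed
    have "{\<sigma> b | \<sigma>. \<sigma> \<in> AutOver M A} \<subseteq>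
        (\<Union>u\<in>(\<lambda>\<sigma>. restrict (map_sum id \<sigma> \<circ> snd q) ?X) ` AutOver M A. ?S u)"
      using S q(2) by fastforce
    moreover have "finite (\<Union>u\<in>(\<lambda>\<sigma>. restrict (map_sum id \<sigma> \<circ> snd q) ?X) ` AutOver M A. ?S u)"
      using fin S q(3) by (intro finite_UN_I) auto
    ultimately have "finite {\<sigma> b | \<sigma>. \<sigma> \<in> AutOver M A}" by (rule finite_subset)
    then show "b \<in> acl M A" by (rule finite_orbit_acl[OF A])
  qed
qed (rule acl_extensive)

end

context monster_model
begin

text \<open>There are fewer formulas over a small set than elements of the universe.\<close>

lemma acl_small:
  assumes A: "small A"
  shows "small (acl M A)"
proof -
  let ?F = "{\<phi>. wf_fml M \<phi>}"
  define P :: "(unit + 'm) set" where "P = UNIV <+> A"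
  define D where "D = ?F <+> A"
  have D_inf: "infinite D" using formulas_infinite by (simp add: D_def)
  have D_small: "|D| <o |UNIV :: 'm set|"
    unfolding D_def using formulas_small A infinite_UNIV
    by (intro card_of_Plus_ordLess_infinite) (simp_all add: small_iff)
  have F_le: "|?F| \<le>o |D|" unfolding D_def by (rule card_of_Plus1)
  have nat_le: "|UNIV :: nat set| \<le>o |D|" using D_inf infinite_iff_card_of_nat by blast
  obtain \<phi>\<^sub>0 where \<phi>\<^sub>0: "\<phi>\<^sub>0 \<in> ?F" using formulas_infinite by (metis finite.emptyI ex_in_conv)
  have P_le: "|P| \<le>o |D|"
    unfolding P_def D_def using \<phi>\<^sub>0
    by (intro card_of_ordLeqI[of "map_sum (\<lambda>_. \<phi>\<^sub>0) id"]) (auto simp: inj_on_def)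
  have sorts_le: "|UNIV :: 's set| \<le>o |D|"
  proof -
    have "|UNIV :: 's set| \<le>o |?F|"
      by (rule card_of_ordLeqI[of "\<lambda>s. FEq (V (s, 0)) (V (s, 0))"]) (auto simp: inj_on_def)
    then show ?thesis using F_le ordLeq_transitive by blast
  qed
  have len_le: "|{l. set l \<subseteq> P \<and> length l = n}| \<le>o |D|" for n
  proof (induction n)
    case 0
    have "{l. set l \<subseteq> P \<and> length l = 0} = {[]}" by auto
    then have "finite {l. set l \<subseteq> P \<and> length l = 0}" by simp
    then show ?case using D_inf by (meson card_of_Well_order card_of_ordLeq_infinite ordLeq_total)
  next
    case (Suc n)
    have "{l. set l \<subseteq> P \<and> length l = Suc n} \<subseteq>
        (\<lambda>(x, l). x # l) ` (P \<times> {l. set l \<subseteq> P \<and> length l = n})"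
      by (auto simp: length_Suc_conv)
    then have "|{l. set l \<subseteq> P \<and> length l = Suc n}| \<le>o |P \<times> {l. set l \<subseteq> P \<and> length l = n}|"
      using card_of_mono1 card_of_image ordLeq_transitive by meson
    moreover have "|P \<times> {l. set l \<subseteq> P \<and> length l = n}| \<le>o |D|"
      using D_inf P_le Suc.IH by (intro card_of_Sigma_ordLeq_infinite) auto
    ultimately show ?case by (rule ordLeq_transitive)
  qed
  have lists_le: "|lists P| \<le>o |D|"
  proof -
    have "lists P = (\<Union>n. {l. set l \<subseteq> P \<and> length l = n})" by auto
    then show ?thesis
      using card_of_UNION_ordLeq_infinite[OF D_inf nat_le, of "\<lambda>n. {l. set l \<subseteq> P \<and> length l = n}"]
        len_le by (simp only: ball_UNIV simp_thms)
  qed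
  \<comment> \<open>The indices are triples of a sort, a formula, and the list of what is put for its free variables.
    The sort has to be recorded, as a formula may fail to contain the type variable.\<close>
  define I where "I = (UNIV :: 's set) \<times> (?F \<times> lists P)"
  have I_le: "|I| \<le>o |D|"
    unfolding I_def using D_inf sorts_le F_le lists_le
    by (intro card_of_Sigma_ordLeq_infinite ballI) simp_all
  obtain en where en: "set (en \<phi>) = fvars \<phi>" for \<phi> :: "('s, 'f, 'r) fml"
    using finite_list[OF finite_fvars] by metis
  define W where "W i = {v. (fst (snd i), v) \<in> pformulas M (\<lambda>_::unit. fst i) A \<and>
    map v (en (fst (snd i))) = snd (snd i)}" for i
  define S where "S i = (\<Union>v\<in>W i. if finite (solutions M (fst i) (fst (snd i), v))
    then solutions M (fst i) (fst (snd i), v) else {})" for i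
  have S_fin: "finite (S i)" for i
  proof (cases "W i = {}")
    case False
    then obtain v where v: "v \<in> W i" by blast
    have "solutions M (fst i) (fst (snd i), v') = solutions M (fst i) (fst (snd i), v)"
      if "v' \<in> W i" for v'
    proof -
      have "map v' (en (fst (snd i))) = map v (en (fst (snd i)))" using that v by (simp add: W_def)
      then have "v' x = v x" if "x \<in> fvars (fst (snd i))" for x using that en by (simp add: map_eq_conv)
      then have "sat M (\<lambda>x. case_sum (\<lambda>_. c) id (v' x)) (fst (snd i)) \<longleftrightarrow>
          sat M (\<lambda>x. case_sum (\<lambda>_. c) id (v x)) (fst (snd i))" for c
        by (intro sat_cong) simp
      then show ?thesis by (simp add: solutions_def holds_def)
    qed
    then have "S i \<subseteq> (if finite (solutions M (fst i) (fst (snd i), v))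
        then solutions M (fst i) (fst (snd i), v) else {})"
      unfolding S_def by (intro UN_least) simp
    then show ?thesis by (rule finite_subset) simp
  qed (simp add: S_def)
  have "acl M A \<subseteq> (\<Union>i\<in>I. S i)"
  proof
    fix b assume "b \<in> acl M A"
    then obtain \<phi> v where q: "(\<phi>, v) \<in> pformulas M (\<lambda>_. sort_of M b) A"
      "b \<in> solutions M (sort_of M b) (\<phi>, v)" "finite (solutions M (sort_of M b) (\<phi>, v))"
      unfolding acl_def by auto
    define i where "i = (sort_of M b, \<phi>, map v (en \<phi>))"
    have "v x \<in> P" if "x \<in> fvars \<phi>" for x
      using pformulas_var[OF q(1), of x] that by (simp add: P_def) (metis InlI InrI UNIV_I)
    then have "set (map v (en \<phi>)) \<subseteq> P" using en by fastforce
    then have "i \<in> I" using pformulas_wf[OF q(1)] by (simp add: i_def I_def lists_eq_set)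
    moreover have "b \<in> S i"
      unfolding S_def
    proof (rule UN_I)
      show "v \<in> W i" using q(1) by (simp add: W_def i_def)
      show "b \<in> (if finite (solutions M (fst i) (fst (snd i), v))
          then solutions M (fst i) (fst (snd i), v) else {})"
        unfolding i_def fst_conv snd_conv if_P[OF q(3)] by (rule q(2))
    qed
    ultimately show "b \<in> (\<Union>i\<in>I. S i)" by blast
  qed
  moreover have "|\<Union>i\<in>I. S i| \<le>o |D|"
  proof (rule card_of_UNION_ordLeq_infinite[OF D_inf I_le])
    show "\<forall>i\<in>I. |S i| \<le>o |D|"
      using S_fin D_inf by (meson card_of_Well_order card_of_ordLeq_infinite ordLeq_total)
  qed
  ultimately show ?thesis
    unfolding small_iff using D_small card_of_mono1 ordLeq_ordLess_trans by meson
qed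

end

section \<open>Independence\<close>

text \<open>
  The situation in which \<open>p\<close> is studied: \<open>cl\<close> is algebraic closure over \<open>B\<close>, \<open>Gal\<close> are the
  automorphisms over \<open>B\<close>, and \<open>reals\<close> are the realizations of \<open>p\<close>.
\<close>

locale homology_setting = monster_model M
  for M :: "('s, 'f, 'r, 'm) struct" +
  fixes ind :: "'m indrel" and B :: "'m set"
    and p :: "('s, 'f, 'r, 'x, 'm) pformula set"
  assumes star: "star_independence M ind"
    and small_B: "small B" and acl_B: "acl M B = B"
    and small_index: "|UNIV :: 'x set| <o |UNIV :: 'm set|"
    and p_ex: "\<exists>a. p = tp M B a \<and>
      (range a = acl M (range a \<union> B) \<or> acl M (range a \<union> B) = dcl M (range a \<union> B))"
begin

abbreviation cl :: "'m set \<Rightarrow> 'm set" where "cl Y \<equiv> acl M (Y \<union> B)"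
abbreviation Gal :: "('m \<Rightarrow> 'm) set" where "Gal \<equiv> AutOver M B"
abbreviation reals :: "('x \<Rightarrow> 'm) set" where "reals \<equiv> realizations M B p"

lemma reals_nonempty: "\<exists>a. a \<in> reals"
  using p_ex unfolding realizations_def by blast

lemma reals_Gal: "a \<in> reals \<Longrightarrow> \<sigma> \<in> Gal \<Longrightarrow> \<sigma> \<circ> a \<in> reals"
  by (simp add: realizations_def tp_Aut)

lemma reals_transitive:
  assumes "a \<in> reals" "b \<in> reals"
  obtains \<sigma> where "\<sigma> \<in> Gal" "\<sigma> \<circ> a = b"
  using tp_eq_conjugate[OF _ small_B small_index, of a b] assms unfolding realizations_def by auto

lemma small_range: "small (range (a :: 'x \<Rightarrow> 'm))"
  using small_index by (rule small_image)

lemma pair_conjugate: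
  fixes a a' b b' :: "'x \<Rightarrow> 'm"
  shows "tp M B (case_sum a b) = tp M B (case_sum a' b') \<longleftrightarrow> (\<exists>\<sigma>\<in>Gal. \<sigma> \<circ> a = a' \<and> \<sigma> \<circ> b = b')"
proof
  assume eq: "tp M B (case_sum a b) = tp M B (case_sum a' b')"
  have "|UNIV <+> UNIV :: ('x + 'x) set| <o |UNIV :: 'm set|"
    using infinite_UNIV small_index by (intro card_of_Plus_ordLess_infinite)
  then have "|UNIV :: ('x + 'x) set| <o |UNIV :: 'm set|" by simp
  then obtain \<sigma> where \<sigma>: "\<sigma> \<in> Gal" "\<sigma> \<circ> case_sum a b = case_sum a' b'"
    using tp_eq_conjugate[OF eq small_B] by blast
  have "\<sigma> (a i) = a' i" "\<sigma> (b i) = b' i" for i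
    using fun_cong[OF \<sigma>(2), of "Inl i"] fun_cong[OF \<sigma>(2), of "Inr i"] by simp_all
  then show "\<exists>\<sigma>\<in>Gal. \<sigma> \<circ> a = a' \<and> \<sigma> \<circ> b = b'" using \<sigma>(1) by (auto simp: fun_eq_iff)
next
  assume "\<exists>\<sigma>\<in>Gal. \<sigma> \<circ> a = a' \<and> \<sigma> \<circ> b = b'"
  then obtain \<sigma> where \<sigma>: "\<sigma> \<in> Gal" "\<sigma> \<circ> a = a'" "\<sigma> \<circ> b = b'" by blast
  have "\<sigma> \<circ> case_sum a b = case_sum a' b'"
    unfolding \<sigma>(2,3)[symmetric] by (auto simp: fun_eq_iff split: sum.splits)
  then show "tp M B (case_sum a b) = tp M B (case_sum a' b')" using tp_Aut[OF \<sigma>(1)] by metis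
qed

section \<open>Closures over \<open>B\<close>\<close>

lemma cl_extensive: "Y \<subseteq> cl Y" and B_cl: "B \<subseteq> cl Y"
  using acl_extensive[of "Y \<union> B"] by blast+

lemma cl_mono: "Y \<subseteq> Z \<Longrightarrow> cl Y \<subseteq> cl Z"
  by (rule acl_mono) blast

lemma cl_small: "small Y \<Longrightarrow> small (cl Y)"
  by (intro acl_small small_Un small_B)

lemma cl_UN_cl:
  assumes "small (\<Union>i\<in>I. Y i)"
  shows "cl (\<Union>i\<in>I. cl (Y i)) = cl (\<Union>i\<in>I. Y i)"
proof
  have "(\<Union>i\<in>I. cl (Y i)) \<union> B \<subseteq> cl (\<Union>i\<in>I. Y i)"
    using B_cl by (intro Un_least UN_least cl_mono) auto
  then have "cl (\<Union>i\<in>I. cl (Y i)) \<subseteq> acl M (cl (\<Union>i\<in>I. Y i))" by (rule acl_mono)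
  then show "cl (\<Union>i\<in>I. cl (Y i)) \<subseteq> cl (\<Union>i\<in>I. Y i)"
    using acl_idem[OF small_Un[OF assms small_B]] by simp
qed (use cl_extensive in \<open>intro cl_mono UN_mono; blast\<close>)

lemma cl_Gal: "\<sigma> \<in> Gal \<Longrightarrow> \<sigma> ` cl Y = cl (\<sigma> ` Y)"
  using acl_Aut[OF AutOver_Aut, of \<sigma> B "Y \<union> B"] AutOver_image_fix[of \<sigma> M B] by (simp add: image_Un)

text \<open>
  This is where the hypothesis on \<open>p\<close> enters: an automorphism over \<open>B\<close> is determined on
  \<open>cl (range a)\<close> by its action on the tuple \<open>a\<close>.
\<close>

lemma fixes_cl:
  assumes a: "a \<in> reals" and \<sigma>: "\<sigma> \<in> Gal" and fix_a: "\<sigma> \<circ> a = a" and x: "x \<in> cl (range a)"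
  shows "\<sigma> x = x"
proof -
  obtain b where b: "p = tp M B b" "range b = cl (range b) \<or> cl (range b) = dcl M (range b \<union> B)"
    using p_ex by blast
  then have "b \<in> reals" by (simp add: realizations_def)
  then obtain \<rho> where \<rho>: "\<rho> \<in> Gal" "\<rho> \<circ> a = b" using reals_transitive a by blast
  let ?\<sigma> = "\<rho> \<circ> \<sigma> \<circ> inv_map \<rho>"
  have \<sigma>': "?\<sigma> \<in> Gal" using \<rho>(1) \<sigma> by (intro AutOver_comp AutOver_inv)
  have fix_b: "?\<sigma> y = y" if "y \<in> range b" for y
    using that fun_cong[OF fix_a] AutOver_inv_apply(1)[OF \<rho>(1)] unfolding \<rho>(2)[symmetric] by auto
  then have \<sigma>'': "?\<sigma> \<in> AutOver M (range b \<union> B)"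
    using \<sigma>' AutOver_fix[OF \<sigma>'] by (auto simp: AutOver_def)
  have "\<rho> ` range a = range b" using \<rho>(2) by auto
  then have "\<rho> x \<in> cl (range b)" using imageI[OF x, of \<rho>] cl_Gal[OF \<rho>(1), of "range a"] by simp
  then have "?\<sigma> (\<rho> x) = \<rho> x"
    using b(2) fix_b dcl_fixed[OF \<sigma>''] by metis
  then have "\<rho> (\<sigma> x) = \<rho> x" using AutOver_inv_apply(1)[OF \<rho>(1)] by simp
  then show ?thesis using AutOver_inj[OF \<rho>(1)] by (simp add: inj_eq)
qed

lemma Gal_eq_on_cl:
  assumes a: "a \<in> reals" and \<sigma>: "\<sigma> \<in> Gal" "\<tau> \<in> Gal" and eq: "\<sigma> \<circ> a = \<tau> \<circ> a" and x: "x \<in> cl (range a)"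
  shows "\<sigma> x = \<tau> x"
proof -
  have "(inv_map \<tau> \<circ> \<sigma>) x = x"
  proof (rule fixes_cl[OF a _ _ x])
    show "inv_map \<tau> \<circ> \<sigma> \<in> Gal" using \<sigma> by (intro AutOver_comp AutOver_inv)
    show "inv_map \<tau> \<circ> \<sigma> \<circ> a = a"
      using AutOver_inv_apply(3)[OF \<sigma>(2)] eq by (metis comp_assoc id_comp)
  qed
  then show ?thesis using AutOver_inv_apply(2)[OF \<sigma>(2), of "\<sigma> x"] by simp
qed

lemma C_hom_extends:
  assumes "g \<in> C_hom M B Y Z" "Y \<in> C_obj B"
  obtains \<sigma> where "\<sigma> \<in> Gal" "\<And>y. y \<in> Y \<Longrightarrow> g y = \<sigma> y"
proof -
  have g: "elementary_on M Y g" "\<And>b. b \<in> B \<Longrightarrow> g b = b" and Y: "small Y" "B \<subseteq> Y"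
    using assms by (auto simp: C_hom_def C_obj_def)
  obtain \<sigma> where \<sigma>: "\<sigma> \<in> Aut M" "\<And>y. y \<in> Y \<Longrightarrow> \<sigma> y = g y"
    using elementary_on_extends[OF g(1) Y(1)] by blast
  then have "\<sigma> \<in> Gal" using g(2) Y(2) by (auto simp: AutOver_def)
  then show thesis using that \<sigma>(2) by simp
qed

section \<open>Properties of the independence relation\<close>

lemma ind_Gal:
  assumes "\<sigma> \<in> Gal" "small A" "small D"
  shows "ind (\<sigma> ` A) B (\<sigma> ` D) \<longleftrightarrow> ind A B D"
proof -
  have "\<forall>\<sigma>\<in>Aut M. \<forall>A C D. small A \<and> small C \<and> small D \<longrightarrow>
      (ind (\<sigma> ` A) (\<sigma> ` C) (\<sigma> ` D) \<longleftrightarrow> ind A C D)"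
    using star[unfolded star_independence_def] by (elim conjE)
  then have "ind (\<sigma> ` A) (\<sigma> ` B) (\<sigma> ` D) \<longleftrightarrow> ind A B D"
    using AutOver_Aut[OF assms(1)] assms(2,3) small_B by blast
  then show ?thesis by (simp add: AutOver_image_fix[OF assms(1)])
qed

lemma ind_finite_character:
  "small A \<Longrightarrow> small C \<Longrightarrow> small D \<Longrightarrow>
    ind A C D \<longleftrightarrow> (\<forall>A\<^sub>0 D\<^sub>0. finite A\<^sub>0 \<and> A\<^sub>0 \<subseteq> A \<and> finite D\<^sub>0 \<and> D\<^sub>0 \<subseteq> D \<longrightarrow> ind A\<^sub>0 C D\<^sub>0)"
  using star[unfolded star_independence_def, THEN conjunct2, THEN conjunct1, rule_format, of A C D]
  by blast

lemma ind_mono: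
  assumes "ind A C D" "small A" "small C" "small D" "A' \<subseteq> A" "D' \<subseteq> D"
  shows "ind A' C D'"
proof -
  have "small A'" "small D'" using assms small_subset by blast+
  then show ?thesis
    using assms ind_finite_character[of A C D] ind_finite_character[of A' C D'] by (meson order_trans)
qed

lemma ind_normal: "small A \<Longrightarrow> small C \<Longrightarrow> small D \<Longrightarrow> ind A C D \<Longrightarrow> ind A C (acl M (D \<union> C))"
  using star[unfolded star_independence_def, THEN conjunct2, THEN conjunct2, THEN conjunct1]
  by blast

lemma ind_sym: "small A \<Longrightarrow> small C \<Longrightarrow> small D \<Longrightarrow> ind A C D \<longleftrightarrow> ind D C A"
  using star[unfolded star_independence_def, THEN conjunct2, THEN conjunct2, THEN conjunct2,
      THEN conjunct1] by blast

lemma ind_trans: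
  "small A \<Longrightarrow> small D \<Longrightarrow> E \<subseteq> C \<Longrightarrow> C \<subseteq> D \<Longrightarrow> ind A E D \<longleftrightarrow> ind A E C \<and> ind A C D"
  using star[unfolded star_independence_def, THEN conjunct2, THEN conjunct2, THEN conjunct2,
      THEN conjunct2, THEN conjunct1] by blast

lemma ind_cl:
  assumes "ind A B D" "small A" "small D"
  shows "ind (cl A) B (cl D)"
  using assms ind_normal ind_sym small_B cl_small by meson

text \<open>Extension, for tuples: an independent conjugate always exists.\<close>

lemma ind_extend:
  assumes a: "a \<in> reals" and D: "small D"
  obtains c where "c \<in> reals" "ind (range c) B D"
proof -
  have sa: "small (range a)" by (rule small_range)
  have sDB: "small (D \<union> B)" using D small_B by (rule small_Un)
  have "\<forall>A E C. small A \<and> small C \<and> E \<subseteq> C \<longrightarrow> (\<exists>A'. equiv_over M E A A' \<and> ind A' E C)"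
    using star[unfolded star_independence_def] by (elim conjE)
  then obtain A' where A': "equiv_over M B (range a) A'" "ind A' B (D \<union> B)"
    using sa sDB by blast
  then obtain g where g: "elementary_on M (range a \<union> B) g" "\<forall>e\<in>B. g e = e" "g ` range a = A'"
    unfolding equiv_over_def by blast
  obtain \<sigma> where \<sigma>: "\<sigma> \<in> Aut M" "\<And>y. y \<in> range a \<union> B \<Longrightarrow> \<sigma> y = g y"
    using elementary_on_extends[OF g(1) small_Un[OF sa small_B]] by blast
  have "\<sigma> \<in> Gal" using \<sigma> g(2) by (auto simp: AutOver_def)
  then have c: "\<sigma> \<circ> a \<in> reals" by (rule reals_Gal[OF a])
  have "range (\<sigma> \<circ> a) = A'" using \<sigma>(2) g(3) by (auto simp: image_image)
  then have "ind (range (\<sigma> \<circ> a)) B D"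
    using A'(2) ind_mono[of "range (\<sigma> \<circ> a)" B "D \<union> B"] small_range small_B sDB by blast
  then show thesis using c that by blast
qed

text \<open>
  If \<open>C\<close> is independent from \<open>A \<union> D\<close>, then it may be moved to the other side of an independent pair.
  By transitivity \<open>C\<close> is independent from \<open>A\<close> over \<open>D \<union> B\<close>; then use symmetry, normality and
  transitivity again.
\<close>

lemma ind_rotate:
  assumes ab: "ind A B D" and c: "ind C B (A \<union> D)" and small: "small A" "small D" "small C"
  shows "ind A B (D \<union> C)"
proof -
  have s: "small (D \<union> B)" "small (A \<union> D \<union> B)" "small (C \<union> (D \<union> B))" "small (A \<union> D)"
    "small (cl (A \<union> D))" "small (cl D)" "small (acl M (C \<union> (D \<union> B)))"
    by (intro acl_small small_Un small small_B)+
  have "ind C B (cl (A \<union> D))" using ind_normal[OF small(3) small_B s(4) c] .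
  then have "ind C B (A \<union> D \<union> B)"
    by (rule ind_mono[OF _ small(3) small_B s(5) order_refl acl_extensive])
  then have "ind C (D \<union> B) (A \<union> D \<union> B)"
    using ind_trans[OF small(3) s(2), of B "D \<union> B"] by blast
  then have "ind (A \<union> D \<union> B) (D \<union> B) C"
    using ind_sym[OF small(3) s(1,2)] by blast
  then have "ind A (D \<union> B) C"
    by (rule ind_mono[OF _ s(2,1) small(3)]) auto
  then have "ind A (D \<union> B) (acl M (C \<union> (D \<union> B)))"
    by (rule ind_normal[OF small(1) s(1) small(3)])
  then have 1: "ind A (D \<union> B) (C \<union> (D \<union> B))"
    by (rule ind_mono[OF _ small(1) s(1,7) order_refl acl_extensive])
  have "ind A B (cl D)" using ind_normal[OF small(1) small_B small(2) ab] .
  then have 2: "ind A B (D \<union> B)"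
    by (rule ind_mono[OF _ small(1) small_B s(6) order_refl acl_extensive])
  have "ind A B (C \<union> (D \<union> B))"
    using 1 2 ind_trans[OF small(1) s(3), of B "D \<union> B"] by blast
  then show ?thesis by (rule ind_mono[OF _ small(1) small_B s(3)]) auto
qed

lemma independent_pair:
  assumes "i \<noteq> j" "ind (range (\<alpha> i)) B (range (\<alpha> j))"
  shows "independent_family ind B {i, j} (\<lambda>k. cl (range (\<alpha> k :: 'x \<Rightarrow> 'm)))"
proof -
  have *: "ind (range (\<alpha> j)) B (range (\<alpha> i))" using assms(2) ind_sym small_range small_B by blast
  have "{i, j} - {i} = {j}" "{i, j} - {j} = {i}" using assms(1) by auto
  then show ?thesis
    using ind_cl[OF assms(2)] ind_cl[OF *] small_range by (simp add: independent_family_def)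
qed

lemma independent_triple:
  fixes \<alpha> :: "nat \<Rightarrow> 'x \<Rightarrow> 'm"
  assumes ne: "i \<noteq> j" "i \<noteq> k" "j \<noteq> k"
    and ij: "ind (range (\<alpha> i)) B (range (\<alpha> j))"
    and k: "ind (range (\<alpha> k)) B (range (\<alpha> i) \<union> range (\<alpha> j))"
  shows "independent_family ind B {i, j, k} (\<lambda>k. cl (range (\<alpha> k)))"
proof -
  have s: "small (range (\<alpha> l))" "small (range (\<alpha> l) \<union> range (\<alpha> m))" for l m
    using small_range by (simp_all add: small_Un)
  have ji: "ind (range (\<alpha> j)) B (range (\<alpha> i))" using ij ind_sym s small_B by blast
  have i: "ind (range (\<alpha> i)) B (range (\<alpha> j) \<union> range (\<alpha> k))"
    using ind_rotate[OF ij k] s by blast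
  have j: "ind (range (\<alpha> j)) B (range (\<alpha> i) \<union> range (\<alpha> k))"
    using ind_rotate[OF ji k[unfolded Un_commute[of "range (\<alpha> i)"]]] s by blast
  have cl2: "ind (cl (range (\<alpha> l))) B (cl (range (\<alpha> m)) \<union> cl (range (\<alpha> n)))"
    if "ind (range (\<alpha> l)) B (range (\<alpha> m) \<union> range (\<alpha> n))" for l m n
  proof (rule ind_mono[OF ind_cl[OF that s] _ small_B _ order_refl])
    show "small (cl (range (\<alpha> l)))" "small (cl (range (\<alpha> m) \<union> range (\<alpha> n)))"
      using s by (intro cl_small; blast)+
    show "cl (range (\<alpha> m)) \<union> cl (range (\<alpha> n)) \<subseteq> cl (range (\<alpha> m) \<union> range (\<alpha> n))"
      by (intro Un_least cl_mono) auto
  qed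
  have "{i, j, k} - {i} = {j, k}" "{i, j, k} - {j} = {i, k}" "{i, j, k} - {k} = {i, j}"
    using ne by auto
  then show ?thesis using cl2[OF i] cl2[OF j] cl2[OF k] by (simp add: independent_family_def)
qed

lemma independent_family_subset:
  assumes "independent_family ind B s Y" "t \<subseteq> s" "finite s" "\<And>i. i \<in> s \<Longrightarrow> small (Y i)"
  shows "independent_family ind B t Y"
  unfolding independent_family_def
proof
  fix i assume "i \<in> t"
  then have "ind (Y i) B (\<Union>j\<in>s - {i}. Y j)"
    using assms(1,2) by (auto simp: independent_family_def)
  then show "ind (Y i) B (\<Union>j\<in>t - {i}. Y j)"
    by (rule ind_mono[OF _ _ small_B])
      (use assms \<open>i \<in> t\<close> in \<open>auto intro!: small_UN\<close>)
qed

end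

section \<open>Building simplices\<close>

lemma elementary_on_cong:
  assumes "\<And>x. x \<in> X \<Longrightarrow> g x = h x"
  shows "elementary_on M X g \<longleftrightarrow> elementary_on M X h"
proof -
  have "(\<lambda>x. (x, g x)) ` X = (\<lambda>x. (x, h x)) ` X" using assms by simp
  then show ?thesis using partial_elementary_graph by metis
qed

lemma sorted_list_of_set_2: "(i::nat) < j \<Longrightarrow> sorted_list_of_set {i, j} = [i, j]"
  using sorted_list_of_set.idem_if_sorted_distinct[of "[i, j]"] by simp

lemma sorted_list_of_set_3: "(i::nat) < j \<Longrightarrow> j < k \<Longrightarrow> sorted_list_of_set {i, j, k} = [i, j, k]"
  using sorted_list_of_set.idem_if_sorted_distinct[of "[i, j, k]"] by simp

context homology_setting
begin

abbreviation spx :: "nat \<Rightarrow> 'm pfunctor \<Rightarrow> bool" where "spx \<equiv> simplex M B ind p"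

text \<open>
  A functor is given by realizations \<open>\<alpha> i\<close> and a system of automorphisms: the object at \<open>u\<close> is
  embedded by \<open>\<sigma> u\<close> onto the closure of the \<open>\<alpha> i\<close> with \<open>i \<in> u\<close>, and the morphisms are what the
  inclusions between these closures become. Functoriality is then automatic.
\<close>

definition built :: "nat set \<Rightarrow> (nat set \<Rightarrow> 'm \<Rightarrow> 'm) \<Rightarrow> (nat \<Rightarrow> 'x \<Rightarrow> 'm) \<Rightarrow> 'm pfunctor" where
  "built s \<sigma> \<alpha> = \<lparr>supp = s,
     obj = (\<lambda>u. if u \<subseteq> s then inv_map (\<sigma> u) ` cl (\<Union>i\<in>u. range (\<alpha> i)) else {}),
     mor = (\<lambda>u v. if u \<subseteq> v \<and> v \<subseteq> s
       then restrict (inv_map (\<sigma> v) \<circ> \<sigma> u) (inv_map (\<sigma> u) ` cl (\<Union>i\<in>u. range (\<alpha> i)))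
       else (\<lambda>_. undefined))\<rparr>"

lemma built_restrict: "t \<subseteq> s \<Longrightarrow> pfunctor_restrict (built s \<sigma> \<alpha>) t = built t \<sigma> \<alpha>"
  by (auto simp: pfunctor_restrict_def built_def fun_eq_iff)

lemma built_vertex_image:
  assumes "\<And>u. \<sigma> u \<in> Gal" "i \<in> u" "u \<subseteq> s"
  shows "mor (built s \<sigma> \<alpha>) {i} u ` obj (built s \<sigma> \<alpha>) {i} = inv_map (\<sigma> u) ` cl (range (\<alpha> i))"
proof -
  have "{i} \<subseteq> s" "{i} \<subseteq> u" using assms by auto
  then have "mor (built s \<sigma> \<alpha>) {i} u ` obj (built s \<sigma> \<alpha>) {i} =
      (\<lambda>x. inv_map (\<sigma> u) (\<sigma> {i} x)) ` inv_map (\<sigma> {i}) ` cl (range (\<alpha> i))"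
    using assms(3) by (simp add: built_def)
  also have "\<dots> = (\<lambda>x. inv_map (\<sigma> u) (\<sigma> {i} (inv_map (\<sigma> {i}) x))) ` cl (range (\<alpha> i))"
    by (simp only: image_image)
  also have "\<dots> = inv_map (\<sigma> u) ` cl (range (\<alpha> i))"
    by (simp only: AutOver_inv_apply(2)[OF assms(1)])
  finally show ?thesis .
qed

lemma built_simplex:
  assumes \<sigma>: "\<And>u. \<sigma> u \<in> Gal" and s: "card s = n + 1" and \<alpha>: "\<And>i. i \<in> s \<Longrightarrow> \<alpha> i \<in> reals"
    and indep: "independent_family ind B s (\<lambda>i. cl (range (\<alpha> i)))"
  shows "spx n (built s \<sigma> \<alpha>)"
proof -
  define U where "U u = cl (\<Union>i\<in>u. range (\<alpha> i))" for u
  let ?f = "built s \<sigma> \<alpha>"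
  have fin: "finite s" using s by (simp add: card_ge_0_finite)
  have obj: "obj ?f u = inv_map (\<sigma> u) ` U u" if "u \<subseteq> s" for u
    using that by (simp add: built_def U_def)
  have mor: "mor ?f u v = restrict (inv_map (\<sigma> v) \<circ> \<sigma> u) (obj ?f u)" if "u \<subseteq> v" "v \<subseteq> s" for u v
    using that obj[of u] by (simp add: built_def U_def)
  have small_UN_range: "small (\<Union>i\<in>u. range (\<alpha> i))" if "u \<subseteq> s" for u
    using finite_subset[OF that fin] small_range by (rule small_UN)
  have small_U: "small (U u)" if "u \<subseteq> s" for u
    unfolding U_def using small_UN_range[OF that] by (rule cl_small)
  have \<sigma>U: "\<sigma> u x \<in> U u" if "u \<subseteq> s" "x \<in> obj ?f u" for u x
    using that obj[OF that(1)] AutOver_inv_apply(2)[OF \<sigma>] by auto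
  have U_mono: "U u \<subseteq> U v" if "u \<subseteq> v" for u v
    unfolding U_def using that by (intro cl_mono) auto
  have B_obj: "B \<subseteq> obj ?f u" if "u \<subseteq> s" for u
  proof -
    have "inv_map (\<sigma> u) ` B \<subseteq> inv_map (\<sigma> u) ` U u" unfolding U_def using B_cl by (rule image_mono)
    then show ?thesis using obj[OF that] AutOver_image_fix[OF AutOver_inv[OF \<sigma>]] by metis
  qed
  have gal: "inv_map (\<sigma> v) \<circ> \<sigma> u \<in> Gal" for u v by (intro AutOver_comp AutOver_inv \<sigma>)
  have mor_in: "mor ?f u v x \<in> obj ?f v" if "u \<subseteq> v" "v \<subseteq> s" "x \<in> obj ?f u" for u v x
  proof -
    have "\<sigma> u x \<in> U v" using \<sigma>U[of u x] U_mono[OF that(1)] that by blast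
    then show ?thesis using that by (simp add: mor obj)
  qed
  have "is_pfunctor M B ?f"
    unfolding is_pfunctor_def
  proof (intro conjI allI impI)
    show "finite (supp ?f)" using fin by (simp add: built_def)
    have supp: "supp ?f = s" by (simp add: built_def)
    show "obj ?f u \<in> C_obj B" if "u \<subseteq> supp ?f" for u
      using that B_obj[of u] small_image_set[OF small_U] obj unfolding supp by (auto simp: C_obj_def)
    show "mor ?f u v \<in> C_hom M B (obj ?f u) (obj ?f v)" if "u \<subseteq> v \<and> v \<subseteq> supp ?f" for u v
    proof -
      have uv: "u \<subseteq> v" "v \<subseteq> s" "u \<subseteq> s" using that supp by auto
      have "elementary_on M (obj ?f u) (mor ?f u v)"
        using Aut_elementary_on[OF AutOver_Aut[OF gal[of v u]], of "obj ?f u"]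
        by (subst elementary_on_cong[where h = "inv_map (\<sigma> v) \<circ> \<sigma> u"]) (simp_all add: mor uv)
      moreover have "mor ?f u v b = b" if "b \<in> B" for b
        using AutOver_fix[OF gal that] B_obj[OF uv(3)] that by (auto simp: mor uv)
      moreover have "mor ?f u v \<in> obj ?f u \<rightarrow>\<^sub>E obj ?f v"
        using mor_in[OF uv(1,2)] by (auto simp: mor[OF uv(1,2)])
      ultimately show ?thesis by (simp add: C_hom_def)
    qed
    show "mor ?f u u = (\<lambda>x\<in>obj ?f u. x)" if "u \<subseteq> supp ?f" for u
      using that AutOver_inv_apply(1)[OF \<sigma>] unfolding supp by (simp add: mor fun_eq_iff)
    show "mor ?f u w = compose (obj ?f u) (mor ?f v w) (mor ?f u v)"
      if "u \<subseteq> v \<and> v \<subseteq> w \<and> w \<subseteq> supp ?f" for u v w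
    proof
      fix x
      have uvw: "u \<subseteq> v" "v \<subseteq> w" "w \<subseteq> s" "v \<subseteq> s" "u \<subseteq> w" using that supp by auto
      show "mor ?f u w x = compose (obj ?f u) (mor ?f v w) (mor ?f u v) x"
      proof (cases "x \<in> obj ?f u")
        case True
        then show ?thesis
          using mor_in[OF uvw(1,4) True] AutOver_inv_apply(2)[OF \<sigma>]
          by (simp add: compose_def mor[OF uvw(2,3)] mor[OF uvw(1,4)] mor[OF uvw(5,3)])
      qed (simp add: compose_def mor[OF uvw(5,3)])
    qed
    show "obj ?f u = {}" if "\<not> u \<subseteq> supp ?f" for u using that by (simp add: built_def)
    show "mor ?f u v = (\<lambda>_. undefined)" if "\<not> (u \<subseteq> v \<and> v \<subseteq> supp ?f)" for u v
      using that by (auto simp: built_def)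
  qed
  moreover have "obj ?f {} = B"
    using obj[of "{}"] AutOver_image_fix[OF AutOver_inv[OF \<sigma>]] by (simp add: U_def acl_B)
  moreover have "\<exists>b\<in>reals. obj ?f {i} = cl (range b)" if "i \<in> s" for i
  proof
    show "inv_map (\<sigma> {i}) \<circ> \<alpha> i \<in> reals" using reals_Gal[OF \<alpha>[OF that] AutOver_inv[OF \<sigma>]] .
    show "obj ?f {i} = cl (range (inv_map (\<sigma> {i}) \<circ> \<alpha> i))"
      using that by (simp add: obj U_def cl_Gal[OF AutOver_inv[OF \<sigma>]] image_comp)
  qed
  moreover have "obj ?f u = acl M ((\<Union>i\<in>u. mor ?f {i} u ` obj ?f {i}) \<union> B)"
    "independent_family ind B u (\<lambda>i. mor ?f {i} u ` obj ?f {i})" if u: "u \<noteq> {}" "u \<subseteq> s" for u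
  proof -
    have im: "mor ?f {i} u ` obj ?f {i} = inv_map (\<sigma> u) ` cl (range (\<alpha> i))" if "i \<in> u" for i
      using built_vertex_image[OF \<sigma> that u(2)] .
    have "(\<Union>i\<in>u. mor ?f {i} u ` obj ?f {i}) = inv_map (\<sigma> u) ` (\<Union>i\<in>u. cl (range (\<alpha> i)))"
      using im by (simp add: image_UN)
    then have "acl M ((\<Union>i\<in>u. mor ?f {i} u ` obj ?f {i}) \<union> B) =
        inv_map (\<sigma> u) ` cl (\<Union>i\<in>u. cl (range (\<alpha> i)))"
      by (simp only: cl_Gal[OF AutOver_inv[OF \<sigma>]])
    also have "\<dots> = obj ?f u"
      using cl_UN_cl[OF small_UN_range[OF u(2)]] obj[OF u(2)] by (simp only: U_def)
    finally show "obj ?f u = acl M ((\<Union>i\<in>u. mor ?f {i} u ` obj ?f {i}) \<union> B)" by (rule sym)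
    have sm: "small (cl (range (\<alpha> i)))" for i using cl_small small_range by blast
    have indep_u: "independent_family ind B u (\<lambda>i. cl (range (\<alpha> i)))"
      using independent_family_subset[OF indep u(2) fin] sm by blast
    show "independent_family ind B u (\<lambda>i. mor ?f {i} u ` obj ?f {i})"
      unfolding independent_family_def
    proof
      fix i assume i: "i \<in> u"
      have "(\<Union>j\<in>u - {i}. mor ?f {j} u ` obj ?f {j}) =
          inv_map (\<sigma> u) ` (\<Union>j\<in>u - {i}. cl (range (\<alpha> j)))"
        using im by (simp add: image_UN)
      moreover have "small (\<Union>j\<in>u - {i}. cl (range (\<alpha> j)))"
        using sm finite_subset[OF u(2) fin] by (intro small_UN) auto
      ultimately show "ind (mor ?f {i} u ` obj ?f {i}) B (\<Union>j\<in>u - {i}. mor ?f {j} u ` obj ?f {j})"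
        using indep_u i im[OF i] sm ind_Gal[OF AutOver_inv[OF \<sigma>]]
        by (simp add: independent_family_def)
    qed
  qed
  ultimately show ?thesis
    unfolding simplex_def using s by (simp add: built_def)
qed

lemma spx_pfunctor: "spx n f \<Longrightarrow> is_pfunctor M B f"
  unfolding simplex_def by blast

lemma spx_obj_empty: "spx n f \<Longrightarrow> obj f {} = B"
  unfolding simplex_def by blast

lemma spx_obj:
  "spx n f \<Longrightarrow> u \<noteq> {} \<Longrightarrow> u \<subseteq> supp f \<Longrightarrow> obj f u = acl M ((\<Union>i\<in>u. mor f {i} u ` obj f {i}) \<union> B)"
  unfolding simplex_def by blast

lemma pfunctor_obj: "is_pfunctor M B f \<Longrightarrow> u \<subseteq> supp f \<Longrightarrow> obj f u \<in> C_obj B"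
  by (simp add: is_pfunctor_def)

lemma pfunctor_mor:
  "is_pfunctor M B f \<Longrightarrow> u \<subseteq> v \<Longrightarrow> v \<subseteq> supp f \<Longrightarrow> mor f u v \<in> C_hom M B (obj f u) (obj f v)"
  by (simp add: is_pfunctor_def)

text \<open>Morphisms of simplices are restrictions of automorphisms over \<open>B\<close>.\<close>

lemma spx_mor:
  assumes "spx n f" "u \<subseteq> v" "v \<subseteq> supp f"
  obtains \<rho> where "\<rho> \<in> Gal" "mor f u v = restrict \<rho> (obj f u)"
proof -
  have f: "is_pfunctor M B f" using spx_pfunctor[OF assms(1)] .
  have hom: "mor f u v \<in> C_hom M B (obj f u) (obj f v)" using pfunctor_mor[OF f assms(2,3)] .
  have "obj f u \<in> C_obj B" using pfunctor_obj[OF f] assms(2,3) by blast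
  then obtain \<rho> where \<rho>: "\<rho> \<in> Gal" "\<And>y. y \<in> obj f u \<Longrightarrow> mor f u v y = \<rho> y"
    using C_hom_extends[OF hom] by blast
  have "mor f u v \<in> extensional (obj f u)" using hom by (auto simp: C_hom_def PiE_def)
  then have "mor f u v = restrict \<rho> (obj f u)"
    using \<rho>(2) by (auto simp: fun_eq_iff extensional_def)
  then show thesis using that \<rho>(1) by blast
qed

lemma spx_mor_empty:
  assumes f: "spx n f" and v: "v \<subseteq> supp f"
  shows "mor f {} v = restrict id B"
proof -
  have "obj f {} = B" by (rule spx_obj_empty[OF f])
  moreover obtain \<rho> where "\<rho> \<in> Gal" "mor f {} v = restrict \<rho> (obj f {})"
    using spx_mor[OF f _ v, of "{}"] by blast
  ultimately show ?thesis using AutOver_fix by (auto simp: fun_eq_iff)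
qed

text \<open>
  Two functors with support \<open>s\<close> agree when they agree on objects and morphisms in \<open>\<P>(s)\<close>.
\<close>

lemma pfunctor_eqI:
  assumes f: "is_pfunctor M B f" and g: "is_pfunctor M B g" and s: "supp f = s" "supp g = s"
    and obj: "\<And>u. u \<subseteq> s \<Longrightarrow> obj f u = obj g u"
    and mor: "\<And>u v. u \<subset> v \<Longrightarrow> v \<subseteq> s \<Longrightarrow> mor f u v = mor g u v"
  shows "f = g"
proof -
  have "obj f u = obj g u" for u
    using obj f g s by (cases "u \<subseteq> s") (simp_all add: is_pfunctor_def)
  moreover have "mor f u v = mor g u v" for u v
  proof (cases "u \<subseteq> v \<and> v \<subseteq> s")
    case True
    then show ?thesis using mor[of u v] f g s obj by (cases "u = v") (auto simp: is_pfunctor_def)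
  qed (use f g s in \<open>simp add: is_pfunctor_def\<close>)
  ultimately show ?thesis using s by (intro pfunctor.equality) (simp_all add: fun_eq_iff)
qed

text \<open>
  Every 1-simplex arises from the construction, for any automorphisms that are compatible with its
  vertex maps on the chosen realizations: by \<open>Gal_eq_on_cl\<close> they then agree on the whole vertices. This
  freedom in the choice of \<open>\<sigma>\<close> lets several 1-simplices be faces of one 2-simplex.
\<close>

lemma edge_eq_built:
  assumes f: "spx 1 f" and s: "supp f = {i, j}" and ne: "i \<noteq> j"
    and e: "e \<in> reals" "e' \<in> reals"
    and obj: "obj f {i} = cl (range e)" "obj f {j} = cl (range e')"
    and \<sigma>: "\<And>u. \<sigma> u \<in> Gal" and v: "\<sigma> {i} \<circ> e = \<alpha> i" "\<sigma> {j} \<circ> e' = \<alpha> j"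
    and t: "\<sigma> {i, j} \<circ> (mor f {i} {i, j} \<circ> e) = \<alpha> i" "\<sigma> {i, j} \<circ> (mor f {j} {i, j} \<circ> e') = \<alpha> j"
    and indep: "independent_family ind B {i, j} (\<lambda>i. cl (range (\<alpha> i)))"
  shows "f = built {i, j} \<sigma> \<alpha>"
proof -
  let ?g = "built {i, j} \<sigma> \<alpha>"
  have "\<alpha> i \<in> reals" "\<alpha> j \<in> reals" using reals_Gal[OF _ \<sigma>] e v by metis+
  then have g: "spx 1 ?g" using ne indep by (intro built_simplex \<sigma>) auto
  have key: "obj ?g {k} = obj f {k} \<and> mor ?g {k} {i, j} = mor f {k} {i, j}"
    if k: "k \<in> {i, j}" and d: "d \<in> reals" "obj f {k} = cl (range d)" "\<sigma> {k} \<circ> d = \<alpha> k"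
      "\<sigma> {i, j} \<circ> (mor f {k} {i, j} \<circ> d) = \<alpha> k" for k d
  proof -
    have range: "\<sigma> {k} ` range d = range (\<alpha> k)" unfolding d(3)[symmetric] by (simp add: image_comp)
    have "obj ?g {k} = inv_map (\<sigma> {k}) ` cl (\<sigma> {k} ` range d)"
      using k by (auto simp: built_def range)
    also have "\<dots> = inv_map (\<sigma> {k}) ` \<sigma> {k} ` cl (range d)" by (simp only: cl_Gal[OF \<sigma>])
    also have "\<dots> = obj f {k}" using d(2) by (simp add: image_image AutOver_inv_apply(1)[OF \<sigma>])
    finally have o: "obj ?g {k} = obj f {k}" .
    obtain \<rho> where \<rho>: "\<rho> \<in> Gal" "mor f {k} {i, j} = restrict \<rho> (obj f {k})"
      using spx_mor[OF f, of "{k}" "{i, j}"] s k by auto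
    have "d x \<in> obj f {k}" for x using cl_extensive[of "range d"] d(2) by auto
    then have "mor f {k} {i, j} \<circ> d = \<rho> \<circ> d" by (auto simp: \<rho>(2))
    then have eq: "\<sigma> {k} \<circ> d = (\<sigma> {i, j} \<circ> \<rho>) \<circ> d" using d(3,4) by (simp add: comp_assoc)
    have "inv_map (\<sigma> {i, j}) (\<sigma> {k} x) = \<rho> x" if "x \<in> obj f {k}" for x
      using Gal_eq_on_cl[OF d(1) \<sigma> AutOver_comp[OF \<sigma> \<rho>(1)] eq] that d(2)
        AutOver_inv_apply(1)[OF \<sigma>] by simp
    then have "restrict (inv_map (\<sigma> {i, j}) \<circ> \<sigma> {k}) (obj ?g {k}) = restrict \<rho> (obj f {k})"
      unfolding o by (auto simp: fun_eq_iff)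
    moreover have "mor ?g {k} {i, j} = restrict (inv_map (\<sigma> {i, j}) \<circ> \<sigma> {k}) (obj ?g {k})"
      using k by (auto simp: built_def)
    ultimately show ?thesis using o \<rho>(2) by simp
  qed
  have i: "obj ?g {i} = obj f {i}" "mor ?g {i} {i, j} = mor f {i} {i, j}"
    using key[OF _ e(1) obj(1) v(1) t(1)] by simp_all
  have j: "obj ?g {j} = obj f {j}" "mor ?g {j} {i, j} = mor f {j} {i, j}"
    using key[OF _ e(2) obj(2) v(2) t(2)] by simp_all
  have sg: "supp ?g = {i, j}" by (simp add: built_def)
  have sub: "u = {} \<or> u = {i} \<or> u = {j} \<or> u = {i, j}" if "u \<subseteq> {i, j}" for u
    using that by auto
  have top: "obj h {i, j} = acl M ((\<Union>k\<in>{i, j}. mor h {k} {i, j} ` obj h {k}) \<union> B)"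
    if "spx 1 h" "supp h = {i, j}" for h
    using spx_obj[OF that(1), of "{i, j}"] that(2) by blast
  show ?thesis
  proof (rule pfunctor_eqI[OF spx_pfunctor[OF f] spx_pfunctor[OF g] s sg])
    fix u assume "u \<subseteq> {i, j}"
    moreover have "obj f {} = obj ?g {}" by (simp add: spx_obj_empty[OF f] spx_obj_empty[OF g])
    moreover have "obj f {i, j} = obj ?g {i, j}"
      unfolding top[OF f s] top[OF g sg] by (simp add: i j)
    ultimately show "obj f u = obj ?g u" using sub[of u] i j by auto
  next
    fix u v assume uv: "u \<subset> v" "v \<subseteq> {i, j}"
    show "mor f u v = mor ?g u v"
    proof (cases "u = {}")
      case True
      then show ?thesis using spx_mor_empty[OF f] spx_mor_empty[OF g] s sg uv(2) by simp
    next
      case False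
      then have "(u = {i} \<or> u = {j}) \<and> v = {i, j}" using uv by auto
      then show ?thesis using i j by auto
    qed
  qed
qed

text \<open>
  \<open>edge f i e a j e' b\<close>: \<open>f\<close> is a 1-simplex on \<open>{i < j}\<close> whose vertices are the closures of the
  realizations \<open>e\<close> and \<open>e'\<close>, and whose two vertex maps take \<open>(e, e')\<close> to a conjugate of \<open>(a, b)\<close>.
\<close>

definition edge :: "'m pfunctor \<Rightarrow> nat \<Rightarrow> ('x \<Rightarrow> 'm) \<Rightarrow> ('x \<Rightarrow> 'm) \<Rightarrow> nat \<Rightarrow> ('x \<Rightarrow> 'm) \<Rightarrow>
    ('x \<Rightarrow> 'm) \<Rightarrow> bool" where
  "edge f i e a j e' b \<longleftrightarrow> spx 1 f \<and> i < j \<and> supp f = {i, j} \<and> e \<in> reals \<and> e' \<in> reals \<and>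
     obj f {i} = cl (range e) \<and> obj f {j} = cl (range e') \<and>
     (\<exists>\<tau>\<in>Gal. \<tau> \<circ> (mor f {i} {i, j} \<circ> e) = a \<and> \<tau> \<circ> (mor f {j} {i, j} \<circ> e') = b)"

lemma edge_Gal: "edge f i e a j e' b \<Longrightarrow> \<sigma> \<in> Gal \<Longrightarrow> edge f i e (\<sigma> \<circ> a) j e' (\<sigma> \<circ> b)"
proof -
  assume f: "edge f i e a j e' b" and \<sigma>: "\<sigma> \<in> Gal"
  then obtain \<tau> where \<tau>: "\<tau> \<in> Gal" "\<tau> \<circ> (mor f {i} {i, j} \<circ> e) = a"
    "\<tau> \<circ> (mor f {j} {i, j} \<circ> e') = b"
    by (auto simp: edge_def)
  then have "\<sigma> \<circ> \<tau> \<in> Gal" "\<sigma> \<circ> \<tau> \<circ> (mor f {i} {i, j} \<circ> e) = \<sigma> \<circ> a"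
    "\<sigma> \<circ> \<tau> \<circ> (mor f {j} {i, j} \<circ> e') = \<sigma> \<circ> b"
    using AutOver_comp[OF \<sigma>] by (simp_all add: comp_assoc)
  then show ?thesis using f unfolding edge_def by blast
qed

lemma spx_mor_reals:
  assumes "spx n f" "{i} \<subseteq> v" "v \<subseteq> supp f" "e \<in> reals" "obj f {i} = cl (range e)"
  shows "mor f {i} v \<circ> e \<in> reals"
proof -
  obtain \<rho> where \<rho>: "\<rho> \<in> Gal" "mor f {i} v = restrict \<rho> (obj f {i})"
    using spx_mor[OF assms(1-3)] by blast
  have "e x \<in> obj f {i}" for x using cl_extensive[of "range e"] assms(5) by auto
  then have "mor f {i} v \<circ> e = \<rho> \<circ> e" by (auto simp: \<rho>(2))
  then show ?thesis using reals_Gal[OF assms(4) \<rho>(1)] by simp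
qed

lemma edge_reals:
  assumes "edge f i e a j e' b"
  shows "a \<in> reals" "b \<in> reals" "e \<in> reals" "e' \<in> reals"
proof -
  obtain \<tau> where \<tau>: "\<tau> \<in> Gal" "\<tau> \<circ> (mor f {i} {i, j} \<circ> e) = a" "\<tau> \<circ> (mor f {j} {i, j} \<circ> e') = b"
    using assms by (auto simp: edge_def)
  have f: "spx 1 f" "supp f = {i, j}" "obj f {i} = cl (range e)" "obj f {j} = cl (range e')"
    and e: "e \<in> reals" "e' \<in> reals"
    using assms by (simp_all add: edge_def)
  have "mor f {i} {i, j} \<circ> e \<in> reals" "mor f {j} {i, j} \<circ> e' \<in> reals"
    using spx_mor_reals[OF f(1), of i "{i, j}" e] spx_mor_reals[OF f(1), of j "{i, j}" e'] f e by auto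
  then show "a \<in> reals" "b \<in> reals" "e \<in> reals" "e' \<in> reals"
    using reals_Gal[OF _ \<tau>(1)] \<tau>(2,3) e by metis+
qed

lemma edge_exists:
  assumes ij: "i < j" and r: "e \<in> reals" "a \<in> reals" "e' \<in> reals" "b \<in> reals"
    and indep: "ind (range a) B (range b)"
  obtains f where "edge f i e a j e' b"
proof -
  obtain \<sigma>i \<sigma>j where \<sigma>i: "\<sigma>i \<in> Gal" "\<sigma>i \<circ> e = a" and \<sigma>j: "\<sigma>j \<in> Gal" "\<sigma>j \<circ> e' = b"
    using reals_transitive r by metis
  define \<sigma> where "\<sigma> u = (if u = {i} then \<sigma>i else if u = {j} then \<sigma>j else id)" for u
  define \<alpha> where "\<alpha> k = (if k = i then a else b)" for k
  have ne: "i \<noteq> j" "{i} \<noteq> {j}" "{i, j} \<noteq> {i}" "{i, j} \<noteq> {j}" using ij by auto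
  have \<sigma>: "\<sigma> u \<in> Gal" for u using \<sigma>i \<sigma>j AutOver_id[of M B] by (simp add: \<sigma>_def)
  have \<sigma>v: "\<sigma> {i} = \<sigma>i" "\<sigma> {j} = \<sigma>j" "\<sigma> {i, j} = id" using ne by (simp_all add: \<sigma>_def)
  have \<alpha>: "\<alpha> i = a" "\<alpha> j = b" using ne by (simp_all add: \<alpha>_def)
  let ?f = "built {i, j} \<sigma> \<alpha>"
  have fam: "independent_family ind B {i, j} (\<lambda>k. cl (range (\<alpha> k)))"
    using independent_pair[OF ne(1), of \<alpha>] indep by (simp add: \<alpha>)
  have spx: "spx 1 ?f"
    using ne r \<alpha> fam by (intro built_simplex \<sigma>) auto
  have obj: "obj ?f {k} = cl (range (inv_map (\<sigma> {k}) \<circ> \<alpha> k))" if "k \<in> {i, j}" for k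
    using that cl_Gal[OF AutOver_inv[OF \<sigma>]] by (auto simp: built_def image_comp)
  have inv: "inv_map (\<sigma> {i}) \<circ> \<alpha> i = e" "inv_map (\<sigma> {j}) \<circ> \<alpha> j = e'"
    using AutOver_inv_apply(1)[OF \<sigma>i(1)] AutOver_inv_apply(1)[OF \<sigma>j(1)] \<sigma>i(2) \<sigma>j(2)
    by (auto simp: \<sigma>v \<alpha>)
  have o: "obj ?f {i} = cl (range e)" "obj ?f {j} = cl (range e')"
    using obj[of i] obj[of j] inv by simp_all
  have mor: "mor ?f {k} {i, j} x = \<sigma> {k} x" if "k \<in> {i, j}" "x \<in> obj ?f {k}" for k x
    using that \<sigma>v(3) by (auto simp: built_def inv_id[unfolded id_def] id_def)
  have "mor ?f {i} {i, j} \<circ> e = a" "mor ?f {j} {i, j} \<circ> e' = b"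
  proof -
    have "e x \<in> obj ?f {i}" "e' x \<in> obj ?f {j}" for x
      using cl_extensive[of "range e"] cl_extensive[of "range e'"] unfolding o by auto
    then have "mor ?f {i} {i, j} (e x) = \<sigma>i (e x)" "mor ?f {j} {i, j} (e' x) = \<sigma>j (e' x)" for x
      using mor[of i "e x"] mor[of j "e' x"] by (simp_all add: \<sigma>v)
    then show "mor ?f {i} {i, j} \<circ> e = a" "mor ?f {j} {i, j} \<circ> e' = b"
      unfolding \<sigma>i(2)[symmetric] \<sigma>j(2)[symmetric] by (simp_all add: fun_eq_iff)
  qed
  moreover have "supp ?f = {i, j}" by (simp add: built_def)
  ultimately have "edge ?f i e a j e' b"
    unfolding edge_def using spx ij r o by (intro conjI bexI[of _ id] AutOver_id) simp_all
  then show thesis by (rule that)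
qed

text \<open>
  The amalgamation that produces 2-simplices: three edges that fit together along an independent triple
  bound a 2-simplex.
\<close>

lemma triangle:
  assumes f: "edge f i e a j e' b" and g: "edge g j e' b k e'' c" and h: "edge h i e a k e'' c"
    and ab: "ind (range a) B (range b)" and c: "ind (range c) B (range a \<union> range b)"
  obtains F where "spx 2 F" "face 0 F = g" "face 1 F = h" "face 2 F = f"
proof -
  have ijk: "i < j" "j < k" using f g by (simp_all add: edge_def)
  have r: "a \<in> reals" "b \<in> reals" "c \<in> reals" "e \<in> reals" "e' \<in> reals" "e'' \<in> reals"
    using edge_reals[OF f] edge_reals[OF g] by simp_all
  obtain \<sigma>i where \<sigma>i: "\<sigma>i \<in> Gal" "\<sigma>i \<circ> e = a" using reals_transitive r by metis
  obtain \<sigma>j where \<sigma>j: "\<sigma>j \<in> Gal" "\<sigma>j \<circ> e' = b" using reals_transitive r by metis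
  obtain \<sigma>k where \<sigma>k: "\<sigma>k \<in> Gal" "\<sigma>k \<circ> e'' = c" using reals_transitive r by metis
  obtain \<tau>f where \<tau>f: "\<tau>f \<in> Gal" "\<tau>f \<circ> (mor f {i} {i, j} \<circ> e) = a" "\<tau>f \<circ> (mor f {j} {i, j} \<circ> e') = b"
    using f by (auto simp: edge_def)
  obtain \<tau>g where \<tau>g: "\<tau>g \<in> Gal" "\<tau>g \<circ> (mor g {j} {j, k} \<circ> e') = b" "\<tau>g \<circ> (mor g {k} {j, k} \<circ> e'') = c"
    using g by (auto simp: edge_def)
  obtain \<tau>h where \<tau>h: "\<tau>h \<in> Gal" "\<tau>h \<circ> (mor h {i} {i, k} \<circ> e) = a" "\<tau>h \<circ> (mor h {k} {i, k} \<circ> e'') = c"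
    using h by (auto simp: edge_def)
  \<comment> \<open>all faces of the 2-simplex are embedded compatibly into the closure of \<open>a\<close>, \<open>b\<close>, \<open>c\<close>\<close>
  define \<sigma> where "\<sigma> u = (if u = {i} then \<sigma>i else if u = {j} then \<sigma>j else if u = {k} then \<sigma>k
    else if u = {i, j} then \<tau>f else if u = {j, k} then \<tau>g else if u = {i, k} then \<tau>h else id)" for u
  define \<alpha> where "\<alpha> l = (if l = i then a else if l = j then b else c)" for l
  have ne: "i \<noteq> j" "j \<noteq> k" "i \<noteq> k" using ijk by auto
  have \<sigma>: "\<sigma> u \<in> Gal" for u
    using \<sigma>i \<sigma>j \<sigma>k \<tau>f \<tau>g \<tau>h AutOver_id[of M B] by (simp add: \<sigma>_def)
  have \<sigma>1: "\<sigma> {i} = \<sigma>i" "\<sigma> {j} = \<sigma>j" "\<sigma> {k} = \<sigma>k" using ne by (simp_all add: \<sigma>_def)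
  have \<sigma>2: "\<sigma> {i, j} = \<tau>f" "\<sigma> {j, k} = \<tau>g" "\<sigma> {i, k} = \<tau>h"
    using ne by (simp_all add: \<sigma>_def doubleton_eq_iff)
  have \<alpha>: "\<alpha> i = a" "\<alpha> j = b" "\<alpha> k = c" using ne by (simp_all add: \<alpha>_def)
  let ?F = "built {i, j, k} \<sigma> \<alpha>"
  have fam: "independent_family ind B {i, j, k} (\<lambda>l. cl (range (\<alpha> l)))"
    using independent_triple[OF ne(1,3,2), of \<alpha>] ab c by (simp add: \<alpha>)
  have spx: "spx 2 ?F"
    using ne r \<alpha> fam by (intro built_simplex \<sigma>) auto
  have fam2: "independent_family ind B t (\<lambda>l. cl (range (\<alpha> l)))" if "t \<subseteq> {i, j, k}" for t
    using independent_family_subset[OF fam that] cl_small small_range by blast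
  have "f = built {i, j} \<sigma> \<alpha>"
    using f \<tau>f ne \<sigma>i \<sigma>j fam2[of "{i, j}"] by (intro edge_eq_built \<sigma>) (auto simp: edge_def \<sigma>1 \<sigma>2 \<alpha>)
  moreover have "g = built {j, k} \<sigma> \<alpha>"
    using g \<tau>g ne \<sigma>j \<sigma>k fam2[of "{j, k}"] by (intro edge_eq_built \<sigma>) (auto simp: edge_def \<sigma>1 \<sigma>2 \<alpha>)
  moreover have "h = built {i, k} \<sigma> \<alpha>"
    using h \<tau>h ne \<sigma>i \<sigma>k fam2[of "{i, k}"] by (intro edge_eq_built \<sigma>) (auto simp: edge_def \<sigma>1 \<sigma>2 \<alpha>)
  moreover have "supp ?F = {i, j, k}" by (simp add: built_def)
  moreover have "{i, j, k} - {i} = {j, k}" "{i, j, k} - {j} = {i, k}" "{i, j, k} - {k} = {i, j}"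
    using ne by auto
  ultimately have "face 0 ?F = g" "face 1 ?F = h" "face 2 ?F = f"
    unfolding face_def by (simp_all add: sorted_list_of_set_3[OF ijk] built_restrict)
  then show thesis using that spx by blast
qed

end

section \<open>Chains modulo boundaries\<close>

lemma boundary_0 [simp]: "boundary n 0 = 0"
  by (simp add: boundary_def)

lemma boundary_add: "boundary n (a + b) = boundary n a + boundary n b"
  by (simp add: boundary_def frag_extend_add)

lemma boundary_minus: "boundary n (- a) = - boundary n a"
  by (simp add: boundary_def frag_extend_minus)

lemma boundary_diff: "boundary n (a - b) = boundary n a - boundary n b"
  by (simp add: boundary_def frag_extend_diff)

lemma boundary_1: "boundary 1 (frag_of f) = frag_of (face 0 f) - frag_of (face 1 f)"
  by (simp add: boundary_def)

lemma boundary_2: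
  "boundary 2 (frag_of f) = frag_of (face 0 f) - frag_of (face 1 f) + frag_of (face 2 f)"
  by (simp add: boundary_def numeral_2_eq_2)

lemma restrict_restrict:
  "t' \<subseteq> t \<Longrightarrow> pfunctor_restrict (pfunctor_restrict f t) t' = pfunctor_restrict f t'"
  by (auto simp: pfunctor_restrict_def fun_eq_iff)

lemma restrict_simps [simp]:
  "supp (pfunctor_restrict f t) = t"
  "u \<subseteq> t \<Longrightarrow> obj (pfunctor_restrict f t) u = obj f u"
  "u \<subseteq> v \<Longrightarrow> v \<subseteq> t \<Longrightarrow> mor (pfunctor_restrict f t) u v = mor f u v"
  by (simp_all add: pfunctor_restrict_def)

lemma face_edge:
  assumes "supp f = {i, j}" "i < j"
  shows "face 0 f = pfunctor_restrict f {j}" "face 1 f = pfunctor_restrict f {i}"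
proof -
  have "{i, j} - {i} = {j}" "{i, j} - {j} = {i}" using assms(2) by auto
  then show "face 0 f = pfunctor_restrict f {j}" "face 1 f = pfunctor_restrict f {i}"
    by (simp_all add: face_def assms(1) sorted_list_of_set_2[OF assms(2)])
qed

lemma face_triangle:
  assumes "supp f = {i, j, k}" "i < j" "j < k"
  shows "face 0 f = pfunctor_restrict f {j, k}" "face 1 f = pfunctor_restrict f {i, k}"
    "face 2 f = pfunctor_restrict f {i, j}"
proof -
  have "{i, j, k} - {i} = {j, k}" "{i, j, k} - {j} = {i, k}" "{i, j, k} - {k} = {i, j}"
    using assms(2,3) by auto
  then show "face 0 f = pfunctor_restrict f {j, k}" "face 1 f = pfunctor_restrict f {i, k}"
    "face 2 f = pfunctor_restrict f {i, j}"
    by (simp_all add: face_def assms(1) sorted_list_of_set_3[OF assms(2,3)])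
qed

lemma card_2_nat:
  assumes "card (s :: nat set) = 2"
  obtains i j where "s = {i, j}" "i < j"
proof -
  obtain x y where "s = {x, y}" "x \<noteq> y" using assms by (meson card_2_iff)
  then show thesis using that[of x y] that[of y x] by (cases "x < y") (auto simp: insert_commute)
qed

lemma card_3_nat:
  assumes "card (s :: nat set) = 3"
  obtains i j k where "s = {i, j, k}" "i < j" "j < k"
proof -
  have fin: "finite s" and ne: "s \<noteq> {}" using assms by (auto simp: card_eq_0_iff intro: ccontr)
  have "card (s - {Min s}) = 2" using assms fin ne by simp
  then obtain j k where jk: "s - {Min s} = {j, k}" "j < k" by (rule card_2_nat)
  have "j \<in> s - {Min s}" by (simp add: jk(1))
  then have "Min s \<le> j" "Min s \<noteq> j" using Min_le[OF fin, of j] by blast+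
  then have "Min s < j" by simp
  moreover have "s = {Min s, j, k}" using jk(1) Min_in[OF fin ne] by blast
  ultimately show thesis using that jk(2) by blast
qed

context homology_setting
begin

lemma spx_restrict:
  assumes f: "spx n f" and t: "t \<subseteq> supp f" and m: "card t = m + 1"
  shows "spx m (pfunctor_restrict f t)"
proof -
  let ?g = "pfunctor_restrict f t"
  have P: "is_pfunctor M B f" using spx_pfunctor[OF f] .
  note obj = pfunctor_obj[OF P] and mor = pfunctor_mor[OF P]
  note P' = P[unfolded is_pfunctor_def]
  have fin: "finite (supp f)" using P' by (rule conjunct1)
  note id = P'[THEN conjunct2, THEN conjunct2, THEN conjunct2, THEN conjunct1, rule_format]
    and cmp = P'[THEN conjunct2, THEN conjunct2, THEN conjunct2, THEN conjunct2, THEN conjunct1,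
      rule_format, OF conjI[OF _ conjI]]
  have "is_pfunctor M B ?g"
    unfolding is_pfunctor_def
  proof (intro conjI allI impI)
    show "finite (supp ?g)" using fin t finite_subset by auto
    show "obj ?g u \<in> C_obj B" if "u \<subseteq> supp ?g" for u using that obj[of u] t by auto
    show "mor ?g u v \<in> C_hom M B (obj ?g u) (obj ?g v)" if "u \<subseteq> v \<and> v \<subseteq> supp ?g" for u v
    proof -
      have "u \<subseteq> v" "v \<subseteq> t" "u \<subseteq> t" using that by auto
      then show ?thesis using mor[of u v] t by simp
    qed
    show "mor ?g u u = (\<lambda>x\<in>obj ?g u. x)" if "u \<subseteq> supp ?g" for u using that id[of u] t by simp
    show "mor ?g u w = compose (obj ?g u) (mor ?g v w) (mor ?g u v)"
      if "u \<subseteq> v \<and> v \<subseteq> w \<and> w \<subseteq> supp ?g" for u v w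
    proof -
      have "u \<subseteq> v" "v \<subseteq> w" "w \<subseteq> t" "u \<subseteq> w" "v \<subseteq> t" "u \<subseteq> t" using that by auto
      then show ?thesis using cmp[of u v w] t by simp
    qed
    show "obj ?g u = {}" if "\<not> u \<subseteq> supp ?g" for u
      using that by (simp add: pfunctor_restrict_def)
    show "mor ?g u v = (\<lambda>_. undefined)" if "\<not> (u \<subseteq> v \<and> v \<subseteq> supp ?g)" for u v
      using that by (auto simp: pfunctor_restrict_def)
  qed
  moreover have "\<exists>b\<in>reals. obj ?g {i} = cl (range b)" if "i \<in> t" for i
  proof -
    have "\<forall>i\<in>supp f. \<exists>b\<in>reals. obj f {i} = cl (range b)" using f unfolding simplex_def by blast
    then show ?thesis using that t by auto
  qed
  moreover have "obj ?g u = acl M ((\<Union>i\<in>u. mor ?g {i} u ` obj ?g {i}) \<union> B) \<and>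
      independent_family ind B u (\<lambda>i. mor ?g {i} u ` obj ?g {i})" if "u \<noteq> {}" "u \<subseteq> t" for u
  proof -
    have eq: "mor ?g {i} u ` obj ?g {i} = mor f {i} u ` obj f {i}" if "i \<in> u" for i
      using that \<open>u \<subseteq> t\<close> by auto
    have "(\<Union>i\<in>u. mor ?g {i} u ` obj ?g {i}) = (\<Union>i\<in>u. mor f {i} u ` obj f {i})"
      by (intro SUP_cong refl eq)
    moreover have "independent_family ind B u (\<lambda>i. mor f {i} u ` obj f {i})"
      using f that t unfolding simplex_def by blast
    then have "independent_family ind B u (\<lambda>i. mor ?g {i} u ` obj ?g {i})"
      unfolding independent_family_def using eq by (metis (no_types, lifting) DiffD1 SUP_cong)
    ultimately show ?thesis using spx_obj[OF f that(1)] that t by auto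
  qed
  moreover have "obj ?g {} = B" using spx_obj_empty[OF f] by simp
  ultimately show ?thesis unfolding simplex_def restrict_simps(1) using m by blast
qed

lemma spx_1_supp:
  assumes "spx 1 f"
  obtains i j where "supp f = {i, j}" "i < j"
proof -
  have "card (supp f) = 2" using assms unfolding simplex_def by simp
  then show thesis using card_2_nat that by metis
qed

lemma spx_2_supp:
  assumes "spx 2 f"
  obtains i j k where "supp f = {i, j, k}" "i < j" "j < k"
proof -
  have "card (supp f) = 3" using assms unfolding simplex_def by simp
  then show thesis using card_3_nat that by metis
qed

lemma spx_2_faces:
  assumes "spx 2 f"
  shows "spx 1 (face 0 f)" "spx 1 (face 1 f)" "spx 1 (face 2 f)"
proof -
  obtain i j k where s: "supp f = {i, j, k}" "i < j" "j < k" using spx_2_supp[OF assms] .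
  then show "spx 1 (face 0 f)" "spx 1 (face 1 f)" "spx 1 (face 2 f)"
    unfolding face_triangle[OF s] by (auto intro!: spx_restrict[OF assms])
qed

lemma boundary_boundary:
  assumes "spx 2 f"
  shows "boundary 1 (boundary 2 (frag_of f)) = 0"
proof -
  obtain i j k where s: "supp f = {i, j, k}" "i < j" "j < k" using spx_2_supp[OF assms] .
  have "i < k" using s by simp
  then show ?thesis
    unfolding boundary_2 boundary_add boundary_diff boundary_1 face_triangle[OF s]
    by (simp add: face_edge[OF _ s(2)] face_edge[OF _ s(3)] face_edge[OF _ \<open>i < k\<close>]
        restrict_restrict del: One_nat_def)
qed

text \<open>
  \<open>Bd\<close>, \<open>Z1\<close> and \<open>C1\<close> are the boundaries, cycles and chains in degree 1. Chains are compared modulo \<open>Bd\<close>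
  by stating that their difference lies in \<open>Bd\<close>.
\<close>

abbreviation Bd :: "('m pfunctor \<Rightarrow>\<^sub>0 int) set" where "Bd \<equiv> boundaries M B ind p 1"
abbreviation Z1 :: "('m pfunctor \<Rightarrow>\<^sub>0 int) monoid" where "Z1 \<equiv> cycle_group M B ind p 1"
abbreviation C1 :: "('m pfunctor \<Rightarrow>\<^sub>0 int) monoid" where "C1 \<equiv> chain_group M B ind p 1"

lemma Bd_iff: "x \<in> Bd \<longleftrightarrow> (\<exists>c. Poly_Mapping.keys c \<subseteq> {f. spx 2 f} \<and> x = boundary 2 c)"
proof -
  have 2: "Suc 1 = (2::nat)" by simp
  show ?thesis
    unfolding boundaries_def chain_group_def 2 image_iff Bex_def carrier_free_Abelian_group_iff ..
qed

lemma Bd_0 [simp]: "0 \<in> Bd"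
  unfolding Bd_iff by (rule exI[of _ 0]) simp

lemma Bd_diff:
  assumes "x \<in> Bd" "y \<in> Bd"
  shows "x - y \<in> Bd"
proof -
  obtain c d where "Poly_Mapping.keys c \<subseteq> {f. spx 2 f}" "x = boundary 2 c"
    "Poly_Mapping.keys d \<subseteq> {f. spx 2 f}" "y = boundary 2 d"
    using assms unfolding Bd_iff by blast
  then show ?thesis
    unfolding Bd_iff using keys_diff[of c d] by (intro exI[of _ "c - d"]) (auto simp: boundary_diff)
qed

lemma Bd_minus: "x \<in> Bd \<Longrightarrow> - x \<in> Bd"
  using Bd_diff[OF Bd_0, of x] by simp

lemma Bd_add: "x \<in> Bd \<Longrightarrow> y \<in> Bd \<Longrightarrow> x + y \<in> Bd"
  using Bd_diff[of x "- y"] Bd_minus[of y] by simp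

lemma Bd_spx: "spx 2 f \<Longrightarrow> frag_of (face 0 f) - frag_of (face 1 f) + frag_of (face 2 f) \<in> Bd"
  unfolding Bd_iff boundary_2[symmetric] by (intro exI[of _ "frag_of f"]) simp

lemma carrier_C1: "c \<in> carrier C1 \<longleftrightarrow> Poly_Mapping.keys c \<subseteq> {f. spx 1 f}"
  by (simp add: chain_group_def)

lemma carrier_Z1: "c \<in> carrier Z1 \<longleftrightarrow> Poly_Mapping.keys c \<subseteq> {f. spx 1 f} \<and> boundary 1 c = 0"
  by (simp add: cycle_group_def carrier_C1 del: One_nat_def)

lemma Bd_subset: "Bd \<subseteq> carrier Z1"
proof
  fix x assume "x \<in> Bd"
  then obtain c where c: "Poly_Mapping.keys c \<subseteq> {f. spx 2 f}" "x = boundary 2 c"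
    unfolding Bd_iff by blast
  have "boundary 2 c \<in> carrier Z1"
    using c(1)
  proof (induction rule: frag_induction)
    case (one f)
    then have f: "spx 2 f" by simp
    have "Poly_Mapping.keys (boundary 2 (frag_of f)) \<subseteq> {f. spx 1 f}"
      unfolding boundary_2
      using spx_2_faces[OF f] keys_add[of "frag_of (face 0 f) - frag_of (face 1 f)" "frag_of (face 2 f)"]
        keys_diff[of "frag_of (face 0 f)" "frag_of (face 1 f)"]
      by auto
    then show ?case using boundary_boundary[OF f] by (simp add: carrier_Z1 del: One_nat_def)
  next
    case (diff a b)
    then show ?case
      using keys_diff[of "boundary 2 a" "boundary 2 b"] by (auto simp: carrier_Z1 boundary_diff simp del: One_nat_def)
  qed (simp add: carrier_Z1 del: One_nat_def)
  then show "x \<in> carrier Z1" using c(2) by simp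
qed

section \<open>Transport between vertices\<close>

lemma edge_ind:
  assumes f: "edge f i e a j e' b"
  shows "ind (range a) B (range b)"
proof -
  obtain \<tau> where \<tau>: "\<tau> \<in> Gal" "\<tau> \<circ> (mor f {i} {i, j} \<circ> e) = a" "\<tau> \<circ> (mor f {j} {i, j} \<circ> e') = b"
    using f by (auto simp: edge_def)
  let ?X = "\<lambda>k. mor f {k} {i, j} ` obj f {k}"
  have s: "spx 1 f" "supp f = {i, j}" "i < j" and o: "obj f {i} = cl (range e)" "obj f {j} = cl (range e')"
    using f by (simp_all add: edge_def)
  have "independent_family ind B {i, j} ?X" using s unfolding simplex_def by blast
  moreover have "{i, j} - {i} = {j}" using s(3) by auto
  ultimately have X: "ind (?X i) B (?X j)" by (simp add: independent_family_def)
  have sm: "small (?X i)" "small (?X j)"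
    unfolding o using cl_small small_range small_image_set by blast+
  have r: "range (mor f {i} {i, j} \<circ> e) \<subseteq> ?X i" "range (mor f {j} {i, j} \<circ> e') \<subseteq> ?X j"
    unfolding o using cl_extensive[of "range e"] cl_extensive[of "range e'"] by auto
  have "ind (range (mor f {i} {i, j} \<circ> e)) B (range (mor f {j} {i, j} \<circ> e'))"
    by (rule ind_mono[OF X sm(1) small_B sm(2) r])
  then have "ind (\<tau> ` range (mor f {i} {i, j} \<circ> e)) B (\<tau> ` range (mor f {j} {i, j} \<circ> e'))"
    using ind_Gal[OF \<tau>(1)] small_range by blast
  moreover have "\<tau> ` range (mor f {i} {i, j} \<circ> e) = range a" "\<tau> ` range (mor f {j} {i, j} \<circ> e') = range b"
    unfolding \<tau>(2,3)[symmetric] by (simp_all add: image_comp comp_assoc)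
  ultimately show ?thesis by simp
qed

lemma triangle_Bd:
  assumes "edge f i e a j e' b" "edge g j e' b k e'' c" "edge h i e a k e'' c"
    "ind (range c) B (range a \<union> range b)"
  shows "frag_of g - frag_of h + frag_of f \<in> Bd"
  using triangle[OF assms(1-3) edge_ind[OF assms(1)] assms(4)] Bd_spx by metis

text \<open>
  \<open>path x i e a j e' b\<close>: the chain \<open>x\<close> leads from the vertex \<open>(i, e)\<close>, placed at \<open>a\<close>, to the vertex
  \<open>(j, e')\<close>, placed at \<open>b\<close>, through a vertex of larger index placed at a realization independent
  from \<open>a\<close> and \<open>b\<close>. In contrast to edges, paths exist between arbitrary \<open>a\<close> and \<open>b\<close>.
\<close>

definition path :: "('m pfunctor \<Rightarrow>\<^sub>0 int) \<Rightarrow> nat \<Rightarrow> ('x \<Rightarrow> 'm) \<Rightarrow> ('x \<Rightarrow> 'm) \<Rightarrow> nat \<Rightarrow> ('x \<Rightarrow> 'm) \<Rightarrow>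
    ('x \<Rightarrow> 'm) \<Rightarrow> bool" where
  "path x i e a j e' b \<longleftrightarrow> (\<exists>k d c f g. x = frag_of f - frag_of g \<and> edge f i e a k d c \<and>
     edge g j e' b k d c \<and> ind (range c) B (range a \<union> range b))"

lemma edge_exists_ind:
  assumes "i < j" "e \<in> reals" "a \<in> reals" "e' \<in> reals" "b \<in> reals"
    and ind: "ind (range b) B D" and D: "range a \<subseteq> D" "small D"
  obtains f where "edge f i e a j e' b"
proof -
  have "ind (range b) B (range a)"
    by (rule ind_mono[OF ind small_range small_B D(2) order_refl D(1)])
  then have "ind (range a) B (range b)" using ind_sym small_range small_B by blast
  then show thesis using edge_exists assms(1-5) that by blast
qed

lemma path_exists:
  assumes "e \<in> reals" "a \<in> reals" "e' \<in> reals" "b \<in> reals" "d \<in> reals"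
  shows "\<exists>k c f g. edge f i e a k d c \<and> edge g j e' b k d c \<and> ind (range c) B (range a \<union> range b)"
proof -
  have s: "small (range a \<union> range b)" by (intro small_Un small_range)
  obtain c where c: "c \<in> reals" "ind (range c) B (range a \<union> range b)"
    using ind_extend[OF assms(2) s] by blast
  define k where "k = Suc (max i j)"
  have k: "i < k" "j < k" by (simp_all add: k_def)
  obtain f where f: "edge f i e a k d c"
    by (rule edge_exists_ind[OF k(1) assms(1,2,5) c _ s]) auto
  obtain g where g: "edge g j e' b k d c"
    by (rule edge_exists_ind[OF k(2) assms(3,4,5) c _ s]) auto
  show ?thesis using f g c(2) by blast
qed

text \<open>
  Two paths are compared with a third one, whose intermediate realization \<open>c2\<close> is independent from
  everything involved and sits at a still larger index.
\<close>

lemma path_unique: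
  assumes "path x i e a j e' b" "path y i e a j e' b"
  shows "x - y \<in> Bd"
proof -
  obtain k d c f g where 1: "x = frag_of f - frag_of g" "edge f i e a k d c" "edge g j e' b k d c"
    using assms(1) by (auto simp: path_def)
  obtain k' d' c' f' g' where 2: "y = frag_of f' - frag_of g'" "edge f' i e a k' d' c'"
    "edge g' j e' b k' d' c'"
    using assms(2) by (auto simp: path_def)
  note r = edge_reals[OF 1(2)] edge_reals[OF 1(3)] edge_reals[OF 2(2)]
  let ?D = "range a \<union> range b \<union> range c \<union> range c'"
  have s: "small ?D" by (intro small_Un small_range)
  obtain c2 where c2: "c2 \<in> reals" "ind (range c2) B ?D" using ind_extend[OF r(1) s] by blast
  define n where "n = Suc (max k k')"
  have lt: "i < k" "j < k" using 1 by (simp_all add: edge_def)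
  have n: "i < n" "j < n" "k < n" "k' < n" using lt by (simp_all add: n_def)
  obtain F where F: "edge F i e a n d c2"
    by (rule edge_exists_ind[OF n(1) r(3,1,4) c2 _ s]) auto
  obtain G where G: "edge G j e' b n d c2"
    by (rule edge_exists_ind[OF n(2) r(7,5,4) c2 _ s]) auto
  obtain P where P: "edge P k d c n d c2"
    by (rule edge_exists_ind[OF n(3) r(4,2,4) c2 _ s]) auto
  obtain P' where P': "edge P' k' d' c' n d c2"
    by (rule edge_exists_ind[OF n(4) r(12,10,4) c2 _ s]) auto
  have ind2: "ind (range c2) B D" if "D \<subseteq> ?D" for D
    by (rule ind_mono[OF c2(2) small_range small_B s order_refl that])
  have t: "frag_of P - frag_of F + frag_of f \<in> Bd" "frag_of P - frag_of G + frag_of g \<in> Bd"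
    "frag_of P' - frag_of F + frag_of f' \<in> Bd" "frag_of P' - frag_of G + frag_of g' \<in> Bd"
    using triangle_Bd[OF 1(2) P F ind2] triangle_Bd[OF 1(3) P G ind2]
      triangle_Bd[OF 2(2) P' F ind2] triangle_Bd[OF 2(3) P' G ind2] by auto
  have "x - y = ((frag_of P - frag_of F + frag_of f) - (frag_of P - frag_of G + frag_of g)) -
      ((frag_of P' - frag_of F + frag_of f') - (frag_of P' - frag_of G + frag_of g'))"
    by (simp add: 1(1) 2(1))
  then show ?thesis using Bd_diff t by metis
qed

text \<open>Some path; by \<open>path_unique\<close> it is well defined modulo boundaries.\<close>

definition transport :: "nat \<Rightarrow> ('x \<Rightarrow> 'm) \<Rightarrow> ('x \<Rightarrow> 'm) \<Rightarrow> nat \<Rightarrow> ('x \<Rightarrow> 'm) \<Rightarrow> ('x \<Rightarrow> 'm) \<Rightarrow>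
    ('m pfunctor \<Rightarrow>\<^sub>0 int)" where
  "transport i e a j e' b = (SOME x. path x i e a j e' b)"

lemma transport_path:
  assumes "path x i e a j e' b"
  shows "transport i e a j e' b - x \<in> Bd"
  using assms path_unique someI[of "\<lambda>x. path x i e a j e' b"] unfolding transport_def by blast

lemma transport_add:
  assumes r: "e \<in> reals" "a \<in> reals" "e' \<in> reals" "b \<in> reals" "e'' \<in> reals" "c \<in> reals"
  shows "transport i e a j e' b + transport j e' b k e'' c - transport i e a k e'' c \<in> Bd"
proof -
  let ?D = "range a \<union> range b \<union> range c"
  have s: "small ?D" by (intro small_Un small_range)
  obtain d where d: "d \<in> reals" "ind (range d) B ?D" using ind_extend[OF r(2) s] by blast
  define n where "n = Suc (max i (max j k))"
  have n: "i < n" "j < n" "k < n" by (simp_all add: n_def)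
  obtain f where f: "edge f i e a n e d" by (rule edge_exists_ind[OF n(1) r(1,2,1) d _ s]) auto
  obtain g where g: "edge g j e' b n e d" by (rule edge_exists_ind[OF n(2) r(3,4,1) d _ s]) auto
  obtain h where h: "edge h k e'' c n e d" by (rule edge_exists_ind[OF n(3) r(5,6,1) d _ s]) auto
  have ind2: "ind (range d) B D" if "D \<subseteq> ?D" for D
    by (rule ind_mono[OF d(2) small_range small_B s order_refl that])
  have i: "ind (range d) B (range a \<union> range b)" "ind (range d) B (range b \<union> range c)"
    "ind (range d) B (range a \<union> range c)"
    by (auto intro: ind2)
  have p: "path (frag_of f - frag_of g) i e a j e' b" "path (frag_of g - frag_of h) j e' b k e'' c"
    "path (frag_of f - frag_of h) i e a k e'' c"
    unfolding path_def using f g h i by blast+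
  have "transport i e a j e' b + transport j e' b k e'' c - transport i e a k e'' c =
    (transport i e a j e' b - (frag_of f - frag_of g)) + (transport j e' b k e'' c - (frag_of g - frag_of h))
     - (transport i e a k e'' c - (frag_of f - frag_of h))"
    by simp
  then show ?thesis using transport_path[OF p(1)] transport_path[OF p(2)] transport_path[OF p(3)]
    by (simp only: Bd_add Bd_diff)
qed

lemma transport_Gal:
  assumes r: "e \<in> reals" "a \<in> reals" "e' \<in> reals" "b \<in> reals" and \<sigma>: "\<sigma> \<in> Gal"
  shows "transport i e (\<sigma> \<circ> a) j e' (\<sigma> \<circ> b) - transport i e a j e' b \<in> Bd"
proof -
  obtain k c f g where p: "edge f i e a k e c" "edge g j e' b k e c" "ind (range c) B (range a \<union> range b)"
    using path_exists[OF r r(1), of i j] by blast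
  have "ind (\<sigma> ` range c) B (\<sigma> ` (range a \<union> range b))"
    using p(3) ind_Gal[OF \<sigma>] small_range small_Un by blast
  then have "ind (range (\<sigma> \<circ> c)) B (range (\<sigma> \<circ> a) \<union> range (\<sigma> \<circ> b))"
    by (simp add: image_comp image_Un)
  then have "path (frag_of f - frag_of g) i e (\<sigma> \<circ> a) j e' (\<sigma> \<circ> b)"
    unfolding path_def using edge_Gal[OF p(1) \<sigma>] edge_Gal[OF p(2) \<sigma>] by blast
  moreover have "path (frag_of f - frag_of g) i e a j e' b" unfolding path_def using p by blast
  ultimately have "(transport i e (\<sigma> \<circ> a) j e' (\<sigma> \<circ> b) - (frag_of f - frag_of g)) -
      (transport i e a j e' b - (frag_of f - frag_of g)) \<in> Bd"
    using transport_path Bd_diff by blast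
  then show ?thesis by simp
qed

lemma transport_edge:
  assumes f: "edge f i e a j e' b"
  shows "frag_of f - transport i e a j e' b \<in> Bd"
proof -
  note r = edge_reals[OF f]
  let ?D = "range a \<union> range b"
  have s: "small ?D" by (intro small_Un small_range)
  obtain d where d: "d \<in> reals" "ind (range d) B ?D" using ind_extend[OF r(1) s] by blast
  define n where "n = Suc j"
  have n: "i < n" "j < n" using f by (simp_all add: n_def edge_def)
  obtain g where g: "edge g i e a n e d" by (rule edge_exists_ind[OF n(1) r(3,1,3) d _ s]) auto
  obtain h where h: "edge h j e' b n e d" by (rule edge_exists_ind[OF n(2) r(4,2,3) d _ s]) auto
  have "frag_of h - frag_of g + frag_of f \<in> Bd" using triangle_Bd[OF f h g d(2)] .
  moreover have "path (frag_of g - frag_of h) i e a j e' b" unfolding path_def using g h d(2) by blast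
  ultimately have "(frag_of h - frag_of g + frag_of f) - (transport i e a j e' b - (frag_of g - frag_of h)) \<in> Bd"
    using transport_path Bd_diff by blast
  then show ?thesis by simp
qed

text \<open>Composing a loop of this kind with itself gives the same loop, so it vanishes.\<close>

lemma transport_refl:
  assumes "e \<in> reals" "a \<in> reals"
  shows "transport i e a i e a \<in> Bd"
  using transport_add[OF assms assms assms, of i i i] by simp

lemma transport_rev:
  assumes "e \<in> reals" "a \<in> reals" "e' \<in> reals" "b \<in> reals"
  shows "transport i e a j e' b + transport j e' b i e a \<in> Bd"
  using Bd_add[OF transport_add[OF assms(1-4) assms(1,2), of i j i] transport_refl[OF assms(1,2), of i]]
  by simp

text \<open>
  \<open>gen Y\<close> is a chosen realization whose closure is the vertex \<open>Y\<close>. The realization \<open>base\<close> is taken to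
  be the one chosen for its own closure.
\<close>

definition gen :: "'m set \<Rightarrow> 'x \<Rightarrow> 'm" where
  "gen Y = (SOME e. e \<in> reals \<and> cl (range e) = Y)"

definition base :: "'x \<Rightarrow> 'm" where
  "base = gen (cl (range (SOME a. a \<in> reals)))"

lemma gen: "a \<in> reals \<Longrightarrow> gen (cl (range a)) \<in> reals \<and> cl (range (gen (cl (range a)))) = cl (range a)"
  unfolding gen_def by (rule someI[of _ a]) simp

lemma base_real: "base \<in> reals" and gen_base: "gen (cl (range base)) = base"
proof -
  have "(SOME a. a \<in> reals) \<in> reals" using reals_nonempty by (rule someI_ex)
  then show "base \<in> reals" "gen (cl (range base)) = base"
    using gen unfolding base_def by metis+
qed

text \<open>
  The class of \<open>tau a b\<close> will be \<open>[a, b]\<close>: a loop at the base vertex that starts at \<open>a\<close> and ends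
  at \<open>b\<close>.
\<close>

definition tau :: "('x \<Rightarrow> 'm) \<Rightarrow> ('x \<Rightarrow> 'm) \<Rightarrow> ('m pfunctor \<Rightarrow>\<^sub>0 int)" where
  "tau a b = transport 0 base a 0 base b"

lemma tau_add:
  "a \<in> reals \<Longrightarrow> b \<in> reals \<Longrightarrow> c \<in> reals \<Longrightarrow> tau a b + tau b c - tau a c \<in> Bd"
  unfolding tau_def by (intro transport_add base_real)

lemma tau_Gal:
  "a \<in> reals \<Longrightarrow> b \<in> reals \<Longrightarrow> \<sigma> \<in> Gal \<Longrightarrow> tau (\<sigma> \<circ> a) (\<sigma> \<circ> b) - tau a b \<in> Bd"
  unfolding tau_def by (intro transport_Gal base_real)

lemma tau_refl: "a \<in> reals \<Longrightarrow> tau a a \<in> Bd"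
  unfolding tau_def by (intro transport_refl base_real)

text \<open>
  Transport from the vertex \<open>(i, e)\<close> to the base vertex, both placed at the same realization; by
  homogeneity it does not matter, modulo boundaries, at which one.
\<close>

definition mu :: "nat \<Rightarrow> ('x \<Rightarrow> 'm) \<Rightarrow> ('m pfunctor \<Rightarrow>\<^sub>0 int)" where
  "mu i e = transport i e base 0 base base"

text \<open>Up to a term depending only on the end vertices, transport only depends on \<open>(a, b)\<close>.\<close>

lemma transport_split:
  assumes r: "e \<in> reals" "a \<in> reals" "e' \<in> reals" "b \<in> reals"
  shows "transport i e a j e' b - (mu i e - mu j e' + tau a b) \<in> Bd"
proof -
  have mu: "transport i e a 0 base a - mu i e \<in> Bd" if r: "e \<in> reals" "a \<in> reals" for i e a
  proof -
    obtain \<sigma> where "\<sigma> \<in> Gal" "\<sigma> \<circ> base = a" using reals_transitive[OF base_real r(2)] .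
    then show ?thesis
      using transport_Gal[OF r(1) base_real base_real base_real, of \<sigma> i 0] by (simp add: mu_def)
  qed
  note t = transport_add[OF r(1,2) base_real r(2) base_real r(4), of i 0 0]
    transport_add[OF r(1,2) base_real r(4) r(3,4), of i 0 j]
    transport_rev[OF base_real r(4) r(3,4), of 0 j] mu[OF r(1,2), of i] mu[OF r(3,4), of j]
  have "transport i e a j e' b - (mu i e - mu j e' + tau a b) =
    - (transport i e a 0 base b + transport 0 base b j e' b - transport i e a j e' b)
    - (transport i e a 0 base a + transport 0 base a 0 base b - transport i e a 0 base b)
    + (transport 0 base b j e' b + transport j e' b 0 base b)
    + (transport i e a 0 base a - mu i e) - (transport j e' b 0 base b - mu j e')"
    by (simp add: tau_def)
  then show ?thesis using t by (simp only: Bd_add Bd_diff Bd_minus)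
qed

lemma edge_split:
  assumes "edge f i e a j e' b"
  shows "frag_of f - (mu i e - mu j e' + tau a b) \<in> Bd"
proof -
  have "(frag_of f - transport i e a j e' b) +
      (transport i e a j e' b - (mu i e - mu j e' + tau a b)) \<in> Bd"
    using transport_edge[OF assms] transport_split[OF edge_reals(3,1,4,2)[OF assms]]
    by (rule Bd_add)
  moreover have "(frag_of f - transport i e a j e' b) +
      (transport i e a j e' b - (mu i e - mu j e' + tau a b)) =
      frag_of f - (mu i e - mu j e' + tau a b)" by simp
  ultimately show ?thesis by (simp only:)
qed

lemma spx_1_edge:
  assumes f: "spx 1 f" and s: "supp f = {i, j}" "i < j"
  shows "edge f i (gen (obj f {i})) (mor f {i} {i, j} \<circ> gen (obj f {i}))
    j (gen (obj f {j})) (mor f {j} {i, j} \<circ> gen (obj f {j}))"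
proof -
  have "\<exists>b\<in>reals. obj f {k} = cl (range b)" if "k \<in> {i, j}" for k
    using f that s unfolding simplex_def by blast
  then have "gen (obj f {k}) \<in> reals \<and> obj f {k} = cl (range (gen (obj f {k})))" if "k \<in> {i, j}" for k
    using gen that by metis
  then show ?thesis
    unfolding edge_def using f s by (intro conjI bexI[of _ id] AutOver_id) auto
qed

text \<open>Every 1-cycle is homologous to a loop.\<close>

lemma cycle_tau:
  assumes "c \<in> carrier Z1"
  shows "\<exists>b\<in>reals. c - tau base b \<in> Bd"
proof -
  \<comment> \<open>\<open>mu\<close> as a function of a 0-simplex; correcting \<open>c\<close> by the value of \<open>m\<close> on its boundary gives a
    statement that makes sense for all chains and can be proved on generators\<close>
  define m where "m x = mu (the_elem (supp x)) (gen (obj x (supp x)))" for x :: "'m pfunctor"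
  have keys: "Poly_Mapping.keys c \<subseteq> {f. spx 1 f}" and cycle: "boundary 1 c = 0"
    using assms unfolding carrier_Z1 by blast+
  have "\<exists>b\<in>reals. c + frag_extend m (boundary 1 c) - tau base b \<in> Bd"
    using keys
  proof (induction rule: frag_induction)
    case zero
    then show ?case using base_real Bd_minus[OF tau_refl[OF base_real]] by auto
  next
    case (one f)
    then have f: "spx 1 f" by simp
    obtain i j where s: "supp f = {i, j}" "i < j" using spx_1_supp[OF f] .
    define a b where "a = mor f {i} {i, j} \<circ> gen (obj f {i})" and "b = mor f {j} {i, j} \<circ> gen (obj f {j})"
    have e: "edge f i (gen (obj f {i})) a j (gen (obj f {j})) b"
      unfolding a_def b_def by (rule spx_1_edge[OF f s])
    have r: "a \<in> reals" "b \<in> reals" using edge_reals[OF e] by simp_all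
    have "m (face 0 f) = mu j (gen (obj f {j}))" "m (face 1 f) = mu i (gen (obj f {i}))"
      unfolding m_def face_edge[OF s] by simp_all
    then have ext: "frag_extend m (boundary 1 (frag_of f)) = mu j (gen (obj f {j})) - mu i (gen (obj f {i}))"
      unfolding boundary_1 by (simp add: frag_extend_diff)
    then have 1: "frag_of f + frag_extend m (boundary 1 (frag_of f)) - tau a b \<in> Bd"
    proof -
      have "frag_of f + frag_extend m (boundary 1 (frag_of f)) - tau a b =
          frag_of f - (mu i (gen (obj f {i})) - mu j (gen (obj f {j})) + tau a b)"
        unfolding ext by simp
      then show ?thesis using edge_split[OF e] by (simp only:)
    qed
    obtain \<sigma> where \<sigma>: "\<sigma> \<in> Gal" "\<sigma> \<circ> a = base" using reals_transitive[OF r(1) base_real] .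
    have \<sigma>b: "\<sigma> \<circ> b \<in> reals" using reals_Gal[OF r(2) \<sigma>(1)] .
    have "frag_of f + frag_extend m (boundary 1 (frag_of f)) - tau base (\<sigma> \<circ> b) \<in> Bd"
      using Bd_diff[OF 1 tau_Gal[OF r \<sigma>(1)]] unfolding \<sigma>(2) by simp
    then show ?case using \<sigma>b by blast
  next
    case (diff x y)
    then obtain b b' where b: "b \<in> reals" "x + frag_extend m (boundary 1 x) - tau base b \<in> Bd"
      and b': "b' \<in> reals" "y + frag_extend m (boundary 1 y) - tau base b' \<in> Bd" by blast
    obtain \<sigma> where \<sigma>: "\<sigma> \<in> Gal" "\<sigma> \<circ> b' = base" using reals_transitive[OF b'(1) base_real] .
    have \<sigma>b: "\<sigma> \<circ> b \<in> reals" using reals_Gal[OF b(1) \<sigma>(1)] .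
    have "(x + frag_extend m (boundary 1 x) - tau base b) - (y + frag_extend m (boundary 1 y) - tau base b')
        - (tau base b' + tau b' b - tau base b) - (tau (\<sigma> \<circ> b') (\<sigma> \<circ> b) - tau b' b) \<in> Bd"
      by (intro Bd_diff b(2) b'(2) tau_add tau_Gal base_real b(1) b'(1) \<sigma>(1))
    then have "x - y + frag_extend m (boundary 1 (x - y)) - tau base (\<sigma> \<circ> b) \<in> Bd"
      unfolding boundary_diff frag_extend_diff \<sigma>(2) by (simp add: algebra_simps)
    then show ?case using \<sigma>b by blast
  qed
  then show ?thesis using cycle by simp
qed

end

section \<open>The automorphism group of the set of realizations\<close>

declare One_nat_def [simp del]

context homology_setting
begin

abbreviation G :: "(('x \<Rightarrow> 'm) \<Rightarrow> 'x \<Rightarrow> 'm) monoid" where "G \<equiv> AutP M B p"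
abbreviation commG :: "(('x \<Rightarrow> 'm) \<Rightarrow> 'x \<Rightarrow> 'm) set" where "commG \<equiv> derived G (carrier G)"

text \<open>
  The action of an automorphism on the realizations of \<open>p\<close>. Below, \<open>commG\<close> is the derived subgroup \<open>G'\<close>.
\<close>

definition act :: "('m \<Rightarrow> 'm) \<Rightarrow> ('x \<Rightarrow> 'm) \<Rightarrow> 'x \<Rightarrow> 'm" where
  "act \<sigma> = (\<lambda>a\<in>reals. \<sigma> \<circ> a)"

lemma act_apply [simp]: "a \<in> reals \<Longrightarrow> act \<sigma> a = \<sigma> \<circ> a"
  by (simp add: act_def)

lemma carrier_G: "carrier G = act ` Gal"
  by (auto simp: AutP_def act_def)

lemma act_compose: "\<tau> \<in> Gal \<Longrightarrow> compose reals (act \<sigma>) (act \<tau>) = act (\<sigma> \<circ> \<tau>)"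
  by (auto simp: compose_def act_def fun_eq_iff reals_Gal)

lemma act_Bij:
  assumes "\<sigma> \<in> Gal"
  shows "act \<sigma> \<in> Bij reals"
proof -
  have "bij_betw (act \<sigma>) reals reals"
  proof (rule bij_betwI)
    show "act \<sigma> \<in> reals \<rightarrow> reals" "act (inv_map \<sigma>) \<in> reals \<rightarrow> reals"
      using reals_Gal assms AutOver_inv[OF assms] by auto
    show "act (inv_map \<sigma>) (act \<sigma> a) = a" "act \<sigma> (act (inv_map \<sigma>) a) = a" if "a \<in> reals" for a
      using that reals_Gal[OF that assms] reals_Gal[OF that AutOver_inv[OF assms]]
        AutOver_inv_apply[OF assms] by (simp_all add: fun_eq_iff)
  qed
  then show ?thesis by (simp add: Bij_def act_def)
qed

lemma mult_act:
  assumes "\<sigma> \<in> Gal" "\<tau> \<in> Gal"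
  shows "act \<sigma> \<otimes>\<^bsub>G\<^esub> act \<tau> = act (\<sigma> \<circ> \<tau>)"
  using act_Bij[OF assms(1)] act_Bij[OF assms(2)] act_compose[OF assms(2)]
  by (simp add: AutP_def BijGroup_def)

lemma one_act: "\<one>\<^bsub>G\<^esub> = act id"
  by (simp add: AutP_def BijGroup_def act_def)

lemma group_G: "group G"
proof (rule groupI)
  show "\<one>\<^bsub>G\<^esub> \<in> carrier G" unfolding one_act carrier_G using AutOver_id by blast
  fix x assume "x \<in> carrier G"
  then obtain \<sigma> where \<sigma>: "\<sigma> \<in> Gal" "x = act \<sigma>" unfolding carrier_G by blast
  show "\<one>\<^bsub>G\<^esub> \<otimes>\<^bsub>G\<^esub> x = x" unfolding one_act \<sigma>(2) by (simp add: mult_act AutOver_id \<sigma>(1))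
  have "act (inv_map \<sigma>) \<otimes>\<^bsub>G\<^esub> x = \<one>\<^bsub>G\<^esub>"
    unfolding one_act \<sigma>(2) by (simp only: mult_act[OF AutOver_inv[OF \<sigma>(1)] \<sigma>(1)] AutOver_inv_apply(3)[OF \<sigma>(1)])
  then show "\<exists>y\<in>carrier G. y \<otimes>\<^bsub>G\<^esub> x = \<one>\<^bsub>G\<^esub>" unfolding carrier_G using AutOver_inv[OF \<sigma>(1)] by blast
  fix y assume "y \<in> carrier G"
  then obtain \<tau> where \<tau>: "\<tau> \<in> Gal" "y = act \<tau>" unfolding carrier_G by blast
  show "x \<otimes>\<^bsub>G\<^esub> y \<in> carrier G" unfolding \<sigma>(2) \<tau>(2) carrier_G
    using mult_act[OF \<sigma>(1) \<tau>(1)] AutOver_comp[OF \<sigma>(1) \<tau>(1)] by simp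
  fix z assume "z \<in> carrier G"
  then obtain \<rho> where \<rho>: "\<rho> \<in> Gal" "z = act \<rho>" unfolding carrier_G by blast
  show "x \<otimes>\<^bsub>G\<^esub> y \<otimes>\<^bsub>G\<^esub> z = x \<otimes>\<^bsub>G\<^esub> (y \<otimes>\<^bsub>G\<^esub> z)"
    unfolding \<sigma>(2) \<tau>(2) \<rho>(2) by (simp add: mult_act AutOver_comp \<sigma>(1) \<tau>(1) \<rho>(1) comp_assoc)
qed

interpretation G: group G
  by (rule group_G)

lemma mult_G_apply:
  assumes "g \<in> carrier G" "h \<in> carrier G" "a \<in> reals"
  shows "(g \<otimes>\<^bsub>G\<^esub> h) a = g (h a)"
proof -
  obtain \<sigma> \<tau> where "\<sigma> \<in> Gal" "g = act \<sigma>" "\<tau> \<in> Gal" "h = act \<tau>" using assms unfolding carrier_G by blast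
  then show ?thesis using assms(3) reals_Gal by (simp add: mult_act comp_assoc)
qed

lemma G_closed: "g \<in> carrier G \<Longrightarrow> a \<in> reals \<Longrightarrow> g a \<in> reals"
  unfolding carrier_G using reals_Gal by auto

lemma one_G_apply: "a \<in> reals \<Longrightarrow> \<one>\<^bsub>G\<^esub> a = a"
  by (simp add: one_act)

lemma inv_G_apply:
  assumes "g \<in> carrier G" "a \<in> reals"
  shows "(inv\<^bsub>G\<^esub> g) (g a) = a" "g ((inv\<^bsub>G\<^esub> g) a) = a"
  using assms mult_G_apply[of "inv\<^bsub>G\<^esub> g" g a] mult_G_apply[of g "inv\<^bsub>G\<^esub> g" a] one_G_apply by simp_all

lemma G_transitive:
  assumes "a \<in> reals" "b \<in> reals"
  shows "\<exists>g\<in>carrier G. g a = b"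
proof -
  obtain \<sigma> where "\<sigma> \<in> Gal" "\<sigma> \<circ> a = b" using reals_transitive assms by blast
  then show ?thesis unfolding carrier_G using assms(1) by (intro bexI[of _ "act \<sigma>"]) auto
qed

text \<open>
  The elements of \<open>G\<close> that preserve every orbit of the derived subgroup; they will turn out to be the
  kernel of \<open>\<psi>\<close>.
\<close>

definition K0 :: "(('x \<Rightarrow> 'm) \<Rightarrow> 'x \<Rightarrow> 'm) set" where
  "K0 = {g \<in> carrier G. \<forall>a\<in>reals. \<exists>h\<in>commG. g a = h a}"

lemma commG_subgroup: "subgroup commG G"
  by (rule G.derived_is_subgroup) simp

lemma commG_carrier: "g \<in> commG \<Longrightarrow> g \<in> carrier G"
  using subgroup.mem_carrier[OF commG_subgroup] .

lemma commutator:
  assumes "g \<in> carrier G" "h \<in> carrier G"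
  shows "g \<otimes>\<^bsub>G\<^esub> h \<otimes>\<^bsub>G\<^esub> inv\<^bsub>G\<^esub> g \<otimes>\<^bsub>G\<^esub> inv\<^bsub>G\<^esub> h \<in> commG"
  unfolding derived_def using assms by (intro generate.incl) blast

lemma commG_conj:
  assumes "g \<in> carrier G" "h \<in> commG"
  shows "g \<otimes>\<^bsub>G\<^esub> h \<otimes>\<^bsub>G\<^esub> inv\<^bsub>G\<^esub> g \<in> commG"
  using G.derived_self_is_normal assms normal.inv_op_closed2 by metis

lemma commG_sub_K0: "commG \<subseteq> K0"
  using commG_carrier by (auto simp: K0_def)

text \<open>As \<open>G\<close> is transitive and \<open>G/G'\<close> is abelian, one orbit of \<open>G'\<close> decides.\<close>

lemma K0_I:
  assumes g: "g \<in> carrier G" and a: "a \<in> reals" and h: "h \<in> commG" "g a = h a"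
  shows "g \<in> K0"
proof -
  have "\<exists>x\<in>commG. g b = x b" if b: "b \<in> reals" for b
  proof -
    obtain k where k: "k \<in> carrier G" "k a = b" using G_transitive[OF a b] by blast
    let ?c = "g \<otimes>\<^bsub>G\<^esub> k \<otimes>\<^bsub>G\<^esub> inv\<^bsub>G\<^esub> g \<otimes>\<^bsub>G\<^esub> inv\<^bsub>G\<^esub> k" and ?d = "k \<otimes>\<^bsub>G\<^esub> h \<otimes>\<^bsub>G\<^esub> inv\<^bsub>G\<^esub> k"
    have hG: "h \<in> carrier G" using commG_carrier h(1) .
    have "(?c \<otimes>\<^bsub>G\<^esub> ?d) b = ?c (k (h ((inv\<^bsub>G\<^esub> k) b)))"
      using g k(1) hG b by (simp add: mult_G_apply G_closed)
    also have "\<dots> = ?c (k (g a))" using k a h(2) inv_G_apply(1) by metis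
    also have "\<dots> = g (k ((inv\<^bsub>G\<^esub> g) ((inv\<^bsub>G\<^esub> k) (k (g a)))))"
      using g k(1) a by (simp add: mult_G_apply G_closed)
    also have "\<dots> = g b" using g k a by (simp add: inv_G_apply G_closed)
    finally have "g b = (?c \<otimes>\<^bsub>G\<^esub> ?d) b" by (rule sym)
    moreover have "?c \<otimes>\<^bsub>G\<^esub> ?d \<in> commG"
      using commutator[OF g k(1)] commG_conj[OF k(1) h(1)] subgroup.m_closed[OF commG_subgroup] by blast
    ultimately show ?thesis by blast
  qed
  then show ?thesis using g by (simp add: K0_def)
qed

lemma K0_carrier: "K0 \<subseteq> carrier G"
  by (auto simp: K0_def)

lemma K0_subgroup: "subgroup K0 G"
proof (rule G.subgroupI)
  show "K0 \<noteq> {}" using commG_sub_K0 subgroup.one_closed[OF commG_subgroup] by blast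
  obtain a where a: "a \<in> reals" using reals_nonempty by blast
  fix g assume g: "g \<in> K0"
  then have gG: "g \<in> carrier G" using K0_carrier by blast
  obtain h where h: "h \<in> commG" "g ((inv\<^bsub>G\<^esub> g) a) = h ((inv\<^bsub>G\<^esub> g) a)"
    using g gG a G_closed[of "inv\<^bsub>G\<^esub> g" a] by (auto simp: K0_def)
  have "(inv\<^bsub>G\<^esub> h) a = (inv\<^bsub>G\<^esub> g) a"
    using h(2) inv_G_apply(2)[OF gG a] inv_G_apply(1)[OF commG_carrier[OF h(1)]]
      G_closed[of "inv\<^bsub>G\<^esub> g" a] gG a by (metis G.inv_closed)
  then show "inv\<^bsub>G\<^esub> g \<in> K0"
    using K0_I[of "inv\<^bsub>G\<^esub> g" a "inv\<^bsub>G\<^esub> h"] gG a subgroup.m_inv_closed[OF commG_subgroup h(1)] by simp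
  fix g' assume g': "g' \<in> K0"
  then have g'G: "g' \<in> carrier G" using K0_carrier by blast
  obtain h' where h': "h' \<in> commG" "g' a = h' a" using g' a by (auto simp: K0_def)
  obtain k where k: "k \<in> commG" "g (h' a) = k (h' a)"
    using g a G_closed[OF commG_carrier[OF h'(1)] a] by (auto simp: K0_def)
  have "(g \<otimes>\<^bsub>G\<^esub> g') a = (k \<otimes>\<^bsub>G\<^esub> h') a"
    using gG g'G commG_carrier h' k a by (simp add: mult_G_apply)
  then show "g \<otimes>\<^bsub>G\<^esub> g' \<in> K0"
    using K0_I[of "g \<otimes>\<^bsub>G\<^esub> g'" a "k \<otimes>\<^bsub>G\<^esub> h'"] gG g'G a subgroup.m_closed[OF commG_subgroup k(1) h'(1)]
    by simp
qed (rule K0_carrier)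

lemma K0_normal: "K0 \<lhd> G"
proof (rule G.normal_invI[OF K0_subgroup])
  obtain a where a: "a \<in> reals" using reals_nonempty by blast
  fix h x assume h: "h \<in> K0" and x: "x \<in> carrier G"
  then have hG: "h \<in> carrier G" using K0_carrier by blast
  have "(inv\<^bsub>G\<^esub> x) a \<in> reals" using x a G_closed by simp
  then obtain k where k: "k \<in> commG" "h ((inv\<^bsub>G\<^esub> x) a) = k ((inv\<^bsub>G\<^esub> x) a)" using h by (auto simp: K0_def)
  have "(x \<otimes>\<^bsub>G\<^esub> h \<otimes>\<^bsub>G\<^esub> inv\<^bsub>G\<^esub> x) a = (x \<otimes>\<^bsub>G\<^esub> k \<otimes>\<^bsub>G\<^esub> inv\<^bsub>G\<^esub> x) a"
    using x hG commG_carrier[OF k(1)] a k(2) by (simp add: mult_G_apply G_closed)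
  then show "x \<otimes>\<^bsub>G\<^esub> h \<otimes>\<^bsub>G\<^esub> inv\<^bsub>G\<^esub> x \<in> K0"
    using K0_I[of _ a] commG_conj[OF x k(1)] x hG a by simp
qed

lemma K0_coset_comm:
  assumes "g \<in> carrier G" "h \<in> carrier G"
  shows "K0 #>\<^bsub>G\<^esub> (g \<otimes>\<^bsub>G\<^esub> h) = K0 #>\<^bsub>G\<^esub> (h \<otimes>\<^bsub>G\<^esub> g)"
proof -
  let ?c = "g \<otimes>\<^bsub>G\<^esub> h \<otimes>\<^bsub>G\<^esub> inv\<^bsub>G\<^esub> g \<otimes>\<^bsub>G\<^esub> inv\<^bsub>G\<^esub> h"
  have "?c \<in> K0" using commutator[OF assms] commG_sub_K0 by blast
  moreover have "?c \<otimes>\<^bsub>G\<^esub> (h \<otimes>\<^bsub>G\<^esub> g) = g \<otimes>\<^bsub>G\<^esub> h"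
    using assms by (simp add: G.m_assoc G.inv_solve_left G.inv_solve_right flip: G.m_assoc[of "inv\<^bsub>G\<^esub> h" h])
  ultimately have "g \<otimes>\<^bsub>G\<^esub> h \<in> K0 #>\<^bsub>G\<^esub> (h \<otimes>\<^bsub>G\<^esub> g)" unfolding r_coset_def by force
  then show ?thesis using G.repr_independence[OF _ _ K0_subgroup] assms by (metis G.m_closed)
qed

abbreviation A :: "(('x \<Rightarrow> 'm) \<Rightarrow> 'x \<Rightarrow> 'm) set monoid" where "A \<equiv> G Mod K0"

lemma A_mult:
  assumes "g \<in> carrier G" "h \<in> carrier G"
  shows "(K0 #>\<^bsub>G\<^esub> g) \<otimes>\<^bsub>A\<^esub> (K0 #>\<^bsub>G\<^esub> h) = K0 #>\<^bsub>G\<^esub> (g \<otimes>\<^bsub>G\<^esub> h)"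
  using normal.rcos_sum[OF K0_normal assms] by (simp add: FactGroup_def)

lemma A_carrier: "carrier A = (\<lambda>g. K0 #>\<^bsub>G\<^esub> g) ` carrier G"
  by (auto simp: FactGroup_def RCOSETS_def)

lemma A_one: "\<one>\<^bsub>A\<^esub> = K0"
  by (simp add: FactGroup_def)

lemma comm_group_A: "comm_group A"
proof -
  interpret A: group A using normal.factorgroup_is_group[OF K0_normal] .
  show ?thesis
  proof (rule A.group_comm_groupI)
    fix x y assume "x \<in> carrier A" "y \<in> carrier A"
    then obtain g h where "g \<in> carrier G" "x = K0 #>\<^bsub>G\<^esub> g" "h \<in> carrier G" "y = K0 #>\<^bsub>G\<^esub> h"
      unfolding A_carrier by blast
    then show "x \<otimes>\<^bsub>A\<^esub> y = y \<otimes>\<^bsub>A\<^esub> x" using K0_coset_comm by (simp only: A_mult)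
  qed
qed

interpretation A: comm_group A
  by (rule comm_group_A)

text \<open>
  \<open>delta a b\<close> is the coset of the elements of \<open>G\<close> that move \<open>a\<close> to \<open>b\<close>; all of them lie in one coset by
  \<open>delta_eq\<close>.
\<close>

definition delta :: "('x \<Rightarrow> 'm) \<Rightarrow> ('x \<Rightarrow> 'm) \<Rightarrow> (('x \<Rightarrow> 'm) \<Rightarrow> 'x \<Rightarrow> 'm) set" where
  "delta a b = K0 #>\<^bsub>G\<^esub> (SOME g. g \<in> carrier G \<and> g a = b)"

lemma delta_eq:
  assumes g: "g \<in> carrier G" and a: "a \<in> reals" and b: "g a = b"
  shows "delta a b = K0 #>\<^bsub>G\<^esub> g"
proof -
  define h where "h = (SOME g. g \<in> carrier G \<and> g a = b)"
  have "h \<in> carrier G \<and> h a = b" unfolding h_def by (rule someI[of _ g]) (use g b in simp)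
  then have h: "h \<in> carrier G" "h a = b" by auto
  have "(g \<otimes>\<^bsub>G\<^esub> inv\<^bsub>G\<^esub> h) b = \<one>\<^bsub>G\<^esub> b"
    using g h a b inv_G_apply(1)[OF h(1) a] G_closed[OF g a] by (simp add: mult_G_apply one_G_apply)
  then have "g \<otimes>\<^bsub>G\<^esub> inv\<^bsub>G\<^esub> h \<in> K0"
    using K0_I[of "g \<otimes>\<^bsub>G\<^esub> inv\<^bsub>G\<^esub> h" b "\<one>\<^bsub>G\<^esub>"] g h(1) G_closed[OF g a] b
      subgroup.one_closed[OF commG_subgroup] by simp
  then have "g \<otimes>\<^bsub>G\<^esub> inv\<^bsub>G\<^esub> h \<otimes>\<^bsub>G\<^esub> h \<in> K0 #>\<^bsub>G\<^esub> h" unfolding r_coset_def by blast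
  then have "g \<in> K0 #>\<^bsub>G\<^esub> h" using g h(1) by (simp add: G.m_assoc)
  then show ?thesis
    using G.repr_independence[OF _ h(1) K0_subgroup] unfolding delta_def h_def by blast
qed

lemma delta_carrier:
  assumes "a \<in> reals" "b \<in> reals"
  shows "delta a b \<in> carrier A"
  using G_transitive[OF assms] delta_eq[OF _ assms(1)] unfolding A_carrier by blast

lemma delta_add:
  assumes "a \<in> reals" "b \<in> reals" "c \<in> reals"
  shows "delta a b \<otimes>\<^bsub>A\<^esub> delta b c = delta a c"
proof -
  obtain g h where g: "g \<in> carrier G" "g a = b" and h: "h \<in> carrier G" "h b = c"
    using G_transitive assms by meson
  have "delta a b \<otimes>\<^bsub>A\<^esub> delta b c = K0 #>\<^bsub>G\<^esub> (h \<otimes>\<^bsub>G\<^esub> g)"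
    unfolding delta_eq[OF g(1) assms(1) g(2)] delta_eq[OF h(1) assms(2) h(2)] A_mult[OF g(1) h(1)]
    by (rule K0_coset_comm[OF g(1) h(1)])
  also have "\<dots> = delta a c"
    using g h assms(1) by (intro delta_eq[symmetric]) (simp_all add: mult_G_apply)
  finally show ?thesis .
qed

lemma delta_Gal:
  assumes "a \<in> reals" "b \<in> reals" "\<sigma> \<in> Gal"
  shows "delta (\<sigma> \<circ> a) (\<sigma> \<circ> b) = delta a b"
proof -
  obtain g where g: "g \<in> carrier G" "g a = b" using G_transitive assms by meson
  have k: "act \<sigma> \<in> carrier G" using assms(3) by (simp add: carrier_G)
  have "delta a (\<sigma> \<circ> b) = K0 #>\<^bsub>G\<^esub> (act \<sigma> \<otimes>\<^bsub>G\<^esub> g)"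
    using g k assms by (intro delta_eq) (simp_all add: mult_G_apply comp_def)
  moreover have "delta a (\<sigma> \<circ> a) = K0 #>\<^bsub>G\<^esub> act \<sigma>"
    using k assms by (intro delta_eq) simp_all
  moreover have "delta a (\<sigma> \<circ> a) \<otimes>\<^bsub>A\<^esub> delta (\<sigma> \<circ> a) (\<sigma> \<circ> b) = delta a (\<sigma> \<circ> b)"
    using assms reals_Gal by (intro delta_add) simp_all
  moreover have "delta a b = K0 #>\<^bsub>G\<^esub> g" using g assms(1) by (intro delta_eq)
  ultimately have "delta a (\<sigma> \<circ> a) \<otimes>\<^bsub>A\<^esub> delta (\<sigma> \<circ> a) (\<sigma> \<circ> b) = delta a (\<sigma> \<circ> a) \<otimes>\<^bsub>A\<^esub> delta a b"
    using A_mult[OF k g(1)] by simp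
  then show ?thesis
    using A.Units_l_cancel[of "delta a (\<sigma> \<circ> a)" "delta (\<sigma> \<circ> a) (\<sigma> \<circ> b)" "delta a b"]
      delta_carrier assms reals_Gal by (simp add: A.Units_eq del: mult_FactGroup)
qed

section \<open>A cocycle with values in \<open>G/K0\<close>\<close>

text \<open>
  The value of a 1-simplex is \<open>delta\<close> of the images of the realizations chosen for its two vertices,
  the vertex of smaller index coming first.
\<close>

definition cocycle :: "'m pfunctor \<Rightarrow> (('x \<Rightarrow> 'm) \<Rightarrow> 'x \<Rightarrow> 'm) set" where
  "cocycle f = delta (mor f {Min (supp f)} (supp f) \<circ> gen (obj f {Min (supp f)}))
     (mor f {Max (supp f)} (supp f) \<circ> gen (obj f {Max (supp f)}))"

lemma cocycle_eq:
  "supp f = {i, j} \<Longrightarrow> i < j \<Longrightarrow>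
    cocycle f = delta (mor f {i} {i, j} \<circ> gen (obj f {i})) (mor f {j} {i, j} \<circ> gen (obj f {j}))"
  unfolding cocycle_def by (simp add: min_def max_def)

lemma spx_vertex:
  assumes "spx n f" "i \<in> supp f"
  shows "gen (obj f {i}) \<in> reals" "obj f {i} = cl (range (gen (obj f {i})))"
proof -
  obtain b where "b \<in> reals" "obj f {i} = cl (range b)"
    using assms unfolding simplex_def by blast
  then show "gen (obj f {i}) \<in> reals" "obj f {i} = cl (range (gen (obj f {i})))"
    using gen[of b] by simp_all
qed

lemma cocycle_face:
  assumes f: "spx n f" and s: "{i, j} \<subseteq> supp f" "i < j"
  shows "cocycle (pfunctor_restrict f {i, j}) =
    delta (mor f {i} (supp f) \<circ> gen (obj f {i})) (mor f {j} (supp f) \<circ> gen (obj f {j}))"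
proof -
  obtain \<rho> where \<rho>: "\<rho> \<in> Gal" "mor f {i, j} (supp f) = restrict \<rho> (obj f {i, j})"
    using spx_mor[OF f s(1) order_refl] .
  have comp: "mor f {k} (supp f) \<circ> gen (obj f {k}) = \<rho> \<circ> (mor f {k} {i, j} \<circ> gen (obj f {k}))"
    and real: "mor f {k} {i, j} \<circ> gen (obj f {k}) \<in> reals"
    if k: "k \<in> {i, j}" for k
  proof -
    have k': "{k} \<subseteq> {i, j}" "k \<in> supp f" using k s by auto
    note v = spx_vertex[OF f k'(2)]
    have P: "is_pfunctor M B f" using spx_pfunctor[OF f] .
    have cmp: "mor f {k} (supp f) = compose (obj f {k}) (mor f {i, j} (supp f)) (mor f {k} {i, j})"
      by (rule P[unfolded is_pfunctor_def, THEN conjunct2, THEN conjunct2, THEN conjunct2,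
          THEN conjunct2, THEN conjunct1, rule_format]) (use k' s in simp)
    have "mor f {k} {i, j} \<in> C_hom M B (obj f {k}) (obj f {i, j})"
      using pfunctor_mor[OF P k'(1) s(1)] .
    then have into: "mor f {k} {i, j} y \<in> obj f {i, j}" if "y \<in> obj f {k}" for y
      using that by (auto simp: C_hom_def)
    have "gen (obj f {k}) x \<in> obj f {k}" for x
      using cl_extensive[of "range (gen (obj f {k}))"] v(2) by auto
    then show "mor f {k} (supp f) \<circ> gen (obj f {k}) = \<rho> \<circ> (mor f {k} {i, j} \<circ> gen (obj f {k}))"
      unfolding cmp \<rho>(2) using into by (simp add: fun_eq_iff compose_def)
    show "mor f {k} {i, j} \<circ> gen (obj f {k}) \<in> reals"
      using spx_mor_reals[OF f k'(1) s(1) v] .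
  qed
  have "cocycle (pfunctor_restrict f {i, j}) =
      delta (mor f {i} {i, j} \<circ> gen (obj f {i})) (mor f {j} {i, j} \<circ> gen (obj f {j}))"
    using s(2) by (subst cocycle_eq[of _ i j]) simp_all
  also have "\<dots> = delta (\<rho> \<circ> (mor f {i} {i, j} \<circ> gen (obj f {i}))) (\<rho> \<circ> (mor f {j} {i, j} \<circ> gen (obj f {j})))"
    using delta_Gal[OF real real \<rho>(1), of i j] by simp
  finally show ?thesis using comp[of i] comp[of j] by simp
qed

lemma cocycle_carrier:
  assumes "spx 1 f"
  shows "cocycle f \<in> carrier A"
proof -
  obtain i j where s: "supp f = {i, j}" "i < j" using spx_1_supp[OF assms] .
  show ?thesis
    unfolding cocycle_eq[OF s] using edge_reals[OF spx_1_edge[OF assms s]] delta_carrier by blast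
qed

lemma cocycle_edge:
  assumes f: "edge f i e a j e' b" and e: "gen (cl (range e)) = e" "gen (cl (range e')) = e'"
  shows "cocycle f = delta a b"
proof -
  have s: "spx 1 f" "supp f = {i, j}" "i < j" and o: "obj f {i} = cl (range e)" "obj f {j} = cl (range e')"
    using f by (simp_all add: edge_def)
  obtain \<tau> where \<tau>: "\<tau> \<in> Gal" "\<tau> \<circ> (mor f {i} {i, j} \<circ> e) = a" "\<tau> \<circ> (mor f {j} {i, j} \<circ> e') = b"
    using f by (auto simp: edge_def)
  have r: "mor f {i} {i, j} \<circ> e \<in> reals" "mor f {j} {i, j} \<circ> e' \<in> reals"
    using edge_reals[OF spx_1_edge[OF s]] by (simp_all add: o e)
  show ?thesis
    unfolding cocycle_eq[OF s(2,3)] o e using delta_Gal[OF r \<tau>(1)] by (simp add: \<tau>(2,3))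
qed

text \<open>The linear extension of \<open>cocycle\<close> to chains.\<close>

definition D :: "('m pfunctor \<Rightarrow>\<^sub>0 int) \<Rightarrow> (('x \<Rightarrow> 'm) \<Rightarrow> 'x \<Rightarrow> 'm) set" where
  "D = (SOME h. h \<in> hom C1 A \<and> (\<forall>f. spx 1 f \<longrightarrow> h (frag_of f) = cocycle f))"

lemma D_hom: "D \<in> hom C1 A" and D_of: "spx 1 f \<Longrightarrow> D (frag_of f) = cocycle f"
proof -
  have "cocycle ` {f. spx 1 f} \<subseteq> carrier A" using cocycle_carrier by blast
  then obtain h where "h \<in> hom (free_Abelian_group {f. spx 1 f}) A"
    "\<And>f. f \<in> {f. spx 1 f} \<Longrightarrow> h (frag_of f) = cocycle f"
    using A.free_Abelian_group_universal[of cocycle "{f. spx 1 f}"] by blast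
  then have "\<exists>h. h \<in> hom C1 A \<and> (\<forall>f. spx 1 f \<longrightarrow> h (frag_of f) = cocycle f)"
    unfolding chain_group_def by blast
  from someI_ex[OF this]
  show "D \<in> hom C1 A" "spx 1 f \<Longrightarrow> D (frag_of f) = cocycle f" unfolding D_def by blast+
qed

lemma frag_of_C1: "spx 1 f \<Longrightarrow> frag_of f \<in> carrier C1"
  by (simp add: carrier_C1)

lemma C1_add: "c \<in> carrier C1 \<Longrightarrow> d \<in> carrier C1 \<Longrightarrow> c + d \<in> carrier C1"
  unfolding carrier_C1 using keys_add[of c d] by blast

lemma C1_diff: "c \<in> carrier C1 \<Longrightarrow> d \<in> carrier C1 \<Longrightarrow> c - d \<in> carrier C1"
  unfolding carrier_C1 using keys_diff[of c d] by blast

lemma D_carrier: "c \<in> carrier C1 \<Longrightarrow> D c \<in> carrier A"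
  using D_hom by (rule hom_in_carrier)

lemma D_add:
  assumes "c \<in> carrier C1" "d \<in> carrier C1"
  shows "D (c + d) = D c \<otimes>\<^bsub>A\<^esub> D d"
  using hom_mult[OF D_hom assms] by (simp add: chain_group_def)

lemma D_diff:
  assumes "c \<in> carrier C1" "d \<in> carrier C1"
  shows "D (c - d) = D c \<otimes>\<^bsub>A\<^esub> inv\<^bsub>A\<^esub> D d"
proof -
  have "D c = D (c - d) \<otimes>\<^bsub>A\<^esub> D d" using D_add[OF C1_diff[OF assms] assms(2)] by simp
  then show ?thesis using A.inv_solve_right D_carrier C1_diff assms by metis
qed

lemma Bd_C1: "x \<in> Bd \<Longrightarrow> x \<in> carrier C1"
  using Bd_subset carrier_Z1 carrier_C1 by blast

text \<open>
  The cocycle condition. The three faces of a 2-simplex can be evaluated in its top object, and there it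
  is additivity of \<open>delta\<close>.
\<close>

lemma D_Bd:
  assumes "x \<in> Bd"
  shows "D x = \<one>\<^bsub>A\<^esub>"
proof -
  obtain c where c: "Poly_Mapping.keys c \<subseteq> {f. spx 2 f}" "x = boundary 2 c"
    using assms unfolding Bd_iff by blast
  have "D (boundary 2 c) = \<one>\<^bsub>A\<^esub> \<and> boundary 2 c \<in> carrier C1"
    using c(1)
  proof (induction rule: frag_induction)
    case zero
    have 0: "0 \<in> carrier C1" by (simp add: carrier_C1)
    have "D (0 - 0) = D 0 \<otimes>\<^bsub>A\<^esub> inv\<^bsub>A\<^esub> D 0" by (rule D_diff[OF 0 0])
    then have "D 0 = \<one>\<^bsub>A\<^esub>" by (simp only: diff_self A.r_inv[OF D_carrier[OF 0]])
    then show ?case using 0 by simp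
  next
    case (one f)
    then have f: "spx 2 f" by simp
    obtain i j k where s: "supp f = {i, j, k}" "i < j" "j < k" using spx_2_supp[OF f] .
    let ?X = "\<lambda>l. mor f {l} (supp f) \<circ> gen (obj f {l})"
    have X: "?X l \<in> reals" if "l \<in> supp f" for l
      using spx_mor_reals[OF f _ order_refl spx_vertex[OF f that]] that by simp
    have "i < k" using s by simp
    then have coc: "cocycle (face 0 f) = delta (?X j) (?X k)" "cocycle (face 1 f) = delta (?X i) (?X k)"
      "cocycle (face 2 f) = delta (?X i) (?X j)"
      unfolding face_triangle[OF s]
      using s(2,3) cocycle_face[OF f, of j k] cocycle_face[OF f, of i k] cocycle_face[OF f, of i j]
      by (simp_all add: s(1))
    have r: "?X i \<in> reals" "?X j \<in> reals" "?X k \<in> reals" using X[of i] X[of j] X[of k] by (simp_all add: s(1))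
    note fc = spx_2_faces[OF f]
    note C = frag_of_C1[OF fc(1)] frag_of_C1[OF fc(2)] frag_of_C1[OF fc(3)]
    have "D (boundary 2 (frag_of f)) =
        delta (?X j) (?X k) \<otimes>\<^bsub>A\<^esub> inv\<^bsub>A\<^esub> delta (?X i) (?X k) \<otimes>\<^bsub>A\<^esub> delta (?X i) (?X j)"
      unfolding boundary_2 D_add[OF C1_diff[OF C(1,2)] C(3)] D_diff[OF C(1,2)] D_of[OF fc(1)]
        D_of[OF fc(2)] D_of[OF fc(3)] coc ..
    also have "\<dots> = inv\<^bsub>A\<^esub> delta (?X i) (?X k) \<otimes>\<^bsub>A\<^esub> (delta (?X i) (?X j) \<otimes>\<^bsub>A\<^esub> delta (?X j) (?X k))"
      using r delta_carrier by (simp add: A.m_ac del: mult_FactGroup)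
    also have "\<dots> = \<one>\<^bsub>A\<^esub>"
      using r delta_carrier by (simp add: delta_add del: mult_FactGroup)
    finally show ?case
      using C1_add[OF C1_diff[OF C(1,2)] C(3)] unfolding boundary_2 by blast
  next
    case (diff a b)
    then have "D (boundary 2 a - boundary 2 b) = \<one>\<^bsub>A\<^esub> \<otimes>\<^bsub>A\<^esub> inv\<^bsub>A\<^esub> \<one>\<^bsub>A\<^esub>"
      using D_diff[of "boundary 2 a" "boundary 2 b"] by metis
    also have "\<dots> = \<one>\<^bsub>A\<^esub>" by (simp only: A.inv_one A.l_one[OF A.one_closed])
    finally show ?case using diff C1_diff unfolding boundary_diff by blast
  qed
  then show ?thesis using c(2) by simp
qed

text \<open>Vertices of simplices are determined by their index and their object.\<close>

lemma vertex_eq: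
  assumes f: "spx n f" "i \<in> supp f" and g: "spx m g" "i \<in> supp g" and eq: "obj f {i} = obj g {i}"
  shows "pfunctor_restrict f {i} = pfunctor_restrict g {i}"
proof -
  have f0: "spx 0 (pfunctor_restrict f {i})" and g0: "spx 0 (pfunctor_restrict g {i})"
    using f g by (auto intro: spx_restrict)
  show ?thesis
  proof (rule pfunctor_eqI[OF spx_pfunctor[OF f0] spx_pfunctor[OF g0]])
    show "obj (pfunctor_restrict f {i}) u = obj (pfunctor_restrict g {i}) u" if "u \<subseteq> {i}" for u
      using that eq spx_obj_empty[OF f(1)] spx_obj_empty[OF g(1)] by (auto simp: subset_singleton_iff)
    show "mor (pfunctor_restrict f {i}) u v = mor (pfunctor_restrict g {i}) u v"
      if "u \<subset> v" "v \<subseteq> {i}" for u v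
    proof -
      have "u = {}" "v = {i}" using that by auto
      then show ?thesis using spx_mor_empty[OF f0, of v] spx_mor_empty[OF g0, of v] by simp
    qed
  qed simp_all
qed

text \<open>
  The path taken here has all its vertices generated by \<open>base\<close>, which is the realization that \<open>gen\<close>
  chooses for them. So \<open>D\<close> can be read off from the realizations at which they are placed.
\<close>

lemma tau_cycle_D:
  assumes b: "b \<in> reals"
  shows "tau base b \<in> carrier Z1" "D (tau base b) = delta base b"
proof -
  obtain k c f g where p: "edge f 0 base base k base c" "edge g 0 base b k base c"
    "ind (range c) B (range base \<union> range b)"
    using path_exists[OF base_real base_real base_real b base_real, of 0 0] by blast
  have "path (frag_of f - frag_of g) 0 base base 0 base b" unfolding path_def using p by blast
  then have t: "tau base b - (frag_of f - frag_of g) \<in> Bd" unfolding tau_def by (rule transport_path)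
  have s: "spx 1 f" "supp f = {0, k}" "spx 1 g" "supp g = {0, k}" "0 < k"
    and o: "obj f {0} = obj g {0}" "obj f {k} = obj g {k}"
    using p by (simp_all add: edge_def)
  have "face 0 f = face 0 g" "face 1 f = face 1 g"
    unfolding face_edge[OF s(2,5)] face_edge[OF s(4,5)] using s o by (auto intro!: vertex_eq)
  then have "boundary 1 (frag_of f - frag_of g) = 0" by (simp add: boundary_diff boundary_1)
  moreover have C: "frag_of f - frag_of g \<in> carrier C1"
    using frag_of_C1 s by (intro C1_diff)
  moreover have bt: "boundary 1 (tau base b - (frag_of f - frag_of g)) = 0"
    "tau base b - (frag_of f - frag_of g) \<in> carrier C1"
    using t Bd_subset Bd_C1 carrier_Z1 by blast+
  ultimately have "boundary 1 (tau base b) = 0" by (simp add: boundary_diff)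
  moreover have tC: "tau base b \<in> carrier C1" using C1_add[OF bt(2) C] by simp
  ultimately show "tau base b \<in> carrier Z1" unfolding carrier_Z1 carrier_C1 by blast
  have c: "c \<in> reals" using edge_reals[OF p(1)] by simp
  have "D (tau base b) = D (tau base b - (frag_of f - frag_of g)) \<otimes>\<^bsub>A\<^esub> D (frag_of f - frag_of g)"
    using D_add[OF bt(2) C] by simp
  also have "\<dots> = D (frag_of f - frag_of g)" by (simp only: D_Bd[OF t] A.l_one[OF D_carrier[OF C]])
  also have "\<dots> = delta base c \<otimes>\<^bsub>A\<^esub> inv\<^bsub>A\<^esub> delta b c"
    using D_diff[OF frag_of_C1[OF s(1)] frag_of_C1[OF s(3)]] D_of[OF s(1)] D_of[OF s(3)]
      cocycle_edge[OF p(1) gen_base gen_base] cocycle_edge[OF p(2) gen_base gen_base] by simp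
  also have "\<dots> = delta base b"
    using delta_add[OF base_real b c] delta_carrier base_real b c by (metis A.inv_solve_right')
  finally show "D (tau base b) = delta base b" .
qed

section \<open>Shells\<close>

text \<open>All three vertices of the shell are the base vertex, with indices 0, 1 and 2.\<close>

lemma shell_exists:
  assumes a: "a \<in> reals" and b: "b \<in> reals"
  shows "\<exists>f. one_shell M B ind p f \<and> shell_supp f = {0, 1, 2} \<and> endpoint_pair M B p f a b"
proof -
  obtain c1 where c1: "c1 \<in> reals" "ind (range c1) B (range a)"
    using ind_extend[OF a small_range] by blast
  have s: "small (range c1 \<union> range b)" by (intro small_Un small_range)
  obtain c2 where c2: "c2 \<in> reals" "ind (range c2) B (range c1 \<union> range b)"
    using ind_extend[OF a s] by blast
  have lt: "(0::nat) < 1" "(0::nat) < 2" "(1::nat) < 2" by simp_all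
  obtain f2 where f2: "edge f2 0 base a 1 base c1"
    by (rule edge_exists_ind[OF lt(1) base_real a base_real c1 _ small_range]) auto
  obtain f0 where f0: "edge f0 1 base c1 2 base c2"
    by (rule edge_exists_ind[OF lt(3) base_real c1(1) base_real c2 _ s]) auto
  obtain f1 where f1: "edge f1 0 base b 2 base c2"
    by (rule edge_exists_ind[OF lt(2) base_real b base_real c2 _ s]) auto
  define f where "f j = (if j = 0 then f0 else if j = 1 then f1 else f2)" for j :: nat
  have f: "f 0 = f0" "f 1 = f1" "f 2 = f2" by (simp_all add: f_def)
  have S: "spx 1 f0" "spx 1 f1" "spx 1 f2" and su: "supp f0 = {1, 2}" "supp f1 = {0, 2}" "supp f2 = {0, 1}"
    and o: "obj f0 {1} = cl (range base)" "obj f0 {2} = cl (range base)" "obj f1 {0} = cl (range base)"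
      "obj f1 {2} = cl (range base)" "obj f2 {0} = cl (range base)" "obj f2 {1} = cl (range base)"
    using f0 f1 f2 by (simp_all only: edge_def)
  have faces: "face 0 f1 = face 0 f0" "face 0 f2 = face 1 f0" "face 1 f2 = face 1 f1"
    unfolding face_edge[OF su(1) lt(3)] face_edge[OF su(2) lt(2)] face_edge[OF su(3) lt(1)]
    using S su o by (auto intro!: vertex_eq)
  have le2: "j = 0 \<or> j = 1 \<or> j = 2" if "j \<le> 2" for j :: nat using that by auto
  have "one_shell M B ind p f"
    unfolding one_shell_def
  proof (intro conjI allI impI)
    show "spx 1 (f j)" if "j \<le> 2" for j using le2[OF that] S f by metis
    show "face i (f j) = face (j - 1) (f i)" if "i < j \<and> j \<le> 2" for i j
    proof -
      have "(i = 0 \<and> j = 1) \<or> (i = 0 \<and> j = 2) \<or> (i = 1 \<and> j = 2)" using that by auto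
      then show ?thesis using faces f by (auto simp: One_nat_def)
    qed
  qed
  moreover have "shell_supp f = {0, 1, 2}"
  proof -
    have "{..2::nat} = {0, 1, 2}" by auto
    then show ?thesis unfolding shell_supp_def using f su by auto
  qed
  moreover have "representation M B p f a c1 c2 b"
    unfolding representation_def
  proof (intro conjI exI)
    show "{a, c1, c2, b} \<subseteq> reals" using a b c1 c2 by simp
    show "(0::nat) < 1" "(1::nat) < 2" by simp_all
    show "supp (f 0) = {1, 2}" "supp (f 1) = {0, 2}" "supp (f 2) = {0, 1}" using f su by simp_all
    show "{base, base, base} \<subseteq> reals" using base_real by simp
    show "cl (range base) = obj (f 2) {0}" "cl (range base) = obj (f 2) {1}" "cl (range base) = obj (f 0) {2}"
      using f o by simp_all
    have pe: "pair_equiv M B (x, y) (mor h {i} {i, j} \<circ> base, mor h {j} {i, j} \<circ> base)"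
      if E: "edge h i base x j base y" for h i j x y
    proof -
      obtain \<tau> where "\<tau> \<in> Gal" "\<tau> \<circ> (mor h {i} {i, j} \<circ> base) = x" "\<tau> \<circ> (mor h {j} {i, j} \<circ> base) = y"
        using E by (auto simp: edge_def)
      then show ?thesis unfolding pair_equiv_def fst_conv snd_conv using pair_conjugate by metis
    qed
    show "pair_equiv M B (a, c1) (mor (f 2) {0} {0, 1} \<circ> base, mor (f 2) {1} {0, 1} \<circ> base)"
      unfolding f using pe[OF f2] .
    show "pair_equiv M B (c1, c2) (mor (f 0) {1} {1, 2} \<circ> base, mor (f 0) {2} {1, 2} \<circ> base)"
      unfolding f using pe[OF f0] .
    show "pair_equiv M B (b, c2) (mor (f 1) {0} {0, 2} \<circ> base, mor (f 1) {2} {0, 2} \<circ> base)"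
      unfolding f using pe[OF f1] .
  qed
  then have "endpoint_pair M B p f a b" unfolding endpoint_pair_def by blast
  ultimately show ?thesis by blast
qed

text \<open>
  Here the vertices of the shell need not be represented by the realizations chosen by \<open>gen\<close>; this is
  why \<open>edge\<close> and \<open>transport\<close> carry arbitrary realizations \<open>e\<close>, \<open>e'\<close> generating the vertices.
\<close>

lemma shell_tau:
  assumes f: "one_shell M B ind p f" and ab: "endpoint_pair M B p f a b"
  shows "shell_chain f - tau a b \<in> Bd"
proof -
  obtain a1 a2 where rep: "representation M B p f a a1 a2 b" using ab unfolding endpoint_pair_def by blast
  then obtain n0 n1 n2 e0 e1 e2 where n: "n0 < n1" "n1 < n2"
    and su: "supp (f 0) = {n1, n2}" "supp (f 1) = {n0, n2}" "supp (f 2) = {n0, n1}"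
    and e: "e0 \<in> reals" "e1 \<in> reals" "e2 \<in> reals"
    and o: "cl (range e0) = obj (f 2) {n0}" "cl (range e1) = obj (f 2) {n1}" "cl (range e2) = obj (f 0) {n2}"
    and pe: "pair_equiv M B (a, a1) (mor (f 2) {n0} {n0, n1} \<circ> e0, mor (f 2) {n1} {n0, n1} \<circ> e1)"
      "pair_equiv M B (a1, a2) (mor (f 0) {n1} {n1, n2} \<circ> e1, mor (f 0) {n2} {n1, n2} \<circ> e2)"
      "pair_equiv M B (b, a2) (mor (f 1) {n0} {n0, n2} \<circ> e0, mor (f 1) {n2} {n0, n2} \<circ> e2)"
    unfolding representation_def by auto
  have S: "spx 1 (f j)" if "j \<le> 2" for j using f that unfolding one_shell_def by blast
  have fc: "face i (f j) = face (j - 1) (f i)" if "i < j" "j \<le> 2" for i j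
    using f that unfolding one_shell_def by blast
  have n02: "n0 < n2" using n by simp
  have "face 0 (f 1) = face 0 (f 0)" "face 0 (f 2) = face 1 (f 0)" "face 1 (f 2) = face 1 (f 1)"
    using fc[of 0 1] fc[of 0 2] fc[of 1 2] by (simp_all add: One_nat_def)
  then have "pfunctor_restrict (f 1) {n2} = pfunctor_restrict (f 0) {n2}"
    "pfunctor_restrict (f 2) {n1} = pfunctor_restrict (f 0) {n1}"
    "pfunctor_restrict (f 2) {n0} = pfunctor_restrict (f 1) {n0}"
    unfolding face_edge[OF su(1) n(2)] face_edge[OF su(2) n02] face_edge[OF su(3) n(1)] by blast+
  then have o': "obj (f 1) {n2} = obj (f 0) {n2}" "obj (f 2) {n1} = obj (f 0) {n1}"
    "obj (f 2) {n0} = obj (f 1) {n0}"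
    using restrict_simps(2) order_refl by metis+
  have E: "edge h i e x j e' y"
    if "spx 1 h" "i < j" "supp h = {i, j}" "e \<in> reals" "e' \<in> reals" "obj h {i} = cl (range e)"
      "obj h {j} = cl (range e')"
      and pe: "pair_equiv M B (x, y) (mor h {i} {i, j} \<circ> e, mor h {j} {i, j} \<circ> e')" for h i e x j e' y
  proof -
    have "\<exists>\<sigma>\<in>Gal. \<sigma> \<circ> (mor h {i} {i, j} \<circ> e) = x \<and> \<sigma> \<circ> (mor h {j} {i, j} \<circ> e') = y"
      using pe pair_conjugate unfolding pair_equiv_def fst_conv snd_conv by metis
    then show ?thesis unfolding edge_def using that by blast
  qed
  have E2: "edge (f 2) n0 e0 a n1 e1 a1"
    by (rule E[OF S n(1) su(3) e(1,2) _ _ pe(1)]) (simp_all add: o)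
  have E0: "edge (f 0) n1 e1 a1 n2 e2 a2"
    by (rule E[OF S n(2) su(1) e(2,3) _ _ pe(2)]) (simp_all add: o o')
  have E1: "edge (f 1) n0 e0 b n2 e2 a2"
    by (rule E[OF S n02 su(2) e(1,3) _ _ pe(3)]) (simp_all add: o o')
  have r: "a \<in> reals" "a1 \<in> reals" "a2 \<in> reals" "b \<in> reals"
    using edge_reals[OF E2] edge_reals[OF E1] by simp_all
  have "shell_chain f - tau a b =
      (frag_of (f 0) - (mu n1 e1 - mu n2 e2 + tau a1 a2)) - (frag_of (f 1) - (mu n0 e0 - mu n2 e2 + tau b a2))
      + (frag_of (f 2) - (mu n0 e0 - mu n1 e1 + tau a a1))
      + (tau a a1 + tau a1 a2 - tau a a2) - (tau a b + tau b a2 - tau a a2)"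
    by (simp add: shell_chain_def)
  then show ?thesis
    using edge_split[OF E0] edge_split[OF E1] edge_split[OF E2] tau_add[OF r(1,2,3)] tau_add[OF r(1,4,3)]
    by (simp only: Bd_add Bd_diff)
qed

section \<open>The first homology group\<close>

abbreviation H1 :: "('m pfunctor \<Rightarrow>\<^sub>0 int) set monoid" where "H1 \<equiv> homology M B ind p 1"
abbreviation cls :: "('m pfunctor \<Rightarrow>\<^sub>0 int) \<Rightarrow> ('m pfunctor \<Rightarrow>\<^sub>0 int) set" where
  "cls \<equiv> homology_class M B ind p 1"

lemma mult_Z1: "x \<otimes>\<^bsub>Z1\<^esub> y = x + y"
  by (simp add: cycle_group_def chain_group_def)

lemma cls_iff: "cls x = cls y \<longleftrightarrow> x - y \<in> Bd"
proof -
  have c: "z \<in> cls x \<longleftrightarrow> z - x \<in> Bd" for z x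
    unfolding homology_class_def r_coset_def mult_Z1 by (auto simp: algebra_simps) (metis diff_add_cancel add.commute)
  show ?thesis
  proof
    assume "cls x = cls y"
    moreover have "x \<in> cls x" by (simp add: c)
    ultimately show "x - y \<in> Bd" using c by blast
  next
    assume xy: "x - y \<in> Bd"
    have "z - x \<in> Bd \<longleftrightarrow> z - y \<in> Bd" for z
      using Bd_add[OF _ xy, of "z - x"] Bd_diff[OF _ xy, of "z - y"] by auto
    then show "cls x = cls y" using c by blast
  qed
qed

lemma Z1_subgroup: "subgroup (carrier Z1) C1"
proof -
  interpret C1: group C1 by (simp add: chain_group_def)
  show ?thesis
  proof (rule C1.subgroupI)
    show "carrier Z1 \<subseteq> carrier C1" by (auto simp: cycle_group_def)
    show "carrier Z1 \<noteq> {}" using Bd_0 Bd_subset by blast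
    fix a assume a: "a \<in> carrier Z1"
    then have "inv\<^bsub>C1\<^esub> a = - a" by (simp add: chain_group_def cycle_group_def)
    then show "inv\<^bsub>C1\<^esub> a \<in> carrier Z1" using a by (simp add: carrier_Z1 boundary_minus)
    fix b assume b: "b \<in> carrier Z1"
    have "a \<otimes>\<^bsub>C1\<^esub> b = a + b" by (simp add: chain_group_def)
    then show "a \<otimes>\<^bsub>C1\<^esub> b \<in> carrier Z1"
      using a b keys_add[of a b] by (auto simp: carrier_Z1 boundary_add)
  qed
qed

lemma comm_group_Z1: "comm_group Z1"
proof -
  interpret C1: group C1 by (simp add: chain_group_def)
  have "C1\<lparr>carrier := carrier Z1\<rparr> = Z1" by (simp add: cycle_group_def)
  then interpret Z1: group Z1 using C1.subgroup_imp_group[OF Z1_subgroup] by simp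
  show ?thesis by (rule Z1.group_comm_groupI) (simp add: mult_Z1 add.commute)
qed

interpretation Z1: comm_group Z1
  by (rule comm_group_Z1)

lemma Bd_normal: "Bd \<lhd> Z1"
proof (rule Z1.subgroup_imp_normal, rule Z1.subgroupI)
  show "Bd \<subseteq> carrier Z1" by (rule Bd_subset)
  show "Bd \<noteq> {}" using Bd_0 by blast
  fix a assume a: "a \<in> Bd"
  have "\<one>\<^bsub>Z1\<^esub> = 0" by (simp add: cycle_group_def chain_group_def)
  then have "(- a) \<otimes>\<^bsub>Z1\<^esub> a = \<one>\<^bsub>Z1\<^esub>" by (simp add: mult_Z1)
  then have "inv\<^bsub>Z1\<^esub> a = - a" using a Bd_minus[OF a] Bd_subset by (intro Z1.inv_equality) auto
  then show "inv\<^bsub>Z1\<^esub> a \<in> Bd" using Bd_minus[OF a] by simp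
  fix b assume "b \<in> Bd"
  then show "a \<otimes>\<^bsub>Z1\<^esub> b \<in> Bd" using Bd_add[OF a] by (simp add: mult_Z1)
qed

lemma carrier_H1: "carrier H1 = cls ` carrier Z1"
  by (auto simp: homology_def FactGroup_def RCOSETS_def homology_class_def)

lemma mult_H1: "x \<in> carrier Z1 \<Longrightarrow> y \<in> carrier Z1 \<Longrightarrow> cls x \<otimes>\<^bsub>H1\<^esub> cls y = cls (x + y)"
  using normal.rcos_sum[OF Bd_normal, of x y] by (simp add: homology_def FactGroup_def homology_class_def mult_Z1)

lemma one_H1: "\<one>\<^bsub>H1\<^esub> = cls 0"
proof -
  have "cls 0 = Bd" unfolding homology_class_def r_coset_def mult_Z1 by auto
  then show ?thesis by (simp add: homology_def FactGroup_def)
qed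

lemma comm_group_H1: "comm_group H1"
proof -
  interpret H1: group H1 unfolding homology_def by (rule normal.factorgroup_is_group[OF Bd_normal])
  show ?thesis
  proof (rule H1.group_comm_groupI)
    fix x y assume "x \<in> carrier H1" "y \<in> carrier H1"
    then show "x \<otimes>\<^bsub>H1\<^esub> y = y \<otimes>\<^bsub>H1\<^esub> x" unfolding carrier_H1 by (auto simp: mult_H1 add.commute)
  qed
qed

lemma bracket_tau:
  assumes "a \<in> reals" "b \<in> reals"
  shows "bracket M B ind p a b = cls (tau a b)"
  unfolding bracket_def
proof (rule the_equality)
  obtain f where f: "one_shell M B ind p f" "shell_supp f = {0, 1, 2}" "endpoint_pair M B p f a b"
    using shell_exists[OF assms] by blast
  then have "cls (tau a b) = cls (shell_chain f)" using shell_tau[OF f(1,3)] cls_iff by metis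
  then show "\<exists>f. one_shell M B ind p f \<and> shell_supp f = {0, 1, 2} \<and> endpoint_pair M B p f a b \<and>
      cls (tau a b) = cls (shell_chain f)"
    using f by blast
  fix c assume "\<exists>f. one_shell M B ind p f \<and> shell_supp f = {0, 1, 2} \<and> endpoint_pair M B p f a b \<and>
      c = cls (shell_chain f)"
  then show "c = cls (tau a b)" using shell_tau cls_iff by blast
qed

abbreviation \<psi> :: "(('x \<Rightarrow> 'm) \<Rightarrow> 'x \<Rightarrow> 'm) \<Rightarrow> ('m pfunctor \<Rightarrow>\<^sub>0 int) set" where
  "\<psi> \<equiv> psi M B ind p"

lemma psi_tau:
  assumes g: "g \<in> carrier G"
  shows "\<psi> g = cls (tau base (g base))"
proof -
  obtain \<sigma> where \<sigma>: "\<sigma> \<in> Gal" "g = act \<sigma>" using g unfolding carrier_G by blast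
  have eq: "bracket M B ind p a (g a) = cls (tau base (g base))" if a: "a \<in> reals" for a
  proof -
    have r: "\<sigma> \<circ> a \<in> reals" "\<sigma> \<circ> base \<in> reals" using reals_Gal[OF _ \<sigma>(1)] a base_real by simp_all
    have "tau a (\<sigma> \<circ> a) - tau base (\<sigma> \<circ> base) =
       (tau a (\<sigma> \<circ> a) + tau (\<sigma> \<circ> a) (\<sigma> \<circ> base) - tau a (\<sigma> \<circ> base))
       - (tau (\<sigma> \<circ> a) (\<sigma> \<circ> base) - tau a base)
       - (tau a base + tau base (\<sigma> \<circ> base) - tau a (\<sigma> \<circ> base))" by simp
    also have "\<dots> \<in> Bd" by (intro Bd_diff tau_add tau_Gal a r base_real \<sigma>(1))
    finally have "cls (tau a (\<sigma> \<circ> a)) = cls (tau base (\<sigma> \<circ> base))" by (simp only: cls_iff)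
    then show ?thesis using a r base_real by (simp add: \<sigma>(2) bracket_tau)
  qed
  show ?thesis
    unfolding psi_def
  proof (rule the_equality)
    show "\<forall>a\<in>reals. cls (tau base (g base)) = bracket M B ind p a (g a)" using eq by simp
    show "c = cls (tau base (g base))" if "\<forall>a\<in>reals. c = bracket M B ind p a (g a)" for c
      using that eq[OF base_real] base_real by simp
  qed
qed

lemma psi_hom: "\<psi> \<in> hom G H1"
proof (rule homI)
  fix g assume g: "g \<in> carrier G"
  have gb: "g base \<in> reals" using G_closed[OF g base_real] .
  then show "\<psi> g \<in> carrier H1" unfolding psi_tau[OF g] carrier_H1 using tau_cycle_D(1) by blast
  fix h assume h: "h \<in> carrier G"
  have hb: "h base \<in> reals" using G_closed[OF h base_real] .
  have ghb: "g (h base) \<in> reals" using G_closed[OF g hb] .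
  obtain \<sigma> where \<sigma>: "\<sigma> \<in> Gal" "g = act \<sigma>" using g unfolding carrier_G by blast
  have "tau (g base) (g (h base)) - tau base (h base) \<in> Bd"
    using tau_Gal[OF base_real hb \<sigma>(1)] base_real hb by (simp add: \<sigma>(2))
  then have "(tau (g base) (g (h base)) - tau base (h base))
      - (tau base (g base) + tau (g base) (g (h base)) - tau base (g (h base))) \<in> Bd"
    using tau_add[OF base_real gb ghb] by (rule Bd_diff)
  then have "cls (tau base (g (h base))) = cls (tau base (g base) + tau base (h base))"
    unfolding cls_iff by (simp add: algebra_simps)
  then show "\<psi> (g \<otimes>\<^bsub>G\<^esub> h) = \<psi> g \<otimes>\<^bsub>H1\<^esub> \<psi> h"
    using g h gb hb tau_cycle_D(1) base_real by (simp add: psi_tau mult_H1 mult_G_apply)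
qed

lemma psi_surj: "\<psi> ` carrier G = carrier H1"
proof
  show "\<psi> ` carrier G \<subseteq> carrier H1" using hom_in_carrier[OF psi_hom] by blast
  show "carrier H1 \<subseteq> \<psi> ` carrier G"
  proof
    fix x assume "x \<in> carrier H1"
    then obtain c where c: "c \<in> carrier Z1" "x = cls c" unfolding carrier_H1 by blast
    obtain b where b: "b \<in> reals" "c - tau base b \<in> Bd" using cycle_tau[OF c(1)] by blast
    obtain g where g: "g \<in> carrier G" "g base = b" using G_transitive[OF base_real b(1)] by blast
    have "x = \<psi> g" using b(2) unfolding c(2) psi_tau[OF g(1)] g(2) cls_iff .
    then show "x \<in> \<psi> ` carrier G" using g(1) by blast
  qed
qed

lemma group_hom_psi: "group_hom G H1 \<psi>"
  using group_G comm_group_H1 psi_hom by (simp add: group_hom_def group_hom_axioms_def comm_group_def)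

interpretation psi: group_hom G H1 \<psi>
  by (rule group_hom_psi)

lemma psi_commG: "g \<in> commG \<Longrightarrow> \<psi> g = \<one>\<^bsub>H1\<^esub>"
proof -
  assume g: "g \<in> commG"
  interpret H1: comm_group H1 by (rule comm_group_H1)
  have "\<psi> ` commG = {\<one>\<^bsub>H1\<^esub>}"
    using psi.derived_img[of "carrier G"] H1.derived_eq_singleton[of "\<psi> ` carrier G"] psi_surj by simp
  then show ?thesis using g by blast
qed

lemma kernel_psi: "kernel G H1 \<psi> = K0"
proof
  show "K0 \<subseteq> kernel G H1 \<psi>"
  proof
    fix g assume g: "g \<in> K0"
    then have gG: "g \<in> carrier G" using K0_carrier by blast
    obtain h where h: "h \<in> commG" "g base = h base" using g base_real by (auto simp: K0_def)
    have "\<psi> g = \<psi> h" unfolding psi_tau[OF gG] psi_tau[OF commG_carrier[OF h(1)]] h(2) ..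
    then show "g \<in> kernel G H1 \<psi>" using gG psi_commG[OF h(1)] by (simp add: kernel_def)
  qed
  show "kernel G H1 \<psi> \<subseteq> K0"
  proof
    fix g assume "g \<in> kernel G H1 \<psi>"
    then have g: "g \<in> carrier G" "\<psi> g = \<one>\<^bsub>H1\<^esub>" by (simp_all add: kernel_def)
    then have "tau base (g base) \<in> Bd" unfolding psi_tau[OF g(1)] one_H1 cls_iff by simp
    then have "D (tau base (g base)) = K0" using D_Bd A_one by metis
    then have "K0 #>\<^bsub>G\<^esub> g = K0"
      using tau_cycle_D(2)[OF G_closed[OF g(1) base_real]] delta_eq[OF g(1) base_real refl] by simp
    then show "g \<in> K0" using G.rcos_self[OF g(1) K0_subgroup] by simp
  qed
qed

lemma K0_orbits:
  "K0 = {g \<in> carrier G. \<forall>Y \<in> orbits (G\<lparr>carrier := commG\<rparr>) reals (\<lambda>g. g). g ` Y = Y}"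
proof -
  have orb: "orbit (G\<lparr>carrier := commG\<rparr>) (\<lambda>g. g) a = {h a | h. h \<in> commG}" for a
    by (simp add: orbit_def)
  have sub: "g ` {h a | h. h \<in> commG} \<subseteq> {h a | h. h \<in> commG}" if g: "g \<in> K0" and a: "a \<in> reals" for g a
  proof
    fix y assume "y \<in> g ` {h a | h. h \<in> commG}"
    then obtain h where h: "h \<in> commG" "y = g (h a)" by blast
    obtain k where k: "k \<in> commG" "g (h a) = k (h a)"
      using g G_closed[OF commG_carrier[OF h(1)] a] by (auto simp: K0_def)
    have "y = (k \<otimes>\<^bsub>G\<^esub> h) a" using h k commG_carrier a by (simp add: mult_G_apply)
    then show "y \<in> {h a | h. h \<in> commG}" using subgroup.m_closed[OF commG_subgroup k(1) h(1)] by blast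
  qed
  show ?thesis
  proof (intro subset_antisym subsetI)
    fix g assume g: "g \<in> K0"
    have gG: "g \<in> carrier G" using g K0_carrier by blast
    have "g ` Y = Y" if Y: "Y \<in> orbits (G\<lparr>carrier := commG\<rparr>) reals (\<lambda>g. g)" for Y
    proof -
      obtain a where a: "a \<in> reals" "Y = {h a | h. h \<in> commG}"
        using Y unfolding orbits_def orb by blast
      show "g ` Y = Y"
      proof
        show "g ` Y \<subseteq> Y" using sub[OF g a(1)] a(2) by simp
        show "Y \<subseteq> g ` Y"
        proof
          fix y assume y: "y \<in> Y"
          have yr: "y \<in> reals" using y a G_closed commG_carrier by auto
          have "(inv\<^bsub>G\<^esub> g) y \<in> Y"
            using sub[OF subgroup.m_inv_closed[OF K0_subgroup g] a(1)] y a(2) by blast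
          moreover have "y = g ((inv\<^bsub>G\<^esub> g) y)" using inv_G_apply(2)[OF gG yr] by simp
          ultimately show "y \<in> g ` Y" by blast
        qed
      qed
    qed
    then show "g \<in> {g \<in> carrier G. \<forall>Y \<in> orbits (G\<lparr>carrier := commG\<rparr>) reals (\<lambda>g. g). g ` Y = Y}"
      using gG by blast
  next
    fix g assume "g \<in> {g \<in> carrier G. \<forall>Y \<in> orbits (G\<lparr>carrier := commG\<rparr>) reals (\<lambda>g. g). g ` Y = Y}"
    then have g: "g \<in> carrier G" "\<And>Y. Y \<in> orbits (G\<lparr>carrier := commG\<rparr>) reals (\<lambda>g. g) \<Longrightarrow> g ` Y = Y" by auto
    let ?Y = "{h base | h. h \<in> commG}"
    have "?Y \<in> orbits (G\<lparr>carrier := commG\<rparr>) reals (\<lambda>g. g)"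
      unfolding orbits_def orb using base_real by blast
    then have "g ` ?Y = ?Y" by (rule g(2))
    moreover have "base \<in> ?Y"
      using subgroup.one_closed[OF commG_subgroup] one_G_apply[OF base_real]
      by (intro CollectI exI[of _ "\<one>\<^bsub>G\<^esub>"]) simp
    ultimately have "g base \<in> ?Y" by blast
    then show "g \<in> K0" using K0_I[OF g(1) base_real] by blast
  qed
qed

end

theorem theorem4p4:
  fixes M :: "('s, 'f, 'r, 'm) struct"
    and T :: "('s, 'f, 'r) fml set"
    and ind :: "'m indrel"
    and B :: "'m set"
    and p :: "('s, 'f, 'r, 'x, 'm) pformula set"
  assumes "complete_theory M T" and "is_model M T" and "monster M" and "has_imaginaries M"
    and "star_independence M ind"
    and "small B" and "acl M B = B"
    and "(UNIV :: 'x set) \<prec> (UNIV :: 'm set)"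
    and "\<exists>a. p = tp M B a \<and>
           (range a = acl M (range a \<union> B) \<or> acl M (range a \<union> B) = dcl M (range a \<union> B))"
  shows "let G = AutP M B p;
             G' = derived G (carrier G);
             H\<^sub>1 = homology M B ind p 1;
             \<psi> = psi M B ind p;
             K = kernel G H\<^sub>1 \<psi>
         in (\<forall>h\<in>K. \<forall>a\<in>realizations M B p. \<exists>h'\<in>G'. h a = h' a) \<and>
            G' \<subseteq> K \<and> K \<lhd> G \<and>
            K = {g \<in> carrier G.
                   \<forall>X \<in> orbits (G\<lparr>carrier := G'\<rparr>) (realizations M B p) (\<lambda>g. g). g ` X = X} \<and>
            \<psi> \<in> hom G H\<^sub>1 \<and>
            (\<lambda>X. the_elem (\<psi> ` X)) \<in> iso (G Mod K) H\<^sub>1"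
proof -
  interpret homology_setting M ind B p
    using assms by unfold_locales (simp_all add: is_model_def lesspoll_iff_ordLess)
  interpret psi: group_hom "AutP M B p" "homology M B ind p 1" "psi M B ind p"
    by (rule group_hom_psi)
  have "\<forall>h\<in>K0. \<forall>a\<in>realizations M B p. \<exists>h'\<in>commG. h a = h' a"
    unfolding K0_def by blast
  then show ?thesis
    unfolding Let_def kernel_psi
    using commG_sub_K0 K0_normal K0_orbits psi_hom psi.FactGroup_iso_set[OF psi_surj, unfolded kernel_psi]
    by (intro conjI)
qed

end
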